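(* Let $(X_n)_{n\in\mathbb{N}}$ be the BST chain and let $X_\infty$ be its limit, with $X_\infty(u)$ denoting $X_\infty(A_u)$ for $u\in\mathbb{V}$. The series $$Z_\infty:=\sum_{u\in\mathbb{V}}X_\infty(u)^2$$ converges almost surely and in quadratic mean, and, as $n\to\infty$, $$\frac{1}{n^2}\,\mathrm{WI}(X_n)-2\log n\ \to\ W_\infty,$$ again almost surely and in quadratic mean, where the limit is given by $$W_\infty:=2\gamma-3+Y_\infty-Z_\infty,$$ with $\gamma$ Euler's constant and $$Y_\infty:=\lim_{k\to\infty}\ \sum_{u\in\mathbb{V},\,|u|\le k}X_\infty(u)\,C\!\left(\frac{X_\infty(u0)}{X_\infty(u)}\right),\qquad C(s):=1+2\bigl(s\log(s)+(1-s)\log(1-s)\bigr)\ \ (0<s<1).$$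
   Context: Nodes. $\mathbb{V}=\bigsqcup_{k\ge 0}\{0,1\}^k$ is the set of all finite 0--1 sequences (nodes), $\varnothing$ is the empty sequence, $|u|$ is the length of $u$, and $\partial\mathbb{V}=\{0,1\}^\infty$; $\bar{\mathbb{V}}=\mathbb{V}\cup\partial\mathbb{V}$. For $u=(u_1,\dots,u_k)\in\mathbb{V}$ write $u0=(u_1,\dots,u_k,0)$, and, if $k\ge1$, $\bar u=(u_1,\dots,u_{k-1})$ (the parent). Write $u\le v$ if $u$ is a prefix of $v$ ($v\in\bar{\mathbb{V}}$), $u\wedge v$ for the longest common prefix, and $A_u=\{v\in\partial\mathbb{V}: v\ge u\}$. $\bar{\mathbb{V}}$ is the completion of $\mathbb{V}$ under the metric $d_{\mathbb{V}}(u,v)=2^{-|u\wedge v|}-\frac12(2^{-|u|}+2^{-|v|})$. Binary trees. A binary tree is a prefix-stable set $x\subset\mathbb{V}$ ($u\in x$ and $v\le u$ imply $v\in x$), regarded as a graph with edges $(\bar u,u)$, $u\in x$, $u\ne\varnothing$. For a finite nonempty binary tree $x$: $\partial x=\{u\in\mathbb{V}:\bar u\in x,\ u\notin x\}$ is the set of external nodes, and $\sigma(x,u)=\#\{v\in x:u\le v\}$. The Wiener index is $\mathrm{WI}(x)=\frac12\sum_{(u,v)\in x\times x}d_{\mathrm{can}}(u,v)$, where $d_{\mathrm{can}}(u,v)$ is the graph distance (minimum number of edges on a path from $u$ to $v$), i.e. $d_{\mathrm{can}}(u,v)=|u|+|v|-2|u\wedge v|$. BST chain. This is the Markov chain $(X_n)_{n\in\mathbb{N}}$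 of finite binary trees with $X_1=\{\varnothing\}$ in which, given $X_n$, the tree $X_{n+1}$ is $X_n\cup\{u\}$ with $u$ chosen uniformly at random from the $n+1$ external nodes of $X_n$; it is the sequence of trees produced by the binary search tree algorithm applied to i.i.d. uniform$(0,1)$ input. Its limit $X_\infty$ is the random probability measure on $\partial\mathbb{V}$ that is the almost sure weak limit, on $(\bar{\mathbb{V}},d_{\mathbb{V}})$, of the uniform distributions on the sets $X_n$; equivalently, almost surely $X_\infty(A_u)=\lim_{n\to\infty}\sigma(X_n,u)/n$ for all $u\in\mathbb{V}$. Almost surely $0<X_\infty(A_{u0})/X_\infty(A_u)<1$ for all $u$. The limit defining $Y_\infty$ exists almost surely and in quadratic mean. Convergence in quadratic mean is convergence in $L^2$. *)

theory Defs
  imports "HOL-Probability.Probability" "HOL-Library.Sublist"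
begin

section \<open>Nodes and the space of finite and infinite 0-1 sequences\<close>

text \<open>A node is a \<^typ>\<open>bool list\<close> (\<^const>\<open>False\<close> is the digit 0); the parent of a
  nonempty \<open>u\<close> is \<^term>\<open>butlast u\<close>. The following type adds the infinite sequences.\<close>

datatype seq01 = Node "bool list" | End "nat \<Rightarrow> bool"

definition boundary :: "seq01 set"
  where "boundary = range End"

fun depth :: "seq01 \<Rightarrow> enat" where
  "depth (Node u) = enat (length u)"
| "depth (End w) = \<infinity>"

fun below :: "bool list \<Rightarrow> seq01 \<Rightarrow> bool" where
  "below u (Node v) = prefix u v"
| "below u (End w) = (\<forall>i < length u. u ! i = w i)"

definition cone :: "bool list \<Rightarrow> seq01 set"
  where "cone u = {v \<in> boundary. below u v}"

text \<open>The length of the longest common prefix; it is infinite if both arguments are the same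
  infinite sequence.\<close>

definition meet_len :: "seq01 \<Rightarrow> seq01 \<Rightarrow> enat"
  where "meet_len u v = Sup {enat (length p) | p. below p u \<and> below p v}"

fun half_pow :: "enat \<Rightarrow> real" where
  "half_pow (enat k) = (1/2) ^ k"
| "half_pow \<infinity> = 0"

lemma half_pow_antimono: "a \<le> b \<Longrightarrow> half_pow b \<le> half_pow a"
  by (cases a; cases b) (auto intro: power_decreasing)

lemma half_pow_inj: "half_pow a = half_pow b \<Longrightarrow> a = b"
  by (cases a; cases b) (auto simp: power_inject_exp')

lemma below_len: "below p v \<Longrightarrow> enat (length p) \<le> depth v"
  by (cases v) (auto simp: prefix_length_le)

lemma below_total:
  assumes "below p w" "below q w"
  shows "prefix p q \<or> prefix q p"
proof (cases w)
  case (Node v)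
  then show ?thesis using assms by (simp add: prefix_same_cases)
next
  case (End v)
  have "r = map v [0..<length r]" if "below r w" for r
    using that End by (auto intro!: nth_equalityI)
  then have "p = map v [0..<length p]" "q = map v [0..<length q]"
    using assms by blast+
  moreover have "prefix (map v [0..<i]) (map v [0..<j])" if "i \<le> j" for i j
  proof -
    have "[0..<j] = [0..<i] @ [i..<j]"
      using upt_add_eq_append[of 0 i "j - i"] that by simp
    then show ?thesis by simp
  qed
  moreover have "length p \<le> length q \<or> length q \<le> length p" by linarith
  ultimately show ?thesis by metis
qed

lemma below_prefix: "prefix p q \<Longrightarrow> below q v \<Longrightarrow> below p v"
proof (cases v)
  case (End w)
  assume "prefix p q" "below q v"
  then obtain r where q: "q = p @ r" "\<forall>i < length q. q ! i = w i"
    using End by (auto simp: prefix_def)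
  have "p ! i = w i" if "i < length p" for i
    using q(2)[rule_format, of i] that unfolding q(1) by (simp add: nth_append)
  then show ?thesis using End by simp
qed (auto dest: prefix_order.trans)

lemma meet_len_le: "meet_len u v \<le> depth u" "meet_len u v \<le> depth v"
  unfolding meet_len_def by (auto intro!: Sup_least below_len)

lemma meet_len_commute: "meet_len u v = meet_len v u"
  unfolding meet_len_def by (simp add: conj_commute)

lemma meet_len_iff: "k < meet_len u v \<longleftrightarrow> (\<exists>p. below p u \<and> below p v \<and> k < enat (length p))"
  unfolding meet_len_def less_Sup_iff by auto

lemma meet_len_min: "min (meet_len u w) (meet_len w v) \<le> meet_len u v"
proof (rule ccontr)
  assume "\<not> ?thesis"
  then have "meet_len u v < meet_len u w" "meet_len u v < meet_len w v"
    by (simp_all add: min_le_iff_disj not_le)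
  then obtain p q where pq: "below p u" "below p w" "meet_len u v < enat (length p)"
    "below q w" "below q v" "meet_len u v < enat (length q)"
    unfolding meet_len_iff by auto
  from below_total[OF pq(2,4)] have "meet_len u v < meet_len u v"
    using pq below_prefix meet_len_iff by meson
  then show False by simp
qed

lemma meet_len_eqD:
  assumes "meet_len u v = depth u" "meet_len u v = depth v"
  shows "u = v"
proof (cases u)
  case (Node a)
  then obtain b where b: "v = Node b" "length a = length b" using assms by (cases v) auto
  show ?thesis
  proof (cases "a = []")
    case False
    then have "enat (length a - 1) < depth u"
      using Node by (cases a) auto
    then have "enat (length a - 1) < meet_len u v" using assms(1) by simp
    then obtain p where "below p u" "below p v" and l: "length a - 1 < length p"
      unfolding meet_len_iff by auto
    then have p: "prefix p a" "prefix p b" using Node b by simp_all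
    have eq: "p = c" if c: "prefix p c" "length c = length a" for c
    proof -
      obtain r where r: "c = p @ r" using c(1) by (auto simp: prefix_def)
      then have "length p + length r = length a" using c(2) by simp
      then have "r = []" using l by (cases r) auto
      then show ?thesis using r by simp
    qed
    have "a = b" using eq[OF p(1) refl] eq[OF p(2) b(2)[symmetric]] by simp
    then show ?thesis using b Node by simp
  qed (use b Node in auto)
next
  case (End a)
  then obtain b where b: "v = End b" using assms by (cases v) auto
  have "a i = b i" for i
  proof -
    have "enat i < meet_len u v" using assms End by simp
    then show ?thesis using b End unfolding meet_len_iff by auto
  qed
  then show ?thesis using b End by auto
qed

lemma meet_len_self: "meet_len u u = depth u"
proof (cases u)
  case (Node a)
  then have "enat (length a) \<le> meet_len u u"
    unfolding meet_len_def by (intro Sup_upper) auto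
  then show ?thesis using meet_len_le(1)[of u u] Node by simp
next
  case (End a)
  have "enat i < meet_len u u" for i
    unfolding meet_len_iff using End by (intro exI[of _ "map a [0..<Suc i]"]) (auto simp del: upt_Suc)
  then have "meet_len u u = \<infinity>"
    by (cases "meet_len u u") (auto dest: less_imp_neq)
  then show ?thesis using End by simp
qed

text \<open>The metric is $2^{-|u \wedge v|} - (2^{-|u|} + 2^{-|v|})/2$, with $2^{-\infty} = 0$.\<close>

instantiation seq01 :: metric_space
begin

definition dist_seq01 :: "seq01 \<Rightarrow> seq01 \<Rightarrow> real" where
  "dist_seq01 u v = half_pow (meet_len u v) - (half_pow (depth u) + half_pow (depth v)) / 2"

definition uniformity_seq01 :: "(seq01 \<times> seq01) filter" where
  "uniformity_seq01 = (INF e\<in>{0<..}. principal {(x, y). dist x y < e})"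

definition open_seq01 :: "seq01 set \<Rightarrow> bool" where
  "open_seq01 U = (\<forall>x\<in>U. \<forall>\<^sub>F (x', y) in uniformity. x' = x \<longrightarrow> y \<in> U)"

instance
proof
  fix u v w :: seq01
  have le: "half_pow (depth a) \<le> half_pow (meet_len a b)"
    "half_pow (depth a) \<le> half_pow (meet_len b a)" for a b
    by (simp_all add: half_pow_antimono meet_len_le)
  show "dist u v = 0 \<longleftrightarrow> u = v"
  proof
    assume "dist u v = 0"
    then have "half_pow (meet_len u v) = half_pow (depth u)"
      "half_pow (meet_len u v) = half_pow (depth v)"
      using le(1)[of u v] le(2)[of v u] unfolding dist_seq01_def by argo+
    then show "u = v" by (intro meet_len_eqD half_pow_inj)
  qed (simp add: dist_seq01_def meet_len_self)
  have "half_pow (meet_len u v) \<le> half_pow (min (meet_len u w) (meet_len w v))"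
    by (intro half_pow_antimono meet_len_min)
  also have "\<dots> \<le> max (half_pow (meet_len u w)) (half_pow (meet_len w v))"
    by (auto simp: min_def)
  finally have "half_pow (meet_len u v)
      \<le> half_pow (meet_len u w) + half_pow (meet_len w v) - half_pow (depth w)"
    using le(2)[of w u] le(1)[of w v] by linarith
  then show "dist u v \<le> dist u w + dist v w"
    by (simp add: dist_seq01_def meet_len_commute[of v w] field_simps)
qed (simp_all add: uniformity_seq01_def open_seq01_def)

end

section \<open>Binary trees and the Wiener index\<close>

definition binary_tree :: "bool list set \<Rightarrow> bool"
  where "binary_tree x \<longleftrightarrow> (\<forall>u\<in>x. \<forall>v. prefix v u \<longrightarrow> v \<in> x)"

definition finite_trees :: "bool list set set"
  where "finite_trees = {x. finite x \<and> x \<noteq> {} \<and> binary_tree x}"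

definition external_nodes :: "bool list set \<Rightarrow> bool list set"
  where "external_nodes x = {u. u \<noteq> [] \<and> butlast u \<in> x \<and> u \<notin> x}"

text \<open>The edges join \<^term>\<open>butlast u\<close> and \<open>u\<close>, taken in both directions.\<close>

definition tree_edges :: "bool list set \<Rightarrow> (bool list \<times> bool list) set"
  where "tree_edges x = (let D = {(butlast u, u) | u. u \<in> x \<and> u \<noteq> []} in D \<union> D\<inverse>)"

definition graph_dist :: "bool list set \<Rightarrow> bool list \<Rightarrow> bool list \<Rightarrow> nat"
  where "graph_dist x u v = (LEAST n. (u, v) \<in> tree_edges x ^^ n)"

definition wiener_index :: "bool list set \<Rightarrow> real"
  where "wiener_index x = 1/2 * (\<Sum>(u, v)\<in>x \<times> x. real (graph_dist x u v))"

lemma tree_edges_iff: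
  "(u, v) \<in> tree_edges x \<longleftrightarrow> (\<exists>b. v = u @ [b] \<and> v \<in> x) \<or> (\<exists>b. u = v @ [b] \<and> u \<in> x)"
  unfolding tree_edges_def Let_def
  by (auto simp: append_butlast_last_id) (metis append_butlast_last_id)+

lemma length_lcp_ge: "prefix p u \<Longrightarrow> prefix p v \<Longrightarrow> length p \<le> length (longest_common_prefix u v)"
  by (intro prefix_length_le longest_common_prefix_max_prefix)

lemma walk_length_ge:
  "(u, v) \<in> tree_edges x ^^ n \<Longrightarrow> length u + length v \<le> n + 2 * length (longest_common_prefix u v)"
proof (induction n arbitrary: v)
  case 0
  then show ?case using length_lcp_ge[of u u u] by simp
next
  case (Suc n)
  then obtain w where w: "(u, w) \<in> tree_edges x ^^ n" "(w, v) \<in> tree_edges x" by auto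
  let ?p = "longest_common_prefix u w"
  from w(2) consider b where "v = w @ [b]" | b where "w = v @ [b]"
    unfolding tree_edges_iff by auto
  then show ?case
  proof cases
    case 1
    have "prefix ?p v"
      unfolding 1 by (rule prefix_prefix) (rule longest_common_prefix_prefix2)
    then have "length ?p \<le> length (longest_common_prefix u v)"
      by (intro length_lcp_ge longest_common_prefix_prefix1)
    then show ?thesis using Suc.IH[OF w(1)] 1 by simp
  next
    case 2
    have "prefix ?p (v @ [b])" using 2 longest_common_prefix_prefix2 by metis
    then have "prefix (butlast ?p) v"
      by (metis butlast_snoc prefix_snoc prefix_order.trans prefixeq_butlast)
    moreover have "prefix (butlast ?p) u"
      by (meson longest_common_prefix_prefix1 prefix_order.trans prefixeq_butlast)
    ultimately have "length (butlast ?p) \<le> length (longest_common_prefix u v)"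
      by (intro length_lcp_ge)
    then show ?thesis using Suc.IH[OF w(1)] 2 by simp
  qed
qed

lemma down_walk:
  "binary_tree x \<Longrightarrow> p @ r \<in> x \<Longrightarrow>
    (p, p @ r) \<in> tree_edges x ^^ length r \<and> (p @ r, p) \<in> tree_edges x ^^ length r"
proof (induction r rule: rev_induct)
  case (snoc b r)
  have "prefix (p @ r) (p @ r @ [b])" by simp
  then have "p @ r \<in> x" using snoc.prems unfolding binary_tree_def by blast
  note IH = snoc.IH[OF snoc.prems(1) this]
  have e: "(p @ r, p @ r @ [b]) \<in> tree_edges x" "(p @ r @ [b], p @ r) \<in> tree_edges x"
    using snoc.prems(2) by (auto simp: tree_edges_iff)
  then show ?case
    using relpow_Suc_I[OF IH[THEN conjunct1] e(1)] relpow_Suc_I2[OF e(2) IH[THEN conjunct2]] by simp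
qed simp

lemma graph_dist_eq:
  assumes "binary_tree x" "u \<in> x" "v \<in> x"
  shows "graph_dist x u v = length u + length v - 2 * length (longest_common_prefix u v)"
  unfolding graph_dist_def
proof (rule Least_equality)
  obtain r s where rs: "u = longest_common_prefix u v @ r" "v = longest_common_prefix u v @ s"
    by (meson longest_common_prefix_prefix1 longest_common_prefix_prefix2 prefixE)
  let ?p = "longest_common_prefix u v"
  have "(u, ?p) \<in> tree_edges x ^^ length r" "(?p, v) \<in> tree_edges x ^^ length s"
    using down_walk[of x ?p r] down_walk[of x ?p s] assms rs by auto
  then have "(u, v) \<in> tree_edges x ^^ (length r + length s)"
    unfolding relpow_add by blast
  moreover have "length u = length ?p + length r" "length v = length ?p + length s"
    using rs by (metis length_append)+
  ultimately show "(u, v) \<in> tree_edges x ^^ (length u + length v - 2 * length ?p)"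
    by simp
next
  fix n assume "(u, v) \<in> tree_edges x ^^ n"
  then show "length u + length v - 2 * length (longest_common_prefix u v) \<le> n"
    using walk_length_ge by fastforce
qed

section \<open>The chain and its limit\<close>

definition bst_step :: "bool list set \<Rightarrow> bool list set pmf"
  where "bst_step x = map_pmf (\<lambda>u. x \<union> {u}) (pmf_of_set (external_nodes x))"

text \<open>Time starts at 1; \<open>X 0\<close> is unconstrained. As there are only countably many states, the
  Markov property is stated by elementary conditioning, multiplied out.\<close>

definition bst_chain :: "'a measure \<Rightarrow> (nat \<Rightarrow> 'a \<Rightarrow> bool list set) \<Rightarrow> bool"
  where "bst_chain M X \<longleftrightarrow>
    (\<forall>n\<ge>1. X n \<in> M \<rightarrow>\<^sub>M count_space finite_trees) \<and>
    (AE \<omega> in M. X 1 \<omega> = {[]}) \<and>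
    (\<forall>n\<ge>1. \<forall>x y.
      measure M {\<omega> \<in> space M. (\<forall>i\<in>{1..n}. X i \<omega> = x i) \<and> X (n + 1) \<omega> = y} =
      measure M {\<omega> \<in> space M. \<forall>i\<in>{1..n}. X i \<omega> = x i} * pmf (bst_step (x n)) y)"

definition weakly_converges :: "(nat \<Rightarrow> 'b::topological_space measure) \<Rightarrow> 'b measure \<Rightarrow> bool"
  where "weakly_converges \<mu> \<nu> \<longleftrightarrow>
    (\<forall>f::'b \<Rightarrow> real. continuous_on UNIV f \<longrightarrow> bounded (range f) \<longrightarrow>
      (\<lambda>n. \<integral>x. f x \<partial>\<mu> n) \<longlonglongrightarrow> (\<integral>x. f x \<partial>\<nu>))"

text \<open>The limit is a random probability measure on the boundary; for the weak convergence, it and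
  the uniform distributions on the trees are regarded as Borel measures on \<^typ>\<open>seq01\<close>.\<close>

definition bst_limit ::
    "'a measure \<Rightarrow> (nat \<Rightarrow> 'a \<Rightarrow> bool list set) \<Rightarrow> ('a \<Rightarrow> seq01 measure) \<Rightarrow> bool"
  where "bst_limit M X Xinf \<longleftrightarrow>
    Xinf \<in> M \<rightarrow>\<^sub>M prob_algebra (restrict_space borel boundary) \<and>
    (AE \<omega> in M. weakly_converges
      (\<lambda>n. distr (measure_pmf (pmf_of_set (X n \<omega>))) borel Node)
      (distr (Xinf \<omega>) borel (\<lambda>v. v)))"

section \<open>Convergence in quadratic mean and the limiting functionals\<close>

definition sq_integrable :: "'a measure \<Rightarrow> ('a \<Rightarrow> real) \<Rightarrow> bool"
  where "sq_integrable M f \<longleftrightarrow> f \<in> borel_measurable M \<and> integrable M (\<lambda>\<omega>. (f \<omega>)\<^sup>2)"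

definition tendsto_L2 ::
    "'a measure \<Rightarrow> ('i \<Rightarrow> 'a \<Rightarrow> real) \<Rightarrow> ('a \<Rightarrow> real) \<Rightarrow> 'i filter \<Rightarrow> bool"
  where "tendsto_L2 M f g F \<longleftrightarrow>
    (\<forall>\<^sub>F i in F. sq_integrable M (f i)) \<and> sq_integrable M g \<and>
    ((\<lambda>i. \<integral>\<omega>. (f i \<omega> - g \<omega>)\<^sup>2 \<partial>M) \<longlongrightarrow> 0) F"

definition mass :: "seq01 measure \<Rightarrow> bool list \<Rightarrow> real"
  where "mass \<mu> u = measure \<mu> (cone u)"

definition C_fun :: "real \<Rightarrow> real"
  where "C_fun s = 1 + 2 * (s * ln s + (1 - s) * ln (1 - s))"

definition Y_partial :: "seq01 measure \<Rightarrow> nat \<Rightarrow> real"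
  where "Y_partial \<mu> k =
    (\<Sum>u | length u \<le> k. mass \<mu> u * C_fun (mass \<mu> (u @ [False]) / mass \<mu> u))"

definition Y_lim :: "seq01 measure \<Rightarrow> real"
  where "Y_lim \<mu> = lim (Y_partial \<mu>)"

definition Z_lim :: "seq01 measure \<Rightarrow> real"
  where "Z_lim \<mu> = (\<Sum>\<^sub>\<infinity>u. (mass \<mu> u)\<^sup>2)"

definition W_lim :: "seq01 measure \<Rightarrow> real"
  where "W_lim \<mu> = 2 * euler_mascheroni - 3 + Y_lim \<mu> - Z_lim \<mu>"

end

theory Submission
  imports Defs "HOL-Real_Asymp.Real_Asymp"
begin

text \<open>Write S for the sum and Q for the sum of squares of the subtree sizes of a tree with n nodes.
  Then the Wiener index is n S - Q. Let s(n) be the mean of S in the chain. For any node v let the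
  excess at v be the difference between the version of S for the subtree at v and its mean given
  the size of that subtree. Excesses at different nodes of the same level are uncorrelated, and
  weighting external nodes at depth d by (5/4)^d shows that their total variance at level k is at
  most of order (4/5)^k n^2, uniformly in n. Splitting the excess at the root along the first k
  levels gives finitely many terms that converge to those of the series for Y; the same scheme
  applied to Q / n^2 gives Z. This identifies the limit in quadratic mean.

  For almost sure convergence no martingale convergence theorem is needed: S and Q with suitable
  corrections form a martingale whose increments are at most of order n^(-3/4) in quadratic mean,
  so its distance to the limit is of order n^(-1/4). This suffices along the fourth powers, and
  between them the Wiener index is monotone.\<close>

section \<open>Trees grown by adding external nodes\<close>

text \<open>The obstacle is an exchange of limits: size fractions converge at each fixed node, but
  the functionals sum over infinitely many nodes, so everything rests on tail bounds that are
  uniform in n. They come from one-step computations alone. The drift of a functional f of a tree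
  with n nodes is the sum of its changes over the n + 1 possible insertions. Drift f makes the mean
  grow like n, drift 2 f like n^2. The weight (5/4)^d has drift 3/2 of itself, so as a source term,
  measured against n^2, it contributes a convergent series. At the same time (5/4)^d dominates d^2
  up to a constant, and counting depths from level k instead of from the root gains the factor
  (4/5)^k.

  The martingale has a rate but does not reveal its limit; the truncation along levels reveals the
  limit but has no rate in n. Letting the later time tend to infinity in the martingale estimate
  transfers the rate to the identified limit.\<close>

definition subtree_size :: "bool list set \<Rightarrow> bool list \<Rightarrow> nat"
  where "subtree_size x v = card {u \<in> x. prefix v u}"

text \<open>These are the trees that the chain can occupy at time n. Carrying n along turns every
  later claim about the chain into one about a deterministic set of trees, with induction over the
  insertions.\<close>

inductive grown :: "nat \<Rightarrow> bool list set \<Rightarrow> bool" where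
  root: "grown (Suc 0) {[]}"
| insert: "grown n x \<Longrightarrow> u \<in> external_nodes x \<Longrightarrow> grown (Suc n) (insert u x)"

lemma external_nodes_iff: "u \<in> external_nodes x \<longleftrightarrow> (\<exists>v b. u = v @ [b] \<and> v \<in> x \<and> u \<notin> x)"
  by (cases u rule: rev_cases) (auto simp: external_nodes_def)

lemma external_nodes_root: "external_nodes {[]} = {[False], [True]}"
  unfolding set_eq_iff external_nodes_iff by auto

lemma external_nodes_insert:
  assumes "binary_tree x" "u \<in> external_nodes x"
  shows "external_nodes (insert u x) = external_nodes x - {u} \<union> {u @ [False], u @ [True]}"
proof -
  have ux: "u \<notin> x" using assms(2) by (simp add: external_nodes_def)
  have "u @ [b] \<notin> x" for b
    using assms(1) ux unfolding binary_tree_def by (metis prefixI)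
  then show ?thesis
    unfolding set_eq_iff Un_iff Diff_iff external_nodes_iff
    using ux by auto
qed

lemma snoc_external: "u \<in> external_nodes x \<Longrightarrow> u @ [b] \<notin> external_nodes x"
  by (simp add: external_nodes_def)

lemma binary_tree_insert:
  "binary_tree x \<Longrightarrow> u \<in> external_nodes x \<Longrightarrow> binary_tree (insert u x)"
  unfolding binary_tree_def external_nodes_iff by (auto simp: prefix_snoc)

lemma grown_binary_tree: "grown n x \<Longrightarrow> binary_tree x"
  by (induction rule: grown.induct) (auto simp: binary_tree_insert, simp add: binary_tree_def)

lemma grown_finite: "grown n x \<Longrightarrow> finite x"
  by (induction rule: grown.induct) auto

lemma grown_card: "grown n x \<Longrightarrow> card x = n"
  by (induction rule: grown.induct) (auto simp: grown_finite external_nodes_def)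

lemma grown_pos: "grown n x \<Longrightarrow> 0 < n"
  by (induction rule: grown.induct) auto

lemma grown_Nil: "grown n x \<Longrightarrow> [] \<in> x"
  by (induction rule: grown.induct) auto

lemma grown_external:
  "grown n x \<Longrightarrow> finite (external_nodes x) \<and> card (external_nodes x) = Suc n"
proof (induction rule: grown.induct)
  case root
  show ?case by (simp add: external_nodes_root)
next
  case (insert n x u)
  then show ?case
    using snoc_external[OF insert.hyps(2)]
    by (auto simp: external_nodes_insert grown_binary_tree card_insert_if)
qed

lemmas grown_external_finite = grown_external[THEN conjunct1]
lemmas grown_external_card = grown_external[THEN conjunct2]

text \<open>Finitely many states at each time make every function of finitely many states almost
  surely bounded, hence integrable; all moments of the chain rest on this.\<close>

lemma finite_grown: "finite {x. grown n x}"
proof (induction n)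
  case 0
  have "{x. grown 0 x} = {}" using grown_pos by blast
  then show ?case by simp
next
  case (Suc n)
  have "{x. grown (Suc n) x} \<subseteq> insert {[]} (\<Union>x\<in>{x. grown n x}. (\<lambda>u. insert u x) ` external_nodes x)"
    by (blast elim: grown.cases)
  then show ?case
    by (rule finite_subset) (auto simp: grown_external_finite Suc)
qed

section \<open>Subtree sizes and the external nodes below a given node\<close>

lemma subtree_size_insert:
  assumes "finite x" "u \<notin> x"
  shows "subtree_size (insert u x) v = subtree_size x v + (if prefix v u then 1 else 0)"
proof -
  have "{w \<in> insert u x. prefix v w} = (if prefix v u then insert u else id) {w \<in> x. prefix v w}"
    by auto
  then show ?thesis using assms by (auto simp: subtree_size_def)
qed

lemma subtree_size_0: "binary_tree x \<Longrightarrow> v \<notin> x \<Longrightarrow> subtree_size x v = 0"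
  unfolding subtree_size_def binary_tree_def
  by (metis (mono_tags, lifting) card.empty empty_Collect_eq)

lemma subtree_size_le: "grown n x \<Longrightarrow> subtree_size x v \<le> n"
  unfolding subtree_size_def
  using card_mono[of x "{u \<in> x. prefix v u}"] by (auto simp: grown_finite grown_card)

lemma subtree_size_Nil: "grown n x \<Longrightarrow> subtree_size x [] = n"
  unfolding subtree_size_def by (auto simp: grown_card)

lemma subtree_size_rec:
  assumes "finite x"
  shows "subtree_size x v =
    (if v \<in> x then 1 else 0) + subtree_size x (v @ [False]) + subtree_size x (v @ [True])"
proof -
  have "{u \<in> x. prefix v u} = {u \<in> x. u = v}
    \<union> {u \<in> x. prefix (v @ [False]) u} \<union> {u \<in> x. prefix (v @ [True]) u}"
    by (auto simp: prefix_def) (metis append_Nil2 neq_Nil_conv)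
  moreover have "card ({u \<in> x. u = v} \<union> {u \<in> x. prefix (v @ [False]) u} \<union> {u \<in> x. prefix (v @ [True]) u})
     = card {u \<in> x. u = v} + card {u \<in> x. prefix (v @ [False]) u} + card {u \<in> x. prefix (v @ [True]) u}"
    using assms by (subst card_Un_disjoint, simp, simp, force simp: prefix_def)+ simp
  moreover have "{u \<in> x. u = v} = (if v \<in> x then {v} else {})" by auto
  then have "card {u \<in> x. u = v} = (if v \<in> x then 1 else 0)" by simp
  ultimately show ?thesis by (simp add: subtree_size_def)
qed

text \<open>A finite binary tree has one more external node than nodes, here applied to the subtree
  at \<open>v\<close>. The induction follows the growth of the whole tree: \<open>v\<close> may be
  an ancestor of the new node or that node itself, one of the two new external nodes, or
  unaffected.\<close>

lemma external_count:
  "grown n x \<Longrightarrow> card {u \<in> external_nodes x. prefix v u}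
     = (if v \<in> x \<union> external_nodes x then Suc (subtree_size x v) else 0)"
proof (induction arbitrary: v rule: grown.induct)
  case root
  have *: "{u \<in> {[False], [True]}. prefix v u} =
     (if v = [] then {[False], [True]} else if v = [False] \<or> v = [True] then {v} else {})"
    by (auto simp: prefix_Cons)
  show ?case unfolding external_nodes_root *
    by (auto simp: subtree_size_def)
next
  case (insert n x u)
  note bt = grown_binary_tree[OF insert.hyps(1)] and fin = grown_finite[OF insert.hyps(1)]
  note ext = external_nodes_insert[OF bt insert.hyps(2)]
  have ux: "u \<notin> x" using insert.hyps(2) by (simp add: external_nodes_def)
  have snoc: "u @ [b] \<notin> external_nodes x" "u @ [b] \<notin> x" for b
    using snoc_external[OF insert.hyps(2)] bt ux unfolding binary_tree_def by (metis prefixI)+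
  note finE = grown_external_finite[OF insert.hyps(1)]
  consider "prefix v u" | b where "v = u @ [b]" | "\<not> prefix v u" "\<forall>b. v \<noteq> u @ [b]" by blast
  then show ?case
  proof cases
    case 1
    have v: "v \<in> x \<union> external_nodes x"
    proof (cases "v = u")
      case False
      obtain w b where w: "u = w @ [b]" "w \<in> x" using insert.hyps(2) unfolding external_nodes_iff by blast
      then have "prefix v w" using 1 False by (auto simp: prefix_snoc)
      then show ?thesis using bt w(2) unfolding binary_tree_def by blast
    qed (use insert.hyps in auto)
    let ?A = "{w \<in> external_nodes x. prefix v w}"
    have "{w \<in> external_nodes (insert u x). prefix v w} = ?A - {u} \<union> {u @ [False], u @ [True]}"
      unfolding ext using 1 by (auto intro: prefix_prefix)
    also have "card \<dots> = card (?A - {u}) + 2"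
      using finE snoc by (subst card_Un_disjoint) auto
    also have "card (?A - {u}) = card ?A - 1"
      using 1 insert.hyps(2) by simp
    also have "card ?A = Suc (subtree_size x v)" using insert.IH v by simp
    finally show ?thesis
      using 1 v ext subtree_size_insert[OF fin ux] by auto
  next
    case 2
    have "\<not> prefix (u @ [b]) w" if w: "w \<in> external_nodes x" for w
    proof
      assume "prefix (u @ [b]) w"
      moreover obtain w' c where "w = w' @ [c]" "w' \<in> x" using w unfolding external_nodes_iff by blast
      ultimately have "u @ [b] = w \<or> prefix (u @ [b]) w'" by (auto simp: prefix_snoc)
      then show False using snoc[of b] w bt \<open>w' \<in> x\<close> unfolding binary_tree_def by blast
    qed
    then have "{w \<in> external_nodes (insert u x). prefix v w} = {v}"
      unfolding ext using 2 by auto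
    moreover have "subtree_size (insert u x) v = 0"
      using 2 snoc by (intro subtree_size_0 binary_tree_insert bt insert.hyps) auto
    ultimately show ?thesis using 2 ext by simp
  next
    case 3
    then have "{w \<in> external_nodes (insert u x). prefix v w} = {w \<in> external_nodes x. prefix v w}"
      unfolding ext by (auto simp: prefix_snoc)
    moreover have "v \<in> insert u x \<union> external_nodes (insert u x) \<longleftrightarrow> v \<in> x \<union> external_nodes x"
      unfolding ext using 3 by auto
    ultimately show ?thesis
      using insert.IH[of v] 3 subtree_size_insert[OF fin ux] by simp
  qed
qed

lemma strict_prefix_external:
  assumes "binary_tree x" "u \<in> external_nodes x" "strict_prefix w u"
  shows "w \<in> x"
proof -
  obtain v b where v: "u = v @ [b]" "v \<in> x" using assms(2) unfolding external_nodes_iff by blast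
  then have "prefix w v" using assms(3) by (auto simp: strict_prefix_def prefix_snoc)
  then show ?thesis using assms(1) v unfolding binary_tree_def by blast
qed

lemma finite_strict_prefixes: "finite {w. strict_prefix w u}"
proof -
  have "finite {w. prefix w u}"
    using finite_set[of "prefixes u"] by (simp add: set_prefixes_eq)
  then show "finite {w. strict_prefix w u}"
    by (rule rev_finite_subset) (auto simp: strict_prefix_def)
qed

lemma card_prefixes: "card {w. prefix w u} = Suc (length u)"
  using distinct_card[OF distinct_prefixes, of u] by (simp add: set_prefixes_eq)

text \<open>Double counting of pairs of an external node and a proper ancestor. It turns an average
  over insertion points into a sum over nodes, each weighted with the number of insertion points
  below it.\<close>

lemma external_sum_swap:
  fixes F :: "bool list \<Rightarrow> real"
  assumes "grown n x"
  shows "(\<Sum>u\<in>external_nodes x. \<Sum>w | strict_prefix w u. F w)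
     = (\<Sum>w\<in>x. F w * (real (subtree_size x w) + 1))"
proof -
  note bt = grown_binary_tree[OF assms]
  have "(\<Sum>u\<in>external_nodes x. \<Sum>w | strict_prefix w u. F w)
      = (\<Sum>u\<in>external_nodes x. \<Sum>w\<in>x. if prefix w u then F w else 0)"
  proof (rule sum.cong[OF refl])
    fix u assume u: "u \<in> external_nodes x"
    then have "u \<notin> x" by (simp add: external_nodes_def)
    then have "{w. strict_prefix w u} = {w \<in> x. prefix w u}"
      using strict_prefix_external[OF bt u] by (auto simp: strict_prefix_def)
    then show "(\<Sum>w | strict_prefix w u. F w) = (\<Sum>w\<in>x. if prefix w u then F w else 0)"
      using grown_finite[OF assms] by (simp add: sum.inter_filter)
  qed
  also have "\<dots> = (\<Sum>w\<in>x. \<Sum>u\<in>external_nodes x. if prefix w u then F w else 0)"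
    by (rule sum.swap)
  also have "\<dots> = (\<Sum>w\<in>x. F w * (real (subtree_size x w) + 1))"
  proof (intro sum.cong refl)
    fix w assume w: "w \<in> x"
    have "(\<Sum>u\<in>external_nodes x. if prefix w u then F w else 0)
       = F w * real (card {u \<in> external_nodes x. prefix w u})"
      using grown_external_finite[OF assms] by (simp add: sum.If_cases Int_def)
    then show "(\<Sum>u\<in>external_nodes x. if prefix w u then F w else 0)
       = F w * (real (subtree_size x w) + 1)"
      using w by (simp add: external_count[OF assms])
  qed
  finally show ?thesis .
qed

section \<open>Additive functionals of the subtree sizes; path sum and square sum\<close>

definition node_sum :: "(bool list \<Rightarrow> nat \<Rightarrow> real) \<Rightarrow> bool list set \<Rightarrow> real"
  where "node_sum F x = (\<Sum>w\<in>x. F w (subtree_size x w))"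

lemma node_sum_insert:
  assumes "grown n x" "u \<in> external_nodes x"
  shows "node_sum F (insert u x) = node_sum F x
    + (\<Sum>w | strict_prefix w u. F w (Suc (subtree_size x w)) - F w (subtree_size x w)) + F u 1"
proof -
  note bt = grown_binary_tree[OF assms(1)] and fin = grown_finite[OF assms(1)]
  have ux: "u \<notin> x" using assms(2) by (simp add: external_nodes_def)
  let ?P = "{w. strict_prefix w u}"
  have P: "?P \<subseteq> x" using strict_prefix_external[OF bt assms(2)] by blast
  have "node_sum F (insert u x) = F u 1 + (\<Sum>w\<in>x. F w (subtree_size (insert u x) w))"
    unfolding node_sum_def using ux fin subtree_size_insert[OF fin ux, of u] subtree_size_0[OF bt ux]
    by simp
  also have "(\<Sum>w\<in>x. F w (subtree_size (insert u x) w)) = (\<Sum>w\<in>x. F w (subtree_size x w)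
     + (if w \<in> ?P then F w (Suc (subtree_size x w)) - F w (subtree_size x w) else 0))"
    using ux by (intro sum.cong) (auto simp: subtree_size_insert[OF fin ux] strict_prefix_def)
  also have "\<dots> = node_sum F x
    + (\<Sum>w\<in>x. if w \<in> ?P then F w (Suc (subtree_size x w)) - F w (subtree_size x w) else 0)"
    by (simp add: sum.distrib node_sum_def)
  also have "(\<Sum>w\<in>x. if w \<in> ?P then F w (Suc (subtree_size x w)) - F w (subtree_size x w) else 0)
     = (\<Sum>w\<in>?P. F w (Suc (subtree_size x w)) - F w (subtree_size x w))"
    using P fin by (subst sum.If_cases) (auto intro!: sum.cong simp: Int_absorb1)
  finally show ?thesis by simp
qed

text \<open>The left side is n + 1 times the expected change in one step of the chain. An insertion
  changes the sizes of exactly the proper ancestors, by one each, and the new node enters with size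
  1.\<close>

lemma node_sum_drift:
  assumes "grown n x"
  shows "(\<Sum>u\<in>external_nodes x. node_sum F (insert u x) - node_sum F x)
    = (\<Sum>w\<in>x. (F w (Suc (subtree_size x w)) - F w (subtree_size x w)) * (real (subtree_size x w) + 1))
      + (\<Sum>u\<in>external_nodes x. F u 1)"
  by (simp add: node_sum_insert[OF assms] sum.distrib external_sum_swap[OF assms] cong: sum.cong)

text \<open>Counting every node below \<open>v\<close> once for each of its ancestors from
  \<open>v\<close> down to itself shows that this is the internal path length of the subtree at
  \<open>v\<close> plus its number of nodes.\<close>

definition path_sum :: "bool list set \<Rightarrow> bool list \<Rightarrow> real"
  where "path_sum x v = node_sum (\<lambda>w m. if prefix v w then real m else 0) x"

definition square_sum :: "bool list set \<Rightarrow> real"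
  where "square_sum x = node_sum (\<lambda>w m. (real m)\<^sup>2) x"

lemma card_path:
  assumes "prefix v u"
  shows "card {w. prefix v w \<and> strict_prefix w u} = length u - length v"
proof -
  obtain r where r: "u = v @ r" using assms by (auto simp: prefix_def)
  have "{w. prefix v w \<and> strict_prefix w u} = (@) v ` {w. strict_prefix w r}"
    unfolding r by (auto simp: prefix_def strict_prefix_def)
  moreover have "card {w. strict_prefix w r} = length r"
  proof -
    have "{w. strict_prefix w r} = {w. prefix w r} - {r}" by (auto simp: strict_prefix_def)
    then show ?thesis by (simp add: card_prefixes)
  qed
  ultimately show ?thesis by (simp add: r card_image inj_on_def)
qed

lemma path_sum_insert:
  assumes "grown n x" "u \<in> external_nodes x"
  shows "path_sum (insert u x) v = path_sum x v
    + (if prefix v u then real (length u) - real (length v) + 1 else 0)"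
proof -
  have "(\<Sum>w | strict_prefix w u. (if prefix v w then real (Suc (subtree_size x w)) else 0)
       - (if prefix v w then real (subtree_size x w) else 0))
     = (\<Sum>w | strict_prefix w u. if prefix v w then 1 else 0)"
    by (intro sum.cong) auto
  also have "\<dots> = real (card {w. prefix v w \<and> strict_prefix w u})"
    using finite_strict_prefixes[of u] by (simp add: sum.If_cases Int_def conj_commute)
  also have "\<dots> = (if prefix v u then real (length u) - real (length v) else 0)"
  proof (cases "prefix v u")
    case True
    then show ?thesis using card_path[OF True] prefix_length_le[OF True] by (simp add: of_nat_diff)
  next
    case False
    then have "{w. prefix v w \<and> strict_prefix w u} = {}"
      by (auto simp: strict_prefix_def dest: prefix_order.trans)
    then show ?thesis using False by (simp only: card.empty) simp
  qed
  finally show ?thesis unfolding path_sum_def node_sum_insert[OF assms] by simp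
qed

lemma path_sum_outside: "binary_tree x \<Longrightarrow> v \<notin> x \<Longrightarrow> path_sum x v = 0"
  unfolding path_sum_def node_sum_def binary_tree_def by (intro sum.neutral) auto

lemma path_sum_rec:
  assumes "finite x" "binary_tree x"
  shows "path_sum x v = real (subtree_size x v) + path_sum x (v @ [False]) + path_sum x (v @ [True])"
proof -
  have *: "(if prefix v w then a else 0) = (if w = v then a else 0)
     + (if prefix (v @ [False]) w then a else 0) + (if prefix (v @ [True]) w then a else (0::real))" for w a
  proof (cases "prefix v w")
    case True
    then obtain r where "w = v @ r" by (auto simp: prefix_def)
    then show ?thesis by (cases r) auto
  next
    case False
    then show ?thesis by (auto dest: append_prefixD)
  qed
  have "path_sum x v = (\<Sum>w\<in>x. if w = v then real (subtree_size x w) else 0)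
      + path_sum x (v @ [False]) + path_sum x (v @ [True])"
    unfolding path_sum_def node_sum_def by (subst *) (simp add: sum.distrib)
  also have "(\<Sum>w\<in>x. if w = v then real (subtree_size x w) else 0) = real (subtree_size x v)"
    using assms subtree_size_0[of x v] by (simp add: sum.delta')
  finally show ?thesis .
qed

text \<open>The classical relation between external and internal path length. Both sides evaluate
  the total change of the path sum at \<open>v\<close> over all insertions:
  \<open>path_sum_insert\<close> yields the depths, \<open>node_sum_drift\<close> the right
  side.\<close>

lemma external_depth_sum:
  assumes "grown n x" "v \<in> x \<union> external_nodes x"
  shows "(\<Sum>u | u \<in> external_nodes x \<and> prefix v u. real (length u) - real (length v) + 1)
    = path_sum x v + 2 * real (subtree_size x v) + 1"
proof -
  note bt = grown_binary_tree[OF assms(1)] and fin = grown_finite[OF assms(1)]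
  have "(\<Sum>u | u \<in> external_nodes x \<and> prefix v u. real (length u) - real (length v) + 1)
    = (\<Sum>u\<in>external_nodes x. path_sum (insert u x) v - path_sum x v)"
    using grown_external_finite[OF assms(1)]
    by (simp add: path_sum_insert[OF assms(1)] sum.inter_filter cong: sum.cong)
  also have "\<dots> = (\<Sum>w\<in>x. (if prefix v w then real (subtree_size x w) + 1 else 0))
      + (\<Sum>u\<in>external_nodes x. if prefix v u then 1 else 0)"
    unfolding path_sum_def node_sum_drift[OF assms(1)]
    by (intro arg_cong2[where f="(+)"] sum.cong) auto
  also have "(\<Sum>w\<in>x. (if prefix v w then real (subtree_size x w) + 1 else 0))
      = path_sum x v + (\<Sum>w\<in>x. if prefix v w then 1 else 0)"
    unfolding path_sum_def node_sum_def by (subst sum.distrib[symmetric]) (intro sum.cong, auto)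
  also have "(\<Sum>w\<in>x. if prefix v w then 1 else 0) = real (subtree_size x v)"
    using fin by (simp add: sum.If_cases subtree_size_def Int_def)
  also have "(\<Sum>u\<in>external_nodes x. if prefix v u then 1 else 0) = real (subtree_size x v) + 1"
    using external_count[OF assms(1), of v] assms(2) grown_external_finite[OF assms(1)]
    by (simp add: sum.If_cases Int_def)
  finally show ?thesis by simp
qed

lemma no_external_below:
  assumes "binary_tree x" "v \<notin> x \<union> external_nodes x"
  shows "{u \<in> external_nodes x. prefix v u} = {}"
  using strict_prefix_external[OF assms(1)] assms(2) by (auto simp: strict_prefix_def)

subsection \<open>The Wiener index\<close>

lemma prefix_pair_iff: "prefix w u \<and> prefix w v \<longleftrightarrow> prefix w (longest_common_prefix u v)"
  by (meson longest_common_prefix_max_prefix longest_common_prefix_prefix1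
      longest_common_prefix_prefix2 prefix_order.trans)

lemma length_sum_eq:
  assumes "finite x" "binary_tree x"
  shows "(\<Sum>u\<in>x. real (length u) + 1) = path_sum x []"
proof -
  have "(\<Sum>u\<in>x. real (length u) + 1) = (\<Sum>u\<in>x. \<Sum>w\<in>x. if prefix w u then 1 else 0)"
  proof (intro sum.cong refl)
    fix u assume "u \<in> x"
    then have "{w. prefix w u} = {w\<in>x. prefix w u}" using assms(2) unfolding binary_tree_def by blast
    then show "real (length u) + 1 = (\<Sum>w\<in>x. if prefix w u then 1 else 0)"
      using assms(1) card_prefixes[of u] by (simp add: sum.If_cases Int_def)
  qed
  also have "\<dots> = (\<Sum>w\<in>x. \<Sum>u\<in>x. if prefix w u then 1 else 0)" by (rule sum.swap)
  also have "\<dots> = path_sum x []"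
    unfolding path_sum_def node_sum_def subtree_size_def using assms(1)
    by (intro sum.cong) (auto simp: sum.If_cases Int_def)
  finally show ?thesis .
qed

text \<open>A node of length l has l + 1 prefixes, so the left side counts pairs of nodes together
  with a common ancestor. Summing over the ancestor last produces the squares.\<close>

lemma lcp_sum_eq:
  assumes "finite x" "binary_tree x"
  shows "(\<Sum>u\<in>x. \<Sum>v\<in>x. real (length (longest_common_prefix u v)) + 1) = square_sum x"
proof -
  have "(\<Sum>u\<in>x. \<Sum>v\<in>x. real (length (longest_common_prefix u v)) + 1)
     = (\<Sum>u\<in>x. \<Sum>v\<in>x. \<Sum>w\<in>x. (if prefix w u then 1 else 0) * (if prefix w v then 1 else 0))"
  proof (intro sum.cong refl)
    fix u v assume "u \<in> x" "v \<in> x"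
    let ?p = "longest_common_prefix u v"
    have "{w. prefix w ?p} = {w\<in>x. prefix w u \<and> prefix w v}"
      using assms(2) \<open>u \<in> x\<close> unfolding binary_tree_def prefix_pair_iff[symmetric] by blast
    moreover have "(\<Sum>w\<in>x. (if prefix w u then 1 else 0) * (if prefix w v then 1 else 0))
      = (\<Sum>w\<in>x. if prefix w u \<and> prefix w v then 1 else (0::real))"
      by (intro sum.cong) auto
    ultimately show "real (length ?p) + 1
       = (\<Sum>w\<in>x. (if prefix w u then 1 else 0) * (if prefix w v then 1 else 0))"
      using assms(1) card_prefixes[of ?p] by (simp add: sum.If_cases Int_def)
  qed
  also have "\<dots> = (\<Sum>u\<in>x. \<Sum>w\<in>x. \<Sum>v\<in>x. (if prefix w u then 1 else 0) * (if prefix w v then 1 else 0))"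
    by (rule sum.cong[OF refl]) (rule sum.swap)
  also have "\<dots> = (\<Sum>w\<in>x. \<Sum>u\<in>x. \<Sum>v\<in>x. (if prefix w u then 1 else 0) * (if prefix w v then 1 else 0))"
    by (rule sum.swap)
  also have "\<dots> = (\<Sum>w\<in>x. (\<Sum>u\<in>x. if prefix w u then 1 else 0) * (\<Sum>v\<in>x. if prefix w v then 1 else 0))"
    by (simp only: sum_product)
  also have "\<dots> = square_sum x"
    unfolding square_sum_def node_sum_def subtree_size_def using assms(1)
    by (intro sum.cong) (auto simp: sum.If_cases Int_def power2_eq_square)
  finally show ?thesis .
qed

lemma graph_dist_real:
  assumes "binary_tree x" "u \<in> x" "v \<in> x"
  shows "real (graph_dist x u v)
    = real (length u) + real (length v) - 2 * real (length (longest_common_prefix u v))"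
proof -
  have "length (longest_common_prefix u v) \<le> length u" "length (longest_common_prefix u v) \<le> length v"
    by (intro prefix_length_le longest_common_prefix_prefix1 longest_common_prefix_prefix2)+
  then show ?thesis unfolding graph_dist_eq[OF assms] by linarith
qed

text \<open>Depths contribute the path sum, common prefixes the square sum. The terms n^2 that arise
  from counting a node among its own ancestors cancel.\<close>

lemma wiener_index_eq:
  assumes "grown n x"
  shows "wiener_index x = real n * path_sum x [] - square_sum x"
proof -
  note bt = grown_binary_tree[OF assms] and fin = grown_finite[OF assms]
  have l: "(\<Sum>u\<in>x. real (length u)) = path_sum x [] - n"
    using length_sum_eq[OF fin bt] grown_card[OF assms] by (simp add: sum.distrib)
  have m: "(\<Sum>u\<in>x. \<Sum>v\<in>x. real (length (longest_common_prefix u v))) = square_sum x - real n * real n"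
    using lcp_sum_eq[OF fin bt] grown_card[OF assms] by (simp add: sum.distrib)
  have "(\<Sum>(u, v)\<in>x \<times> x. real (graph_dist x u v))
     = (\<Sum>u\<in>x. \<Sum>v\<in>x. real (length u) + real (length v) - 2 * real (length (longest_common_prefix u v)))"
    by (simp add: sum.cartesian_product[symmetric] graph_dist_real[OF bt])
  also have "\<dots> = 2 * real n * (path_sum x [] - n) - 2 * (square_sum x - real n * real n)"
    using grown_card[OF assms]
    by (simp add: sum.distrib sum_subtractf sum_distrib_left[symmetric] l m)
  finally show ?thesis unfolding wiener_index_def by (simp add: algebra_simps)
qed

text \<open>Distances depend only on the two nodes, so those between old nodes survive the insertion
  and only nonnegative terms are added. This is what later permits interpolation between
  times.\<close>

lemma wiener_index_mono:
  assumes "grown n x" "u \<in> external_nodes x"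
  shows "wiener_index x \<le> wiener_index (insert u x)"
proof -
  have g: "grown (Suc n) (insert u x)" by (rule grown.insert) fact+
  note bt = grown_binary_tree[OF assms(1)] grown_binary_tree[OF g]
  have "(\<Sum>(u, v)\<in>x \<times> x. real (graph_dist x u v)) = (\<Sum>(a, b)\<in>x \<times> x. real (graph_dist (insert u x) a b))"
    by (intro sum.cong) (auto simp: graph_dist_real[OF bt(1)] graph_dist_real[OF bt(2)])
  also have "\<dots> \<le> (\<Sum>(a, b)\<in>insert u x \<times> insert u x. real (graph_dist (insert u x) a b))"
    using grown_finite[OF g] by (intro sum_mono2) auto
  finally show ?thesis unfolding wiener_index_def by simp
qed

section \<open>One-step drifts\<close>

text \<open>The mean of the path sum at time n: the mean internal path length 2 (n + 1) H_n - 4 n of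
  a random binary search tree, plus n.\<close>

definition mean_path :: "nat \<Rightarrow> real"
  where "mean_path n = 2 * (real n + 1) * harm n - 3 * real n"

lemma mean_path_0 [simp]: "mean_path 0 = 0"
  by (simp add: mean_path_def harm_def)

text \<open>The recursion mirrors \<open>external_depth_sum\<close>; for this reason the constants
  cancel in the drift of the excess.\<close>

lemma mean_path_Suc:
  "(real n + 1) * mean_path (Suc n) = (real n + 2) * mean_path n + 2 * real n + 1"
  by (simp add: mean_path_def harm_Suc field_simps)

definition excess :: "bool list set \<Rightarrow> bool list \<Rightarrow> real"
  where "excess x v = path_sum x v - mean_path (subtree_size x v)"

lemma excess_outside: "binary_tree x \<Longrightarrow> v \<notin> x \<Longrightarrow> excess x v = 0"
  by (simp add: excess_def path_sum_outside subtree_size_0)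

lemma excess_insert:
  assumes "grown n x" "u \<in> external_nodes x"
  shows "excess (insert u x) v = excess x v + (if prefix v u then real (length u) - real (length v) + 1
    - (mean_path (Suc (subtree_size x v)) - mean_path (subtree_size x v)) else 0)"
proof -
  have "u \<notin> x" using assms(2) by (simp add: external_nodes_def)
  then show ?thesis
    by (simp add: excess_def path_sum_insert[OF assms] subtree_size_insert grown_finite[OF assms(1)])
qed

lemma excess_increment_sum:
  assumes "grown n x" "v \<in> x \<union> external_nodes x"
  shows "(\<Sum>u | u \<in> external_nodes x \<and> prefix v u. real (length u) - real (length v) + 1
    - (mean_path (Suc (subtree_size x v)) - mean_path (subtree_size x v))) = excess x v"
proof -
  let ?E = "{u. u \<in> external_nodes x \<and> prefix v u}"
  have split: "(\<Sum>u\<in>?E. f u - c) = (\<Sum>u\<in>?E. f u) - real (card ?E) * c" for f and c :: real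
    by (simp add: sum_subtractf)
  have "real (card ?E) = real (subtree_size x v) + 1"
    using external_count[OF assms(1), of v] assms(2) by simp
  then show ?thesis
    unfolding split external_depth_sum[OF assms] excess_def
    using mean_path_Suc[of "subtree_size x v"] by (simp add: algebra_simps)
qed

text \<open>An eigenfunction with eigenvalue 1 at every \<open>v\<close>, since insertions outside
  the subtree at \<open>v\<close> change nothing. At the root, dividing by n + 1 gives a
  martingale.\<close>

lemma excess_drift:
  assumes "grown n x"
  shows "(\<Sum>u\<in>external_nodes x. excess (insert u x) v - excess x v) = excess x v"
proof -
  note bt = grown_binary_tree[OF assms] and fin = grown_external_finite[OF assms]
  let ?d = "\<lambda>u. real (length u) - real (length v) + 1
    - (mean_path (Suc (subtree_size x v)) - mean_path (subtree_size x v))"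
  have "(\<Sum>u\<in>external_nodes x. excess (insert u x) v - excess x v)
    = (\<Sum>u\<in>external_nodes x. if prefix v u then ?d u else 0)"
    by (intro sum.cong) (auto simp: excess_insert[OF assms])
  also have "\<dots> = (\<Sum>u | u \<in> external_nodes x \<and> prefix v u. ?d u)"
    using fin by (simp add: sum.If_cases Int_def)
  also have "\<dots> = excess x v"
  proof (cases "v \<in> x \<union> external_nodes x")
    case True
    then show ?thesis by (rule excess_increment_sum[OF assms])
  next
    case False
    then show ?thesis by (simp only: no_external_below[OF bt False]) (simp add: excess_outside[OF bt])
  qed
  finally show ?thesis .
qed

text \<open>No insertion lies below both of two incomparable nodes, so the product of the two
  changes vanishes and the eigenvalues 1 and 1 simply add.\<close>

lemma excess_prod_drift:
  assumes "grown n x" "\<not> prefix v w" "\<not> prefix w v"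
  shows "(\<Sum>u\<in>external_nodes x. excess (insert u x) v * excess (insert u x) w - excess x v * excess x w)
    = 2 * (excess x v * excess x w)"
proof -
  let ?d = "\<lambda>v u. excess (insert u x) v - excess x v"
  have "excess (insert u x) v * excess (insert u x) w - excess x v * excess x w
     = ?d v u * excess x w + ?d w u * excess x v" if u: "u \<in> external_nodes x" for u
  proof -
    have "\<not> (prefix v u \<and> prefix w u)" using assms prefix_same_cases by blast
    then have "?d v u * ?d w u = 0" unfolding excess_insert[OF assms(1) u] by auto
    then show ?thesis by (simp add: algebra_simps)
  qed
  then have "(\<Sum>u\<in>external_nodes x. excess (insert u x) v * excess (insert u x) w - excess x v * excess x w)
    = (\<Sum>u\<in>external_nodes x. ?d v u) * excess x w + (\<Sum>u\<in>external_nodes x. ?d w u) * excess x v"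
    by (simp add: sum.distrib sum_distrib_right)
  then show ?thesis by (simp add: excess_drift[OF assms(1)])
qed

text \<open>The factor turns the squared excess into an eigenfunction of the drift, with eigenvalue 2,
  up to the source term.\<close>

definition scaled_square :: "bool list set \<Rightarrow> bool list \<Rightarrow> real"
  where "scaled_square x v
    = (excess x v)\<^sup>2 * ((real (subtree_size x v) + 2) / (real (subtree_size x v) + 1))"

lemma scaled_square_ge: "(excess x v)\<^sup>2 \<le> scaled_square x v"
  unfolding scaled_square_def
  by (rule mult_le_cancel_left1[THEN iffD2]) (auto simp: field_simps)

lemma scaled_square_drift:
  assumes "grown n x"
  shows "(\<Sum>u\<in>external_nodes x. scaled_square (insert u x) v - scaled_square x v)
    \<le> 2 * scaled_square x v
      + 2 * (\<Sum>u | u \<in> external_nodes x \<and> prefix v u. (real (length u) - real (length v) + 1)\<^sup>2)"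
proof (cases "v \<in> x \<union> external_nodes x")
  case False
  note bt = grown_binary_tree[OF assms]
  have "scaled_square (insert u x) v = 0" if "u \<in> external_nodes x" for u
    using that False excess_outside[OF binary_tree_insert[OF bt that], of v]
    by (auto simp: scaled_square_def)
  moreover have "scaled_square x v = 0" using False by (simp add: scaled_square_def excess_outside[OF bt])
  ultimately show ?thesis by (simp add: sum_nonneg)
next
  case True
  note bt = grown_binary_tree[OF assms] and fin = grown_external_finite[OF assms]
  define m where "m = real (subtree_size x v)"
  define G where "G = excess x v"
  define c where "c = mean_path (Suc (subtree_size x v)) - mean_path (subtree_size x v)"
  define E where "E = {u \<in> external_nodes x. prefix v u}"
  define a where "a u = real (length u) - real (length v) + 1" for u :: "bool list"
  have m0: "0 \<le> m" by (simp add: m_def)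
  have cardE: "real (card E) = m + 1"
    using external_count[OF assms, of v] True by (simp add: E_def m_def)
  have sumE: "(\<Sum>u\<in>E. a u - c) = G"
    using excess_increment_sum[OF assms True] by (simp add: E_def a_def c_def G_def)
  have suma: "(\<Sum>u\<in>E. a u) = G + (m + 1) * c" using sumE cardE by (simp add: sum_subtractf)
  have "(\<Sum>u\<in>external_nodes x. scaled_square (insert u x) v - scaled_square x v)
    = (\<Sum>u\<in>external_nodes x. if prefix v u then
        (G + (a u - c))\<^sup>2 * ((m + 3) / (m + 2)) - G\<^sup>2 * ((m + 2) / (m + 1)) else 0)"
  proof (rule sum.cong[OF refl])
    fix u assume u: "u \<in> external_nodes x"
    then have ux: "u \<notin> x" by (simp add: external_nodes_def)
    show "scaled_square (insert u x) v - scaled_square x v = (if prefix v u then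
        (G + (a u - c))\<^sup>2 * ((m + 3) / (m + 2)) - G\<^sup>2 * ((m + 2) / (m + 1)) else 0)"
      unfolding scaled_square_def excess_insert[OF assms u] subtree_size_insert[OF grown_finite[OF assms] ux]
      by (simp add: G_def m_def a_def c_def add.commute)
  qed
  also have "\<dots> = (\<Sum>u\<in>E. (G + (a u - c))\<^sup>2 * ((m + 3) / (m + 2)) - G\<^sup>2 * ((m + 2) / (m + 1)))"
    using fin by (simp add: sum.If_cases Int_def E_def)
  also have "\<dots> = (\<Sum>u\<in>E. (G + (a u - c))\<^sup>2) * ((m + 3) / (m + 2)) - (m + 2) * G\<^sup>2"
  proof -
    have "(m + 1) * (G\<^sup>2 * ((m + 2) / (m + 1))) = (m + 2) * G\<^sup>2"
      using m0 by (simp add: field_simps)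
    then show ?thesis by (simp only: sum_subtractf sum_distrib_right[symmetric] sum_constant cardE)
  qed
  also have "(\<Sum>u\<in>E. (G + (a u - c))\<^sup>2)
     = (\<Sum>u\<in>E. G\<^sup>2 + 2 * G * (a u - c) + ((a u)\<^sup>2 - 2 * c * a u + c\<^sup>2))"
    by (intro sum.cong refl) (simp add: power2_eq_square algebra_simps)
  also have "\<dots> = (m + 1) * G\<^sup>2 + 2 * G * G + ((\<Sum>u\<in>E. (a u)\<^sup>2) - 2 * c * (G + (m + 1) * c) + (m + 1) * c\<^sup>2)"
    by (simp only: sum.distrib sum_subtractf sum_distrib_left[symmetric] sumE suma sum_constant cardE) simp
  also have "\<dots> = (m + 3) * G\<^sup>2 + (\<Sum>u\<in>E. (a u)\<^sup>2) - 2 * c * G - (m + 1) * c\<^sup>2"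
    by (simp add: power2_eq_square algebra_simps)
  finally have eq: "(\<Sum>u\<in>external_nodes x. scaled_square (insert u x) v - scaled_square x v)
    = ((m + 3) * G\<^sup>2 + (\<Sum>u\<in>E. (a u)\<^sup>2) - 2 * c * G - (m + 1) * c\<^sup>2) * ((m + 3) / (m + 2)) - (m + 2) * G\<^sup>2" .
  \<comment> \<open>Completing the square removes the mean increment \<open>c\<close>, which is of
    logarithmic order in the subtree size, at the price of
    \<open>G\<^sup>2 / (m + 1)\<close>.\<close>
  have "- 2 * c * G - (m + 1) * c\<^sup>2 \<le> G\<^sup>2 / (m + 1)"
  proof -
    have "0 \<le> ((m + 1) * c + G)\<^sup>2 / (m + 1)" using m0 by simp
    also have "\<dots> = G\<^sup>2 / (m + 1) + 2 * c * G + (m + 1) * c\<^sup>2"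
      using m0 by (simp add: power2_eq_square field_simps)
    finally show ?thesis by simp
  qed
  then have "((m + 3) * G\<^sup>2 + (\<Sum>u\<in>E. (a u)\<^sup>2) - 2 * c * G - (m + 1) * c\<^sup>2) * ((m + 3) / (m + 2)) - (m + 2) * G\<^sup>2
     \<le> ((m + 3) * G\<^sup>2 + (\<Sum>u\<in>E. (a u)\<^sup>2) + G\<^sup>2 / (m + 1)) * ((m + 3) / (m + 2)) - (m + 2) * G\<^sup>2"
    using m0 by (intro diff_right_mono mult_right_mono) auto
  also have "\<dots> = 2 * (G\<^sup>2 * ((m + 2) / (m + 1))) + (\<Sum>u\<in>E. (a u)\<^sup>2) * ((m + 3) / (m + 2))"
  proof -
    \<comment> \<open>Here \<open>(m + 3) + 1 / (m + 1) = (m + 2)\<^sup>2 / (m + 1)\<close>, so the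
      coefficient of \<open>g\<close> collapses to twice the factor at \<open>m\<close>. This
      computation dictates the factor in \<open>scaled_square\<close>.\<close>
    have "((m + 3) * g + s + g / (m + 1)) * ((m + 3) / (m + 2)) - (m + 2) * g
      = 2 * (g * ((m + 2) / (m + 1))) + s * ((m + 3) / (m + 2))" for g s
      using m0 by (simp add: divide_simps) (simp add: algebra_simps)
    then show ?thesis .
  qed
  also have "(\<Sum>u\<in>E. (a u)\<^sup>2) * ((m + 3) / (m + 2)) \<le> (\<Sum>u\<in>E. (a u)\<^sup>2) * 2"
    using m0 by (intro mult_left_mono sum_nonneg) (auto simp: field_simps)
  finally show ?thesis
    unfolding eq by (simp add: scaled_square_def G_def m_def E_def a_def)
qed

text \<open>Any base between 1 and 3/2 would do: with base z the mean weight grows like n^(2z-1), which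
  is slower than n^2.\<close>

definition leaf_weight :: "bool list set \<Rightarrow> real"
  where "leaf_weight x = (\<Sum>u\<in>external_nodes x. (5/4) ^ length u)"

lemma leaf_weight_nonneg: "0 \<le> leaf_weight x"
  unfolding leaf_weight_def by (simp add: sum_nonneg)

lemma leaf_weight_insert:
  assumes "grown n x" "u \<in> external_nodes x"
  shows "leaf_weight (insert u x) = leaf_weight x + 3/2 * (5/4) ^ length u"
proof -
  note fin = grown_external_finite[OF assms(1)]
  have "leaf_weight (insert u x) = (\<Sum>w\<in>external_nodes x - {u}. (5/4) ^ length w)
      + (\<Sum>w\<in>{u @ [False], u @ [True]}. (5/4) ^ length w)"
    unfolding leaf_weight_def external_nodes_insert[OF grown_binary_tree[OF assms(1)] assms(2)]
    using fin snoc_external[OF assms(2)] by (intro sum.union_disjoint) auto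
  also have "(\<Sum>w\<in>external_nodes x - {u}. (5/4) ^ length w) = leaf_weight x - (5/4) ^ length u"
    unfolding leaf_weight_def using fin assms(2) by (simp add: sum_diff1)
  finally show ?thesis by simp
qed

lemma leaf_weight_drift:
  assumes "grown n x"
  shows "(\<Sum>u\<in>external_nodes x. leaf_weight (insert u x) - leaf_weight x) = 3/2 * leaf_weight x"
  by (simp add: leaf_weight_insert[OF assms] sum_distrib_left leaf_weight_def[of x])

text \<open>The quotient of \<open>(j + 2)\<^sup>2\<close> by \<open>(5/4) ^ j\<close> is largest at
  j = 7, just below 17, so 32 is generous. The step ratio \<open>((j + 3) / (j + 2))\<^sup>2\<close>
  is at most 5/4 only from j = 7 on, hence the explicit cases before.\<close>

lemma square_le_exp: "(real j + 2)\<^sup>2 \<le> 32 * (5/4) ^ j"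
proof (induction j)
  case (Suc j)
  show ?case
  proof (cases "j < 7")
    case True
    then have "j \<in> {0, 1, 2, 3, 4, 5, 6}" by auto
    then show ?thesis by (auto simp: power2_eq_square power_numeral_reduce)
  next
    case False
    then have "(real (Suc j) + 2)\<^sup>2 \<le> 5/4 * (real j + 2)\<^sup>2"
    proof -
      have j: "real j \<ge> 7" using False by simp
      then have "7 * real j \<le> real j * real j" by (intro mult_right_mono) auto
      then have "16 + real j * 4 \<le> real j * real j" using j by linarith
      then show ?thesis by (simp add: power2_eq_square algebra_simps)
    qed
    then show ?thesis using Suc by simp
  qed
qed simp

lemma finite_level [simp]: "finite {v :: bool list. length v = k}"
  using finite_lists_length_eq[of "UNIV :: bool set" k] by simp

lemma finite_below_level [simp]: "finite {v :: bool list. length v < k}"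
proof -
  have "{v :: bool list. length v < k} = (\<Union>j<k. {v. length v = j})" by auto
  then show ?thesis by simp
qed

definition level_square :: "nat \<Rightarrow> bool list set \<Rightarrow> real"
  where "level_square k x = (\<Sum>v | length v = k. scaled_square x v)"

text \<open>Each external node has at most one ancestor on level \<open>k\<close>, and its depth
  counts from there. Bounding the squared depth by the exponential weight thus leaves
  \<open>(4/5) ^ k\<close> times the weight of the whole tree.\<close>

lemma level_square_drift:
  assumes "grown n x"
  shows "(\<Sum>u\<in>external_nodes x. level_square k (insert u x) - level_square k x)
    \<le> 2 * level_square k x + 64 * (4/5) ^ k * leaf_weight x"
proof -
  note fin = grown_external_finite[OF assms]
  let ?L = "{v :: bool list. length v = k}"
  have "(\<Sum>u\<in>external_nodes x. level_square k (insert u x) - level_square k x)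
     = (\<Sum>v\<in>?L. \<Sum>u\<in>external_nodes x. scaled_square (insert u x) v - scaled_square x v)"
    unfolding level_square_def sum_subtractf[symmetric] by (rule sum.swap)
  also have "\<dots> \<le> (\<Sum>v\<in>?L. 2 * scaled_square x v
      + 2 * (\<Sum>u | u \<in> external_nodes x \<and> prefix v u. (real (length u) - real (length v) + 1)\<^sup>2))"
    by (intro sum_mono scaled_square_drift[OF assms])
  also have "\<dots> = 2 * level_square k x + 2 *
    (\<Sum>v\<in>?L. \<Sum>u | u \<in> external_nodes x \<and> prefix v u. (real (length u) - real (length v) + 1)\<^sup>2)"
    by (simp add: level_square_def sum.distrib sum_distrib_left)
  also have "(\<Sum>v\<in>?L. \<Sum>u | u \<in> external_nodes x \<and> prefix v u. (real (length u) - real (length v) + 1)\<^sup>2)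
     \<le> (\<Sum>v\<in>?L. \<Sum>u\<in>external_nodes x. if prefix v u then 32 * (4/5) ^ k * (5/4) ^ length u else 0)"
  proof (rule sum_mono)
    fix v :: "bool list" assume v: "v \<in> ?L"
    have "(\<Sum>u | u \<in> external_nodes x \<and> prefix v u. (real (length u) - real (length v) + 1)\<^sup>2)
       \<le> (\<Sum>u | u \<in> external_nodes x \<and> prefix v u. 32 * (4/5) ^ k * (5/4) ^ length u)"
    proof (rule sum_mono)
      fix u assume "u \<in> {u. u \<in> external_nodes x \<and> prefix v u}"
      then obtain r where r: "u = v @ r" by (auto simp: prefix_def)
      have "(real (length r) + 1)\<^sup>2 \<le> (real (length r) + 2)\<^sup>2" by (intro power_mono) auto
      also have "\<dots> \<le> 32 * (5/4) ^ length r" by (rule square_le_exp)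
      also have "\<dots> = 32 * (4/5) ^ k * (5/4) ^ length u"
      proof -
        have "(4/5::real) ^ k * (5/4) ^ k = 1" by (simp add: power_mult_distrib[symmetric])
        then show ?thesis using v by (simp add: r power_add)
      qed
      finally show "(real (length u) - real (length v) + 1)\<^sup>2 \<le> 32 * (4/5) ^ k * (5/4) ^ length u"
        by (simp add: r)
    qed
    then show "(\<Sum>u | u \<in> external_nodes x \<and> prefix v u. (real (length u) - real (length v) + 1)\<^sup>2)
      \<le> (\<Sum>u\<in>external_nodes x. if prefix v u then 32 * (4/5) ^ k * (5/4) ^ length u else 0)"
      using fin by (simp add: sum.If_cases Int_def)
  qed
  also have "\<dots> = (\<Sum>u\<in>external_nodes x. \<Sum>v\<in>?L. if prefix v u then 32 * (4/5) ^ k * (5/4) ^ length u else 0)"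
    by (rule sum.swap)
  also have "\<dots> \<le> (\<Sum>u\<in>external_nodes x. 32 * (4/5) ^ k * (5/4) ^ length u)"
  proof (rule sum_mono)
    fix u
    have "{v \<in> ?L. prefix v u} \<subseteq> {take k u}" by (auto simp: prefix_def)
    then have "card {v \<in> ?L. prefix v u} \<le> 1"
      using card_mono[of "{take k u}" "{v \<in> ?L. prefix v u}"] by simp
    then have "real (card {v \<in> ?L. prefix v u}) * (32 * (4/5) ^ k * (5/4) ^ length u)
       \<le> 1 * (32 * (4/5) ^ k * (5/4) ^ length u)" by (intro mult_right_mono) auto
    then show "(\<Sum>v\<in>?L. if prefix v u then 32 * (4/5) ^ k * (5/4) ^ length u else 0)
       \<le> 32 * (4/5) ^ k * ((5/4) ^ length u :: real)"
      by (simp add: sum.If_cases Int_def)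
  qed
  also have "\<dots> = 32 * (4/5) ^ k * leaf_weight x" by (simp add: leaf_weight_def sum_distrib_left)
  finally show ?thesis by simp
qed

text \<open>This is the sum of \<open>(5/4) ^ length w * ((m + 1) * (m + 2))\<close> over nodes and
  external nodes alike: an external node has size 0 and contributes twice its weight. Unlike
  \<open>m\<^sup>2\<close>, the polynomial \<open>(m + 1) * (m + 2)\<close> reproduces itself
  exactly, with eigenvalue 2.\<close>

definition weighted_square :: "bool list set \<Rightarrow> real"
  where "weighted_square x
    = node_sum (\<lambda>w m. (5/4) ^ length w * ((real m + 1) * (real m + 2))) x + 2 * leaf_weight x"

lemma weighted_square_drift:
  assumes "grown n x"
  shows "(\<Sum>u\<in>external_nodes x. weighted_square (insert u x) - weighted_square x)
    = 2 * weighted_square x + 5 * leaf_weight x"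
proof -
  let ?F = "\<lambda>(w :: bool list) m. (5/4) ^ length w * ((real m + 1) * (real m + 2))"
  have "(\<Sum>u\<in>external_nodes x. node_sum ?F (insert u x) - node_sum ?F x)
    = 2 * node_sum ?F x + 6 * leaf_weight x"
    unfolding node_sum_drift[OF assms] unfolding node_sum_def leaf_weight_def sum_distrib_left
    by (intro arg_cong2[where f="(+)"] sum.cong) (auto simp: algebra_simps)
  moreover have "(\<Sum>u\<in>external_nodes x. weighted_square (insert u x) - weighted_square x)
    = (\<Sum>u\<in>external_nodes x. (node_sum ?F (insert u x) - node_sum ?F x)
        + 2 * (leaf_weight (insert u x) - leaf_weight x))"
    by (simp add: weighted_square_def algebra_simps)
  moreover have "\<dots> = (\<Sum>u\<in>external_nodes x. node_sum ?F (insert u x) - node_sum ?F x)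
        + 2 * (\<Sum>u\<in>external_nodes x. leaf_weight (insert u x) - leaf_weight x)"
    by (simp only: sum.distrib sum_distrib_left)
  ultimately show ?thesis
    unfolding leaf_weight_drift[OF assms] by (simp add: weighted_square_def)
qed

lemma weighted_square_ge:
  "(\<Sum>w\<in>x. (5/4) ^ length w * (real (subtree_size x w))\<^sup>2) \<le> weighted_square x"
proof -
  have "(\<Sum>w\<in>x. (5/4) ^ length w * (real (subtree_size x w))\<^sup>2)
    \<le> node_sum (\<lambda>w m. (5/4) ^ length w * ((real m + 1) * (real m + 2))) x"
    unfolding node_sum_def by (intro sum_mono mult_left_mono) (auto simp: power2_eq_square algebra_simps)
  then show ?thesis using leaf_weight_nonneg[of x] by (simp add: weighted_square_def)
qed

section \<open>Drifts of path sum and square sum, and the martingale built from them\<close>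

lemma path_sum_drift:
  assumes "grown n x"
  shows "(\<Sum>u\<in>external_nodes x. path_sum (insert u x) [] - path_sum x []) = path_sum x [] + 2 * n + 1"
  using external_depth_sum[OF assms, of "[]"] grown_Nil[OF assms]
  by (simp add: path_sum_insert[OF assms] subtree_size_Nil[OF assms] cong: sum.cong)

lemma square_sum_drift:
  assumes "grown n x"
  shows "(\<Sum>u\<in>external_nodes x. square_sum (insert u x) - square_sum x)
    = 2 * square_sum x + 3 * path_sum x [] + 2 * n + 1"
proof -
  have "(\<Sum>u\<in>external_nodes x. square_sum (insert u x) - square_sum x)
    = (\<Sum>w\<in>x. 2 * (real (subtree_size x w))\<^sup>2 + 3 * real (subtree_size x w) + 1)
      + (\<Sum>u\<in>external_nodes x. 1)"
    unfolding square_sum_def node_sum_drift[OF assms]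
    by (intro arg_cong2[where f="(+)"] sum.cong) (auto simp: power2_eq_square algebra_simps)
  also have "\<dots> = 2 * square_sum x + 3 * path_sum x [] + n + (n + 1)"
    using grown_card[OF assms] grown_external_card[OF assms]
    by (simp add: sum.distrib sum_distrib_left[symmetric] square_sum_def path_sum_def node_sum_def)
  finally show ?thesis by simp
qed

lemma square_sum_insert:
  assumes "grown n x" "u \<in> external_nodes x"
  shows "square_sum x \<le> square_sum (insert u x)"
    and "square_sum (insert u x) \<le> square_sum x + (2 * real n + 1) * (real (length u) + 1)"
proof -
  let ?D = "\<Sum>w | strict_prefix w u. 2 * real (subtree_size x w) + 1"
  have eq: "square_sum (insert u x) = square_sum x + ?D + 1"
    unfolding square_sum_def node_sum_insert[OF assms]
    by (simp add: power2_eq_square algebra_simps)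
  show "square_sum x \<le> square_sum (insert u x)" unfolding eq by (simp add: sum_nonneg)
  have "?D \<le> (\<Sum>w | strict_prefix w u. 2 * real n + 1)"
    using subtree_size_le[OF assms(1)] by (intro sum_mono) simp
  also have "\<dots> = real (length u) * (2 * real n + 1)"
    using card_path[of "[]" u] by simp
  finally show "square_sum (insert u x) \<le> square_sum x + (2 * real n + 1) * (real (length u) + 1)"
    unfolding eq by (simp add: algebra_simps)
qed

text \<open>The martingale behind the theorem: the drift lemmas for the path sum and the square sum
  determine the normalisations and the lower order corrections.\<close>

definition compensated :: "nat \<Rightarrow> bool list set \<Rightarrow> real"
  where "compensated n x = (path_sum x [] - mean_path n) / (real n + 1)
    - (square_sum x + 3 * path_sum x [] + 4 * real n + 2) / ((real n + 1) * (real n + 2))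
    - 4 / (real n + 2)"

text \<open>With S and Q the path sum and the square sum, Q + 3 S + 4 n + 2 has drift twice itself
  plus 4 (n + 1). Divided by (n + 1) (n + 2), its mean therefore rises by 4 / ((n + 2) (n + 3)) per
  step, which is exactly what 4 / (n + 2) loses.\<close>

lemma compensated_step:
  assumes "grown n x"
  shows "(\<Sum>u\<in>external_nodes x. compensated (Suc n) (insert u x)) = (real n + 1) * compensated n x"
proof -
  note card = grown_external_card[OF assms]
  let ?E = "external_nodes x"
  have S: "(\<Sum>u\<in>?E. path_sum (insert u x) []) = (real n + 2) * path_sum x [] + 2 * n + 1"
    using path_sum_drift[OF assms] card by (simp add: sum_subtractf algebra_simps)
  have Q: "(\<Sum>u\<in>?E. square_sum (insert u x))
      = (real n + 3) * square_sum x + 3 * path_sum x [] + 2 * n + 1"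
    using square_sum_drift[OF assms] card by (simp add: sum_subtractf algebra_simps)
  define a b c where "a = real n + 1" and "b = real n + 2" and "c = real n + 3"
  have pos: "a > 0" "b > 0" "c > 0" by (simp_all add: a_def b_def c_def)
  have "compensated (Suc n) (insert u x) = (1 / b - 3 / (b * c)) * path_sum (insert u x) []
     - 1 / (b * c) * square_sum (insert u x)
     - (mean_path (Suc n) / b + (4 * a + 2) / (b * c) + 4 / c)" for u
  proof -
    have e: "real (Suc n) + 1 = b" "real (Suc n) + 2 = c" "real (Suc n) = a"
      by (simp_all add: a_def b_def c_def)
    show ?thesis unfolding compensated_def unfolding e(1,2) unfolding e(3) by (simp add: add_divide_distrib diff_divide_distrib algebra_simps)
  qed
  then have "(\<Sum>u\<in>?E. compensated (Suc n) (insert u x))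
    = (1 / b - 3 / (b * c)) * (\<Sum>u\<in>?E. path_sum (insert u x) [])
     - 1 / (b * c) * (\<Sum>u\<in>?E. square_sum (insert u x))
     - a * (mean_path (Suc n) / b + (4 * a + 2) / (b * c) + 4 / c)"
    by (simp only: sum_subtractf sum_distrib_left sum_constant card) (simp add: a_def add.commute)
  also have "a * (mean_path (Suc n) / b + (4 * a + 2) / (b * c) + 4 / c)
      = ((real n + 2) * mean_path n + 2 * real n + 1) / b + a * ((4 * a + 2) / (b * c) + 4 / c)"
    unfolding mean_path_Suc[symmetric] by (simp add: a_def algebra_simps)
  also have "(1 / b - 3 / (b * c)) * (\<Sum>u\<in>?E. path_sum (insert u x) [])
     - 1 / (b * c) * (\<Sum>u\<in>?E. square_sum (insert u x))
     - (((real n + 2) * mean_path n + 2 * real n + 1) / b + a * ((4 * a + 2) / (b * c) + 4 / c))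
     = a * compensated n x"
    unfolding S Q compensated_def a_def[symmetric] b_def[symmetric] c_def[symmetric]
    using pos by (simp add: divide_simps) (simp add: a_def b_def c_def algebra_simps)
  finally show ?thesis by (simp add: a_def)
qed

lemma sum_square_mean_le:
  fixes f :: "'b \<Rightarrow> real" and m c :: real
  assumes "(\<Sum>u\<in>E. f u) = real (card E) * m"
  shows "(\<Sum>u\<in>E. (f u - m)\<^sup>2) \<le> (\<Sum>u\<in>E. (f u - c)\<^sup>2)"
proof -
  have "(\<Sum>u\<in>E. (f u - c)\<^sup>2) = (\<Sum>u\<in>E. (f u - m)\<^sup>2 + (2 * (m - c) * f u + (c\<^sup>2 - m\<^sup>2)))"
    by (intro sum.cong refl) (simp add: power2_eq_square algebra_simps)
  also have "\<dots> = (\<Sum>u\<in>E. (f u - m)\<^sup>2) + card E * (m - c)\<^sup>2"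
    by (simp add: sum.distrib sum_distrib_left[symmetric] assms) (simp add: power2_eq_square algebra_simps)
  finally show ?thesis by simp
qed

lemma compensated_variance:
  assumes "grown n x"
  shows "(\<Sum>u\<in>external_nodes x. (compensated (Suc n) (insert u x) - compensated n x)\<^sup>2)
    \<le> 128 * leaf_weight x / (real n + 2)\<^sup>2"
proof -
  let ?E = "external_nodes x"
  \<comment> \<open>This is the functional with the time advanced but the two sums not yet updated.
    Mean squares are smallest around the mean, so centring at \<open>c\<close> can only increase the
    sum, and afterwards only the increments of the two sums are left.\<close>
  define c where "c = (path_sum x [] - mean_path (Suc n)) / (real n + 2)
    - (square_sum x + 3 * path_sum x [] + 4 * (real n + 1) + 2) / ((real n + 2) * (real n + 3))
    - 4 / (real n + 3)"
  have "(\<Sum>u\<in>?E. (compensated (Suc n) (insert u x) - compensated n x)\<^sup>2)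
      \<le> (\<Sum>u\<in>?E. (compensated (Suc n) (insert u x) - c)\<^sup>2)"
    by (intro sum_square_mean_le[where m = "compensated n x" and c = c]) (simp add: compensated_step[OF assms] grown_external_card[OF assms] add.commute)
  also have "\<dots> \<le> (\<Sum>u\<in>?E. 128 * (5/4) ^ length u / (real n + 2)\<^sup>2)"
  proof (rule sum_mono)
    fix u assume u: "u \<in> ?E"
    define d where "d = real (length u) + 1"
    define q where "q = square_sum (insert u x) - square_sum x"
    have d: "0 \<le> d" by (simp add: d_def)
    have q: "0 \<le> q" "q \<le> (2 * real n + 1) * d"
      using square_sum_insert[OF assms u] by (simp_all add: q_def d_def)
    have eq: "compensated (Suc n) (insert u x) - c
      = d / (real n + 2) - (q + 3 * d) / ((real n + 2) * (real n + 3))"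
      unfolding compensated_def c_def q_def path_sum_insert[OF assms u] d_def
      by (simp add: add_divide_distrib diff_divide_distrib algebra_simps)
    \<comment> \<open>Both terms of \<open>eq\<close> lie between 0 and 2 d / (n + 2), the second
      because q + 3 d is at most (2 n + 4) d. Hence so does the absolute value of their
      difference.\<close>
    have "0 \<le> (q + 3 * d) / ((real n + 2) * (real n + 3))" using q d by simp
    moreover have "(q + 3 * d) / ((real n + 2) * (real n + 3)) \<le> 2 * d / (real n + 2)"
      using q d by (simp add: divide_simps) (simp add: algebra_simps)
    moreover have "0 \<le> d / (real n + 2)" using d by simp
    ultimately have "\<bar>compensated (Suc n) (insert u x) - c\<bar> \<le> 2 * d / (real n + 2)"
      unfolding eq by (auto simp: abs_le_iff)
    then have "(compensated (Suc n) (insert u x) - c)\<^sup>2 \<le> (2 * d / (real n + 2))\<^sup>2"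
      by (rule abs_le_square_iff[THEN iffD1, OF order_trans]) (use d in simp)
    also have "\<dots> = 4 * d\<^sup>2 / (real n + 2)\<^sup>2" by (simp add: power_divide power_mult_distrib)
    also have "\<dots> \<le> 4 * (32 * (5/4) ^ length u) / (real n + 2)\<^sup>2"
    proof -
      have "d\<^sup>2 \<le> (real (length u) + 2)\<^sup>2" unfolding d_def by (intro power_mono) auto
      also note square_le_exp
      finally show ?thesis by (intro divide_right_mono) auto
    qed
    finally show "(compensated (Suc n) (insert u x) - c)\<^sup>2 \<le> 128 * (5/4) ^ length u / (real n + 2)\<^sup>2"
      by simp
  qed
  also have "\<dots> = 128 * leaf_weight x / (real n + 2)\<^sup>2"
    by (simp add: leaf_weight_def sum_divide_distrib sum_distrib_left)
  finally show ?thesis .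
qed

section \<open>The chain as a Markov process\<close>

lemma countable_finite_trees: "countable finite_trees"
proof -
  have "finite_trees \<subseteq> Collect finite" by (auto simp: finite_trees_def)
  then show ?thesis using countable_Collect_finite countable_subset by blast
qed

lemma set_bst_step:
  assumes "grown n x"
  shows "set_pmf (bst_step x) = (\<lambda>u. insert u x) ` external_nodes x"
proof -
  have "external_nodes x \<noteq> {}" using grown_external_card[OF assms] by force
  then show ?thesis by (simp add: bst_step_def grown_external_finite[OF assms])
qed

lemma bst_step_sum:
  fixes f :: "bool list set \<Rightarrow> real"
  assumes "grown n x"
  shows "(\<Sum>y | grown (Suc n) y. pmf (bst_step x) y * f y)
    = (\<Sum>u\<in>external_nodes x. f (insert u x)) / (real n + 1)"
proof -
  have ne: "external_nodes x \<noteq> {}" using grown_external_card[OF assms] by force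
  have "measure_pmf.expectation (bst_step x) f = (\<Sum>y | grown (Suc n) y. pmf (bst_step x) y *\<^sub>R f y)"
    using set_bst_step[OF assms] grown.insert[OF assms] by (intro integral_measure_pmf finite_grown) auto
  moreover have "measure_pmf.expectation (bst_step x) f = (\<Sum>u\<in>external_nodes x. f (insert u x)) / (real n + 1)"
    using ne grown_external[OF assms] by (simp add: bst_step_def integral_pmf_of_set add.commute)
  ultimately show ?thesis by simp
qed

locale bst = prob_space M for M :: "'a measure" +
  fixes X :: "nat \<Rightarrow> 'a \<Rightarrow> bool list set"
  assumes chain: "bst_chain M X"
begin

lemma measurable_X: "1 \<le> n \<Longrightarrow> X n \<in> M \<rightarrow>\<^sub>M count_space finite_trees"
  using chain by (simp add: bst_chain_def)

lemma measurable_fun1: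
  assumes "1 \<le> n"
  shows "(\<lambda>\<omega>. f (X n \<omega>) :: real) \<in> borel_measurable M"
  by (rule measurable_compose[OF measurable_X[OF assms]]) simp

text \<open>The states form a countable set, so the arguments can be frozen one after the other, for
  an arbitrary \<open>f\<close>. Three times occur because a martingale increment is compared with a
  fixed earlier state.\<close>

lemma measurable_fun3:
  assumes "1 \<le> l" "1 \<le> m" "1 \<le> n"
  shows "(\<lambda>\<omega>. f (X l \<omega>) (X m \<omega>) (X n \<omega>) :: real) \<in> borel_measurable M"
proof -
  have "(\<lambda>\<omega>. f a b (X n \<omega>)) \<in> borel_measurable M" for a b
    by (rule measurable_fun1) fact
  then have "(\<lambda>\<omega>. f a (X m \<omega>) (X n \<omega>)) \<in> borel_measurable M" for a
    by (rule measurable_compose_countable'[OF _ measurable_X countable_finite_trees]) fact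
  then show ?thesis
    by (rule measurable_compose_countable'[OF _ measurable_X countable_finite_trees]) fact
qed

lemma sets_X: "1 \<le> n \<Longrightarrow> {\<omega> \<in> space M. P (X n \<omega>)} \<in> sets M"
  using measurable_sets[OF measurable_X, of n "{x \<in> finite_trees. P x}"] measurable_space[OF measurable_X, of n]
  by (auto simp: vimage_def Int_def conj_commute cong: conj_cong)

section \<open>Histories of finite length and the Markov property\<close>

definition history :: "nat \<Rightarrow> (nat \<Rightarrow> bool list set) \<Rightarrow> 'a set"
  where "history n h = {\<omega> \<in> space M. \<forall>i\<in>{1..n}. X i \<omega> = h i}"

text \<open>\<open>PiE\<close> fixes the values outside \<open>{1..n}\<close>, so different elements
  belong to disjoint events; index 0 is left out since \<open>X 0\<close> is arbitrary.\<close>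

definition histories :: "nat \<Rightarrow> (nat \<Rightarrow> bool list set) set"
  where "histories n = PiE {1..n} (\<lambda>i. {x. grown i x})"

lemma finite_histories: "finite (histories n)"
  unfolding histories_def by (intro finite_PiE finite_grown) auto

lemma history_sets: "history n h \<in> sets M"
proof -
  have "history n h = {\<omega> \<in> space M. \<forall>i\<in>{1..n}. \<omega> \<in> {\<omega> \<in> space M. X i \<omega> = h i}}"
    by (auto simp: history_def)
  also have "\<dots> \<in> sets M"
    by (rule sets.sets_Collect_finite_All) (use sets_X in auto)
  finally show ?thesis .
qed

lemma history_unique:
  assumes "\<omega> \<in> history n h" "\<omega> \<in> history n h'" "h \<in> histories n" "h' \<in> histories n"
  shows "h = h'"
  using assms by (intro PiE_ext[of h "{1..n}" _ h']) (auto simp: history_def histories_def)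

lemma history_disjoint:
  assumes "\<And>h. A h \<subseteq> history n h"
  shows "disjoint_family_on A (histories n)"
  unfolding disjoint_family_on_def
proof (intro ballI impI)
  fix h h' assume *: "h \<in> histories n" "h' \<in> histories n" "h \<noteq> h'"
  then have "history n h \<inter> history n h' = {}" using history_unique by blast
  then show "A h \<inter> A h' = {}" using assms by blast
qed

lemma restrict_history:
  assumes "\<omega> \<in> space M" "\<forall>i\<in>{1..n}. grown i (X i \<omega>)"
  shows "restrict (\<lambda>i. X i \<omega>) {1..n} \<in> histories n" "\<omega> \<in> history n (restrict (\<lambda>i. X i \<omega>) {1..n})"
  using assms by (auto simp: history_def histories_def)

lemma markov:
  assumes "1 \<le> n"
  shows "prob (history n h \<inter> {\<omega> \<in> space M. X (Suc n) \<omega> = y}) = prob (history n h) * pmf (bst_step (h n)) y"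
proof -
  have "history n h \<inter> {\<omega> \<in> space M. X (Suc n) \<omega> = y}
    = {\<omega> \<in> space M. (\<forall>i\<in>{1..n}. X i \<omega> = h i) \<and> X (n + 1) \<omega> = y}"
    by (auto simp: history_def)
  then show ?thesis using chain assms by (simp add: bst_chain_def history_def)
qed

lemma history_grown:
  assumes "1 \<le> n" "h \<in> histories n"
  shows "grown n (h n)"
  using assms by (auto simp: histories_def PiE_iff)

text \<open>The chain is given only through probabilities of whole histories, so its support has to
  be recovered from masses: each grown history passes its entire mass to extensions by grown trees,
  and the total stays 1.\<close>

lemma AE_grown_upto: "1 \<le> n \<Longrightarrow> AE \<omega> in M. \<forall>i\<in>{1..n}. grown i (X i \<omega>)"
proof (induction n rule: dec_induct)
  case base
  have "AE \<omega> in M. X 1 \<omega> = {[]}" using chain by (simp add: bst_chain_def)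
  then show ?case by eventually_elim (auto intro: grown.root)
next
  case (step n)
  let ?Y = "\<lambda>y. {\<omega> \<in> space M. X (Suc n) \<omega> = y}"
  let ?A = "\<lambda>h. \<Union>y\<in>{y. grown (Suc n) y}. history n h \<inter> ?Y y"
  have setsY: "?Y y \<in> sets M" for y using sets_X[of "Suc n" "\<lambda>x. x = y"] by simp
  have A: "prob (?A h) = prob (history n h)" if h: "h \<in> histories n" for h
  proof -
    have "prob (?A h) = (\<Sum>y | grown (Suc n) y. prob (history n h \<inter> ?Y y))"
      using setsY history_sets
      by (intro finite_measure_finite_Union finite_grown) (auto simp: disjoint_family_on_def)
    also have "\<dots> = prob (history n h) * (\<Sum>y | grown (Suc n) y. pmf (bst_step (h n)) y * 1)"
      using markov[OF step.hyps(1)] by (simp add: sum_distrib_left)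
    also have "\<dots> = prob (history n h)"
      unfolding bst_step_sum[OF history_grown[OF step.hyps(1) h]]
      using grown_external_card[OF history_grown[OF step.hyps(1) h]] by (simp add: field_simps)
    finally show ?thesis .
  qed
  have setsA: "?A h \<in> sets M" for h
    using history_sets setsY finite_grown by (intro sets.finite_UN) auto
  have "prob (\<Union>h\<in>histories n. ?A h) = (\<Sum>h\<in>histories n. prob (?A h))"
    using setsA by (intro finite_measure_finite_Union finite_histories history_disjoint) auto
  also have "\<dots> = (\<Sum>h\<in>histories n. prob (history n h))" using A by simp
  also have "\<dots> = prob (\<Union>h\<in>histories n. history n h)"
    using history_sets
    by (intro finite_measure_finite_Union[symmetric] finite_histories history_disjoint) auto
  also have "\<dots> = 1"
  proof (rule prob_eq_1[THEN iffD2])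
    show "(\<Union>h\<in>histories n. history n h) \<in> events" using history_sets finite_histories by auto
    show "AE \<omega> in M. \<omega> \<in> (\<Union>h\<in>histories n. history n h)"
      using step.IH AE_space by eventually_elim (use restrict_history in blast)
  qed
  finally have "AE \<omega> in M. \<omega> \<in> (\<Union>h\<in>histories n. ?A h)"
    by (rule prob_eq_1[THEN iffD1, rotated]) (rule sets.finite_UN[OF finite_histories setsA])
  then show ?case
  proof eventually_elim
    case (elim \<omega>)
    then obtain h y where *: "h \<in> histories n" "grown (Suc n) y" "\<omega> \<in> history n h" "X (Suc n) \<omega> = y" by auto
    have "grown i (X i \<omega>)" if "i \<in> {1..n}" for i
      using *(1,3) that by (auto simp: histories_def history_def PiE_iff)
    then show ?case using * by (auto simp: le_Suc_eq)
  qed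
qed

lemma AE_grown:
  assumes "1 \<le> n"
  shows "AE \<omega> in M. grown n (X n \<omega>)"
  using AE_grown_upto[OF assms] by eventually_elim (use assms in auto)

lemma integrable_fun3:
  fixes f :: "bool list set \<Rightarrow> bool list set \<Rightarrow> bool list set \<Rightarrow> real"
  assumes "1 \<le> l" "1 \<le> m" "1 \<le> n"
  shows "integrable M (\<lambda>\<omega>. f (X l \<omega>) (X m \<omega>) (X n \<omega>))"
proof (rule integrable_const_bound)
  let ?G = "\<lambda>n. {x. grown n x}"
  define B where "B = (\<Sum>(a, b, c)\<in>?G l \<times> ?G m \<times> ?G n. \<bar>f a b c\<bar>)"
  show "AE \<omega> in M. norm (f (X l \<omega>) (X m \<omega>) (X n \<omega>)) \<le> B"
    using AE_grown[OF assms(1)] AE_grown[OF assms(2)] AE_grown[OF assms(3)]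
  proof eventually_elim
    case (elim \<omega>)
    have "(case (X l \<omega>, X m \<omega>, X n \<omega>) of (a, b, c) \<Rightarrow> \<bar>f a b c\<bar>) \<le> B"
      unfolding B_def by (rule member_le_sum) (use elim finite_grown in auto)
    then show ?case by simp
  qed
qed (rule measurable_fun3[OF assms])

lemma integrable_fun1:
  fixes f :: "bool list set \<Rightarrow> real"
  shows "1 \<le> n \<Longrightarrow> integrable M (\<lambda>\<omega>. f (X n \<omega>))"
  using integrable_fun3[of n n n "\<lambda>_ _. f"] by simp

lemma integrable_fun2:
  fixes f :: "bool list set \<Rightarrow> bool list set \<Rightarrow> real"
  shows "1 \<le> m \<Longrightarrow> 1 \<le> n \<Longrightarrow> integrable M (\<lambda>\<omega>. f (X m \<omega>) (X n \<omega>))"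
  using integrable_fun3[of m m n "\<lambda>_. f"] by simp

text \<open>The Markov property with an earlier state as a parameter. Almost surely exactly one
  grown history occurs, so both integrands are finite combinations of indicators to which
  \<open>markov\<close> applies termwise.\<close>

lemma expectation_step3:
  fixes f :: "bool list set \<Rightarrow> bool list set \<Rightarrow> bool list set \<Rightarrow> real"
  assumes "1 \<le> m" "m \<le> n"
  shows "expectation (\<lambda>\<omega>. f (X m \<omega>) (X n \<omega>) (X (Suc n) \<omega>))
    = expectation (\<lambda>\<omega>. (\<Sum>u\<in>external_nodes (X n \<omega>). f (X m \<omega>) (X n \<omega>) (insert u (X n \<omega>))) / (real n + 1))"
proof -
  have n: "1 \<le> n" using assms by simp
  let ?Y = "\<lambda>y. {\<omega> \<in> space M. X (Suc n) \<omega> = y}"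
  let ?G = "{y. grown (Suc n) y}"
  have setsY: "?Y y \<in> sets M" for y using sets_X[of "Suc n" "\<lambda>x. x = y"] by simp
  have AE1: "AE \<omega> in M. f (X m \<omega>) (X n \<omega>) (X (Suc n) \<omega>)
     = (\<Sum>h\<in>histories n. \<Sum>y\<in>?G. f (h m) (h n) y * indicator (history n h \<inter> ?Y y) \<omega>)"
    using AE_grown_upto[OF n] AE_grown[of "Suc n", simplified] AE_space
  proof eventually_elim
    case (elim \<omega>)
    let ?h = "restrict (\<lambda>i. X i \<omega>) {1..n}" and ?y = "X (Suc n) \<omega>"
    note h = restrict_history[OF elim(3,1)]
    have ind: "indicator (history n h \<inter> ?Y y) \<omega> = (if h = ?h then if y = ?y then 1 else 0 else (0::real))"
      if "h \<in> histories n" for h y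
    proof (cases "h = ?h")
      case True
      then show ?thesis using h(2) elim(3) by (simp add: indicator_def)
    next
      case False
      then have "\<omega> \<notin> history n h" using history_unique[OF _ h(2) that h(1)] by blast
      then show ?thesis using False by (simp add: indicator_def)
    qed
    have "(\<Sum>h\<in>histories n. \<Sum>y\<in>?G. f (h m) (h n) y * indicator (history n h \<inter> ?Y y) \<omega>)
      = (\<Sum>h\<in>histories n. if h = ?h then (\<Sum>y\<in>?G. if y = ?y then f (h m) (h n) y else 0) else 0)"
    proof (rule sum.cong[OF refl])
      fix h assume "h \<in> histories n"
      then show "(\<Sum>y\<in>?G. f (h m) (h n) y * indicator (history n h \<inter> ?Y y) \<omega>)
        = (if h = ?h then (\<Sum>y\<in>?G. if y = ?y then f (h m) (h n) y else 0) else 0)"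
        by (simp add: ind split del: if_split cong: if_cong) (simp add: if_distrib[where f = "(*) _"] cong: if_cong)
    qed
    also have "\<dots> = f (?h m) (?h n) ?y"
      using h(1) finite_histories elim(2) finite_grown by (simp add: sum.delta)
    finally show ?case using assms n by simp
  qed
  have AE2: "AE \<omega> in M. (\<Sum>u\<in>external_nodes (X n \<omega>). f (X m \<omega>) (X n \<omega>) (insert u (X n \<omega>))) / (real n + 1)
     = (\<Sum>h\<in>histories n. (\<Sum>u\<in>external_nodes (h n). f (h m) (h n) (insert u (h n))) / (real n + 1)
         * indicator (history n h) \<omega>)"
    using AE_grown_upto[OF n] AE_space
  proof eventually_elim
    case (elim \<omega>)
    let ?h = "restrict (\<lambda>i. X i \<omega>) {1..n}"
    note h = restrict_history[OF elim(2,1)]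
    have ind: "indicator (history n h) \<omega> = (if h = ?h then 1 else (0::real))"
      if "h \<in> histories n" for h
    proof (cases "h = ?h")
      case True
      then show ?thesis using h(2) by (simp add: indicator_def)
    next
      case False
      then have "\<omega> \<notin> history n h" using history_unique[OF _ h(2) that h(1)] by blast
      then show ?thesis using False by (simp add: indicator_def)
    qed
    have "(\<Sum>h\<in>histories n. (\<Sum>u\<in>external_nodes (h n). f (h m) (h n) (insert u (h n))) / (real n + 1)
         * indicator (history n h) \<omega>)
      = (\<Sum>h\<in>histories n. if h = ?h then
         (\<Sum>u\<in>external_nodes (h n). f (h m) (h n) (insert u (h n))) / (real n + 1) else 0)"
      by (intro sum.cong refl) (simp add: ind)
    also have "\<dots> = (\<Sum>u\<in>external_nodes (?h n). f (?h m) (?h n) (insert u (?h n))) / (real n + 1)"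
      using h(1) finite_histories by (simp add: sum.delta)
    finally show ?case using assms n by simp
  qed
  have "expectation (\<lambda>\<omega>. f (X m \<omega>) (X n \<omega>) (X (Suc n) \<omega>))
     = expectation (\<lambda>\<omega>. \<Sum>h\<in>histories n. \<Sum>y\<in>?G. f (h m) (h n) y * indicator (history n h \<inter> ?Y y) \<omega>)"
    using AE1 measurable_fun3[OF assms(1) n, of "Suc n" f] history_sets setsY
    by (intro integral_cong_AE) auto
  also have "\<dots> = (\<Sum>h\<in>histories n. \<Sum>y\<in>?G. f (h m) (h n) y * prob (history n h \<inter> ?Y y))"
    using history_sets setsY by (simp add: Bochner_Integration.integral_sum integrable_real_indicator emeasure_eq_measure)
  also have "\<dots> = (\<Sum>h\<in>histories n. (\<Sum>y\<in>?G. pmf (bst_step (h n)) y * f (h m) (h n) y) * prob (history n h))"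
    by (simp add: markov[OF n] sum_distrib_left mult_ac)
  also have "\<dots> = (\<Sum>h\<in>histories n. (\<Sum>u\<in>external_nodes (h n). f (h m) (h n) (insert u (h n))) / (real n + 1)
       * prob (history n h))"
    by (intro sum.cong refl) (simp add: bst_step_sum[OF history_grown[OF n]])
  also have "\<dots> = expectation (\<lambda>\<omega>. \<Sum>h\<in>histories n. (\<Sum>u\<in>external_nodes (h n). f (h m) (h n) (insert u (h n)))
       / (real n + 1) * indicator (history n h) \<omega>)"
    using history_sets by (simp add: Bochner_Integration.integral_sum integrable_real_indicator emeasure_eq_measure)
  also have "\<dots> = expectation (\<lambda>\<omega>. (\<Sum>u\<in>external_nodes (X n \<omega>). f (X m \<omega>) (X n \<omega>) (insert u (X n \<omega>))) / (real n + 1))"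
    using AE2 measurable_fun3[OF assms(1) n n, of "\<lambda>a b _. (\<Sum>u\<in>external_nodes b. f a b (insert u b)) / (real n + 1)"]
      history_sets
    by (intro integral_cong_AE) (auto elim: eventually_mono)
  finally show ?thesis .
qed

lemma expectation_step:
  fixes f :: "bool list set \<Rightarrow> real"
  assumes "1 \<le> n"
  shows "expectation (\<lambda>\<omega>. f (X (Suc n) \<omega>))
    = expectation (\<lambda>\<omega>. (\<Sum>u\<in>external_nodes (X n \<omega>). f (insert u (X n \<omega>))) / (real n + 1))"
  using expectation_step3[of n n "\<lambda>_ _. f"] assms by simp

lemma expectation_mono_grown:
  fixes f g :: "bool list set \<Rightarrow> real"
  assumes "1 \<le> n" "\<And>x. grown n x \<Longrightarrow> f x \<le> g x"
  shows "expectation (\<lambda>\<omega>. f (X n \<omega>)) \<le> expectation (\<lambda>\<omega>. g (X n \<omega>))"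
  using AE_grown[OF assms(1)] by (intro integral_mono_AE integrable_fun1 assms(1)) (auto elim: eventually_mono intro: assms(2))

lemma expectation_X1: "expectation (\<lambda>\<omega>. f (X 1 \<omega>) :: real) = f {[]}"
proof -
  have "AE \<omega> in M. X 1 \<omega> = {[]}" using chain by (simp add: bst_chain_def)
  then have "expectation (\<lambda>\<omega>. f (X 1 \<omega>)) = expectation (\<lambda>\<omega>. f {[]})"
    using measurable_fun1[of 1 f] by (intro integral_cong_AE) (auto elim: eventually_mono)
  then show ?thesis by (simp add: prob_space)
qed

text \<open>The indicator of an impossible transition vanishes at every insertion, so its
  expectation is 0.\<close>

lemma AE_step: 
  assumes "1 \<le> n"
  shows "AE \<omega> in M. \<exists>u\<in>external_nodes (X n \<omega>). X (Suc n) \<omega> = insert u (X n \<omega>)"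
proof -
  define f where "f a x y = (if \<exists>u\<in>external_nodes x. y = insert u x then 0 else 1 :: real)"
    for a x y :: "bool list set"
  have "expectation (\<lambda>\<omega>. f (X n \<omega>) (X n \<omega>) (X (Suc n) \<omega>)) = 0"
  proof -
    have "(\<Sum>u\<in>external_nodes x. f x x (insert u x)) = 0" for x
      unfolding f_def by (intro sum.neutral) auto
    then show ?thesis unfolding expectation_step3[OF assms order_refl] by simp
  qed
  moreover have "integrable M (\<lambda>\<omega>. f (X n \<omega>) (X n \<omega>) (X (Suc n) \<omega>))"
    using assms by (intro integrable_fun3) auto
  moreover have "AE \<omega> in M. 0 \<le> f (X n \<omega>) (X n \<omega>) (X (Suc n) \<omega>)" by (simp add: f_def)
  ultimately have "AE \<omega> in M. f (X n \<omega>) (X n \<omega>) (X (Suc n) \<omega>) = 0"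
    by (subst (asm) integral_nonneg_eq_0_iff_AE) auto
  then show ?thesis by eventually_elim (simp add: f_def split: if_splits)
qed

lemma expectation_drift_le:
  fixes f g :: "bool list set \<Rightarrow> real"
  assumes "1 \<le> n"
    and drift: "\<And>x. grown n x \<Longrightarrow> (\<Sum>u\<in>external_nodes x. f (insert u x) - f x) \<le> a * f x + b * g x"
  shows "expectation (\<lambda>\<omega>. f (X (Suc n) \<omega>))
    \<le> (1 + a / (real n + 1)) * expectation (\<lambda>\<omega>. f (X n \<omega>)) + b / (real n + 1) * expectation (\<lambda>\<omega>. g (X n \<omega>))"
proof -
  have "(\<Sum>u\<in>external_nodes x. f (insert u x)) / (real n + 1)
     \<le> (1 + a / (real n + 1)) * f x + b / (real n + 1) * g x" if x: "grown n x" for x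
  proof -
    have "(\<Sum>u\<in>external_nodes x. f (insert u x)) \<le> (real n + 1) * f x + (a * f x + b * g x)"
      using drift[OF x] grown_external_card[OF x] by (simp add: sum_subtractf algebra_simps)
    then have "(\<Sum>u\<in>external_nodes x. f (insert u x)) / (real n + 1)
      \<le> ((real n + 1) * f x + (a * f x + b * g x)) / (real n + 1)"
      by (intro divide_right_mono) auto
    also have "\<dots> = (1 + a / (real n + 1)) * f x + b / (real n + 1) * g x"
      by (simp add: divide_simps) (simp add: algebra_simps)
    finally show ?thesis .
  qed
  then have "expectation (\<lambda>\<omega>. f (X (Suc n) \<omega>))
    \<le> expectation (\<lambda>\<omega>. (1 + a / (real n + 1)) * f (X n \<omega>) + b / (real n + 1) * g (X n \<omega>))"
    unfolding expectation_step[OF assms(1)] by (intro expectation_mono_grown assms(1)) auto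
  also have "\<dots> = (1 + a / (real n + 1)) * expectation (\<lambda>\<omega>. f (X n \<omega>)) + b / (real n + 1) * expectation (\<lambda>\<omega>. g (X n \<omega>))"
    using integrable_fun1[OF assms(1)] by simp
  finally show ?thesis .
qed

text \<open>The mean is multiplied by 1 + (3/2) / (n + 1) in each step, and (n + 1)^(3/2) grows at
  least as fast from one step to the next.\<close>

lemma expectation_leaf_weight:
  "1 \<le> n \<Longrightarrow> expectation (\<lambda>\<omega>. leaf_weight (X n \<omega>)) \<le> (real n + 1) * sqrt (real n + 1)"
proof (induction n rule: dec_induct)
  case base
  \<comment> \<open>At time 1 the weight is 2 * 5/4, to be compared with 2 * sqrt 2.\<close>
  have "5/4 \<le> sqrt (2::real)" by (rule real_le_rsqrt) (simp add: power2_eq_square)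
  then show ?case
    unfolding expectation_X1 by (simp add: leaf_weight_def external_nodes_root)
next
  case (step n)
  define t where "t = real n + 1"
  have t: "t > 0" by (simp add: t_def)
  have "expectation (\<lambda>\<omega>. leaf_weight (X (Suc n) \<omega>))
    \<le> (1 + (3/2) / t) * expectation (\<lambda>\<omega>. leaf_weight (X n \<omega>)) + 0 / t * expectation (\<lambda>\<omega>. leaf_weight (X n \<omega>))"
    unfolding t_def by (rule expectation_drift_le[OF step.hyps(1)]) (simp add: leaf_weight_drift)
  also have "\<dots> = (1 + (3/2) / t) * expectation (\<lambda>\<omega>. leaf_weight (X n \<omega>))" by simp
  also have "\<dots> \<le> (1 + (3/2) / t) * (t * sqrt t)"
    using step.IH t by (intro mult_left_mono) (simp_all add: t_def)
  also have "\<dots> = (t + 3/2) * sqrt t" using t by (simp add: field_simps)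
  also have "\<dots> \<le> (t + 1) * sqrt (t + 1)"
  proof (rule power2_le_imp_le)
    have "(t + 3/2)\<^sup>2 * t \<le> (t + 1)\<^sup>2 * (t + 1)"
      using t by (simp add: power2_eq_square algebra_simps)
    then show "((t + 3/2) * sqrt t)\<^sup>2 \<le> ((t + 1) * sqrt (t + 1))\<^sup>2"
      using t by (simp add: power_mult_distrib)
  qed (use t in simp)
  finally show ?case by (simp add: t_def add.commute add.left_commute)
qed

end

text \<open>The left side is of order n^(-3/2). A telescoping majorant gives explicit partial sums,
  both for the growth recursion and for the martingale increments.\<close>

lemma inverse_sqrt_telescope:
  assumes "1 \<le> n"
  shows "sqrt (real n + 1) / (real n + 1)\<^sup>2 \<le> 2 * (1 / sqrt (real n) - 1 / sqrt (real n + 1))"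
proof -
  define a b where "a = sqrt (real n)" and "b = sqrt (real n + 1)"
  have a: "0 < a" "0 < b" "a \<le> b" using assms by (simp_all add: a_def b_def)
  have sq: "b\<^sup>2 = a\<^sup>2 + 1" "b\<^sup>2 = real n + 1" by (simp_all add: a_def b_def)
  have "(b - a) * (b + a) = 1" using sq by (simp add: power2_eq_square algebra_simps)
  then have ba: "b - a = 1 / (b + a)" using a by (simp add: field_simps)
  have "sqrt (real n + 1) / (real n + 1)\<^sup>2 = b / (b\<^sup>2)\<^sup>2" using sq by (simp add: b_def)
  also have "\<dots> = 1 / (b * b * b)" using a by (simp add: power2_eq_square field_simps)
  also have "\<dots> \<le> 2 * ((b - a) / (a * b))"
  proof -
    have "a * b * (b + a) \<le> 2 * (b * b * b)"
    proof -
      have "a * b * (b + a) \<le> b * b * (b + b)" using a by (intro mult_mono) auto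
      then show ?thesis by simp
    qed
    then have "2 / (2 * (b * b * b)) \<le> 2 / (a * b * (b + a))"
      using a by (intro divide_left_mono) auto
    then show ?thesis unfolding ba by (simp add: mult_ac)
  qed
  also have "(b - a) / (a * b) = 1 / a - 1 / b" using a by (simp add: field_simps)
  finally show ?thesis by (simp add: a_def b_def)
qed

text \<open>Variation of constants. The homogeneous recursion is solved by (n + 1) (n + 2), which is
  6 at n = 1; relative to it the source is of order n^(-3/2), hence summable. The induction carries
  the partial sums of its telescoping bound.\<close>

lemma quadratic_growth:
  fixes e :: "nat \<Rightarrow> real"
  assumes step: "\<And>n. 1 \<le> n \<Longrightarrow> e (Suc n) \<le> (1 + 2 / (real n + 1)) * e n + K * sqrt (real n + 1)"
    and e1: "e 1 \<le> 6 * B" and K: "0 \<le> K" and n: "1 \<le> n"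
  shows "e n \<le> (B + 2 * K) * ((real n + 1) * (real n + 2))"
proof -
  have "e n \<le> (B + 2 * K * (1 - 1 / sqrt (real n))) * ((real n + 1) * (real n + 2))"
    using n
  proof (induction n rule: dec_induct)
    case base
    then show ?case using e1 by simp
  next
    case (step n)
    define t where "t = real n + 1"
    define c where "c = B + 2 * K * (1 - 1 / sqrt (real n))"
    have t: "t > 1" using step.hyps by (simp add: t_def)
    have "e (Suc n) \<le> (1 + 2 / t) * e n + K * sqrt t" using assms(1)[OF step.hyps(1)] by (simp add: t_def)
    also have "\<dots> \<le> (1 + 2 / t) * (c * (t * (t + 1))) + K * sqrt t"
      using step.IH t by (intro add_right_mono mult_left_mono) (simp_all add: t_def c_def algebra_simps)
    also have "(1 + 2 / t) * (c * (t * (t + 1))) = c * ((t + 1) * (t + 2))"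
      using t by (simp add: field_simps)
    also have "K * sqrt t \<le> K * (sqrt t / t\<^sup>2 * ((t + 1) * (t + 2)))"
    proof (intro mult_left_mono K)
      have "sqrt t * 1 \<le> sqrt t * (((t + 1) * (t + 2)) / t\<^sup>2)"
        using t by (intro mult_left_mono) (auto simp: field_simps power2_eq_square)
      then show "sqrt t \<le> sqrt t / t\<^sup>2 * ((t + 1) * (t + 2))" by simp
    qed
    also have "c * ((t + 1) * (t + 2)) + K * (sqrt t / t\<^sup>2 * ((t + 1) * (t + 2)))
       = (c + K * (sqrt t / t\<^sup>2)) * ((t + 1) * (t + 2))"
      by (simp only: distrib_right mult.assoc)
    also have "\<dots> \<le> (c + K * (2 * (1 / sqrt (real n) - 1 / sqrt t))) * ((t + 1) * (t + 2))"
      using inverse_sqrt_telescope[OF step.hyps(1)] K t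
      by (intro mult_right_mono add_left_mono mult_left_mono) (auto simp: t_def)
    also have "\<dots> = (B + 2 * K * (1 - 1 / sqrt t)) * ((t + 1) * (t + 2))"
      by (simp add: c_def algebra_simps)
    finally show ?case by (simp add: t_def algebra_simps)
  qed
  also have "\<dots> \<le> (B + 2 * K) * ((real n + 1) * (real n + 2))"
    using K by (intro mult_right_mono add_left_mono) (auto intro: mult_left_le)
  finally show ?thesis .
qed

section \<open>Moment bounds\<close>

lemma level_square_root: "level_square k {[]} = 0"
proof -
  have "excess {[]} v = 0" for v
  proof (cases "v = []")
    case True
    have "subtree_size {[]} [] = 1" by (simp add: subtree_size_def)
    then show ?thesis
      using True mean_path_Suc[of 0] by (simp add: excess_def path_sum_def node_sum_def)
  next
    case False
    then show ?thesis by (simp add: excess_outside binary_tree_def)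
  qed
  then show ?thesis by (simp add: level_square_def scaled_square_def)
qed

lemma level_Suc_sum:
  fixes f :: "bool list \<Rightarrow> 'b::comm_monoid_add"
  shows "(\<Sum>v | length v = Suc k. f v) = (\<Sum>v | length v = k. f (v @ [False]) + f (v @ [True]))"
proof -
  let ?g = "\<lambda>b v. v @ [b :: bool]"
  have "{v :: bool list. length v = Suc k} = ?g False ` {v. length v = k} \<union> ?g True ` {v. length v = k}"
  proof (intro set_eqI iffI)
    fix v :: "bool list" assume "v \<in> {v. length v = Suc k}"
    then show "v \<in> ?g False ` {v. length v = k} \<union> ?g True ` {v. length v = k}"
      by (cases v rule: rev_cases) auto
  qed auto
  moreover have "(\<Sum>v\<in>?g False ` {v. length v = k} \<union> ?g True ` {v. length v = k}. f v)
      = (\<Sum>v\<in>?g False ` {v. length v = k}. f v) + (\<Sum>v\<in>?g True ` {v. length v = k}. f v)"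
    by (intro sum.union_disjoint) auto
  ultimately show ?thesis by (simp add: sum.reindex inj_on_def sum.distrib)
qed

lemma below_Suc_sum:
  fixes f :: "bool list \<Rightarrow> 'b::comm_monoid_add"
  shows "(\<Sum>v | length v < Suc k. f v) = (\<Sum>v | length v < k. f v) + (\<Sum>v | length v = k. f v)"
proof -
  have "{v :: bool list. length v < Suc k} = {v. length v < k} \<union> {v. length v = k}" by auto
  then show ?thesis by (simp only:) (intro sum.union_disjoint, auto)
qed

text \<open>What remains of the recursion \<open>path_sum_rec\<close> when all path sums are
  replaced by their means. Unlike the excess, it is a function of three subtree sizes, so that at a
  fixed node it has a limit after scaling.\<close>

definition toll :: "bool list set \<Rightarrow> bool list \<Rightarrow> real"
  where "toll x v = real (subtree_size x v) + mean_path (subtree_size x (v @ [False]))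
    + mean_path (subtree_size x (v @ [True])) - mean_path (subtree_size x v)"

lemma excess_eq_toll_sum:
  assumes "finite x" "binary_tree x"
  shows "excess x [] = (\<Sum>v | length v < k. toll x v) + (\<Sum>v | length v = k. excess x v)"
proof (induction k)
  case 0
  then show ?case by simp
next
  case (Suc k)
  have "excess x v = toll x v + (excess x (v @ [False]) + excess x (v @ [True]))" for v
    using path_sum_rec[OF assms, of v] by (simp add: excess_def toll_def)
  then have "(\<Sum>v | length v = k. excess x v)
      = (\<Sum>v | length v = k. toll x v + (excess x (v @ [False]) + excess x (v @ [True])))"
    by (intro sum.cong refl)
  also have "\<dots> = (\<Sum>v | length v = k. toll x v) + (\<Sum>v | length v = Suc k. excess x v)"
    by (simp only: level_Suc_sum sum.distrib)
  finally have "(\<Sum>v | length v = k. excess x v)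
      = (\<Sum>v | length v = k. toll x v) + (\<Sum>v | length v = Suc k. excess x v)" .
  then show ?case using Suc by (simp only: below_Suc_sum add.assoc)
qed

lemma geometric_tail: "(\<Sum>j=k..m. (4/5) ^ j) \<le> 5 * (4/5 :: real) ^ k"
proof (cases "k \<le> m")
  case True
  have "(\<Sum>j=k..m. (4/5 :: real) ^ j) = ((4/5) ^ k - (4/5) ^ Suc m) / (1 - 4/5)"
    using True by (subst sum_gp) auto
  then show ?thesis by simp
qed simp

text \<open>After exchanging the sums, every node of the tree has at most one ancestor on each
  level, so it meets a geometric series.\<close>

lemma finite_level_part:
  assumes "grown n x"
  shows "(\<Sum>u | u \<in> x \<and> k \<le> length u. (4/5) ^ length u * real (subtree_size x u)) \<le> 5 * (4/5) ^ k * real n"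
proof -
  note fin = grown_finite[OF assms]
  have "(\<Sum>u | u \<in> x \<and> k \<le> length u. (4/5) ^ length u * real (subtree_size x u))
    = (\<Sum>u | u \<in> x \<and> k \<le> length u. \<Sum>w\<in>x. if prefix u w then (4/5) ^ length u else (0::real))"
    using fin by (intro sum.cong refl) (simp add: sum.If_cases Int_def subtree_size_def)
  also have "\<dots> = (\<Sum>w\<in>x. \<Sum>u | u \<in> x \<and> k \<le> length u. if prefix u w then (4/5) ^ length u else (0::real))"
    by (rule sum.swap)
  also have "\<dots> \<le> (\<Sum>w\<in>x. 5 * (4/5) ^ k)"
  proof (rule sum_mono)
    fix w assume "w \<in> x"
    have "(\<Sum>u | u \<in> x \<and> k \<le> length u. if prefix u w then (4/5) ^ length u else (0::real))
      = (\<Sum>u\<in>{u. (u \<in> x \<and> k \<le> length u) \<and> prefix u w}. (4/5) ^ length u)"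
      using fin by (simp add: sum.If_cases Int_def)
    also have "\<dots> \<le> (\<Sum>u\<in>(\<lambda>j. take j w) ` {k..length w}. (4/5) ^ length u)"
    proof (rule sum_mono2)
      show "{u. (u \<in> x \<and> k \<le> length u) \<and> prefix u w} \<subseteq> (\<lambda>j. take j w) ` {k..length w}"
      proof
        fix u assume "u \<in> {u. (u \<in> x \<and> k \<le> length u) \<and> prefix u w}"
        then have "u = take (length u) w" "length u \<in> {k..length w}"
          by (auto simp: prefix_def)
        then show "u \<in> (\<lambda>j. take j w) ` {k..length w}" by blast
      qed
    qed auto
    also have "\<dots> = (\<Sum>j=k..length w. (4/5) ^ j)"
      by (subst sum.reindex) (auto simp: inj_on_def dest: arg_cong[where f = length])
    also have "\<dots> \<le> 5 * (4/5) ^ k" by (rule geometric_tail)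
    finally show "(\<Sum>u | u \<in> x \<and> k \<le> length u. if prefix u w then (4/5) ^ length u else (0::real)) \<le> 5 * (4/5) ^ k" .
  qed
  also have "\<dots> = 5 * (4/5) ^ k * real n" by (simp add: grown_card[OF assms])
  finally show ?thesis .
qed

definition square_tail :: "nat \<Rightarrow> bool list set \<Rightarrow> real"
  where "square_tail k x = (\<Sum>u | u \<in> x \<and> k \<le> length u. (real (subtree_size x u) / real (card x))\<^sup>2)"

text \<open>The square of the tail is of fourth order in the sizes. Cauchy-Schwarz with weights
  (4/5)^d and (5/4)^d splits it so that one factor is at most 5 (4/5)^k n^2 for every tree; only a
  second moment is then left to estimate.\<close>

lemma square_tail_le:
  assumes "grown n x"
  shows "(square_tail k x)\<^sup>2 \<le> 5 * (4/5) ^ k / (real n)\<^sup>2 * weighted_square x"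
proof -
  let ?T = "{u. u \<in> x \<and> k \<le> length u}" and ?m = "\<lambda>u. real (subtree_size x u)"
  have n: "n > 0" by (rule grown_pos[OF assms])
  have fin: "finite ?T" using grown_finite[OF assms] by simp
  have w: "sqrt ((4/5) ^ j) * sqrt ((5/4) ^ j) = 1" for j
    by (simp add: real_sqrt_mult[symmetric] power_mult_distrib[symmetric])
  have "(\<Sum>u\<in>?T. (?m u)\<^sup>2)\<^sup>2
     = (\<Sum>u\<in>?T. (sqrt ((4/5) ^ length u) * ?m u) * (sqrt ((5/4) ^ length u) * ?m u))\<^sup>2"
  proof (intro arg_cong[where f = "\<lambda>a. a\<^sup>2"] sum.cong refl)
    fix u
    have "(sqrt ((4/5) ^ length u) * ?m u) * (sqrt ((5/4) ^ length u) * ?m u)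
       = (sqrt ((4/5) ^ length u) * sqrt ((5/4) ^ length u)) * (?m u)\<^sup>2" by (simp add: power2_eq_square)
    then show "(?m u)\<^sup>2 = (sqrt ((4/5) ^ length u) * ?m u) * (sqrt ((5/4) ^ length u) * ?m u)"
      by (simp only: w mult_1)
  qed
  also have "\<dots> \<le> (\<Sum>u\<in>?T. (sqrt ((4/5) ^ length u) * ?m u)\<^sup>2) * (\<Sum>u\<in>?T. (sqrt ((5/4) ^ length u) * ?m u)\<^sup>2)"
    by (rule Cauchy_Schwarz_ineq_sum)
  also have "\<dots> = (\<Sum>u\<in>?T. (4/5) ^ length u * (?m u)\<^sup>2) * (\<Sum>u\<in>?T. (5/4) ^ length u * (?m u)\<^sup>2)"
    by (simp add: power_mult_distrib)
  also have "\<dots> \<le> (5 * (4/5) ^ k * (real n)\<^sup>2) * weighted_square x"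
  proof (rule mult_mono)
    have "(\<Sum>u\<in>?T. (4/5) ^ length u * (?m u)\<^sup>2) \<le> (\<Sum>u\<in>?T. (4/5) ^ length u * ?m u * real n)"
      using subtree_size_le[OF assms] by (intro sum_mono) (simp add: power2_eq_square mult_left_mono)
    also have "\<dots> \<le> (5 * (4/5) ^ k * real n) * real n"
      unfolding sum_distrib_right[symmetric] by (intro mult_right_mono finite_level_part[OF assms]) simp
    finally show "(\<Sum>u\<in>?T. (4/5) ^ length u * (?m u)\<^sup>2) \<le> 5 * (4/5) ^ k * (real n)\<^sup>2"
      by (simp add: power2_eq_square mult.assoc)
    have "(\<Sum>u\<in>?T. (5/4) ^ length u * (?m u)\<^sup>2) \<le> (\<Sum>u\<in>x. (5/4) ^ length u * (?m u)\<^sup>2)"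
      using grown_finite[OF assms] by (intro sum_mono2) auto
    also note weighted_square_ge
    finally show "(\<Sum>u\<in>?T. (5/4) ^ length u * (?m u)\<^sup>2) \<le> weighted_square x" .
  qed (auto intro!: sum_nonneg)
  finally have "(\<Sum>u\<in>?T. (?m u)\<^sup>2)\<^sup>2 / (real n ^ 4) \<le> (5 * (4/5) ^ k * (real n)\<^sup>2) * weighted_square x / real n ^ 4"
    by (intro divide_right_mono) auto
  moreover have "square_tail k x = (\<Sum>u\<in>?T. (?m u)\<^sup>2) / (real n)\<^sup>2"
    by (simp add: square_tail_def grown_card[OF assms] power_divide sum_divide_distrib)
  then have "(square_tail k x)\<^sup>2 = (\<Sum>u\<in>?T. (?m u)\<^sup>2)\<^sup>2 / (real n ^ 4)"
    by (simp add: power_divide power_mult[symmetric])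
  moreover have "(5 * (4/5) ^ k * (real n)\<^sup>2) * weighted_square x / real n ^ 4
     = 5 * (4/5) ^ k / (real n)\<^sup>2 * weighted_square x"
    using n by (simp add: field_simps power2_eq_square power4_eq_xxxx)
  ultimately show ?thesis by simp
qed

context bst
begin

lemma drift_quadratic_growth:
  fixes f :: "bool list set \<Rightarrow> real"
  assumes drift: "\<And>n x. grown n x \<Longrightarrow>
      (\<Sum>u\<in>external_nodes x. f (insert u x) - f x) \<le> 2 * f x + K * leaf_weight x"
    and root: "f {[]} \<le> 6 * B" and K: "0 \<le> K" and n: "1 \<le> n"
  shows "expectation (\<lambda>\<omega>. f (X n \<omega>)) \<le> (B + 2 * K) * ((real n + 1) * (real n + 2))"
proof (rule quadratic_growth[OF _ _ K n])
  show "expectation (\<lambda>\<omega>. f (X 1 \<omega>)) \<le> 6 * B" unfolding expectation_X1 by (rule root)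
next
  fix n :: nat assume n: "1 \<le> n"
  have "expectation (\<lambda>\<omega>. f (X (Suc n) \<omega>)) \<le> (1 + 2 / (real n + 1)) * expectation (\<lambda>\<omega>. f (X n \<omega>))
     + K / (real n + 1) * expectation (\<lambda>\<omega>. leaf_weight (X n \<omega>))"
    by (rule expectation_drift_le[OF n drift])
  also have "K / (real n + 1) * expectation (\<lambda>\<omega>. leaf_weight (X n \<omega>))
     \<le> K / (real n + 1) * ((real n + 1) * sqrt (real n + 1))"
    using K by (intro mult_left_mono expectation_leaf_weight n) simp
  also have "\<dots> = K * sqrt (real n + 1)" by simp
  finally show "expectation (\<lambda>\<omega>. f (X (Suc n) \<omega>))
     \<le> (1 + 2 / (real n + 1)) * expectation (\<lambda>\<omega>. f (X n \<omega>)) + K * sqrt (real n + 1)" by simp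
qed

lemma expectation_level_square:
  assumes "1 \<le> n"
  shows "expectation (\<lambda>\<omega>. level_square k (X n \<omega>)) \<le> 128 * (4/5) ^ k * ((real n + 1) * (real n + 2))"
  using drift_quadratic_growth[of "level_square k" "64 * (4/5) ^ k" 0, OF level_square_drift _ _ assms]
  by (simp add: level_square_root)

lemma expectation_weighted_square:
  assumes "1 \<le> n"
  shows "expectation (\<lambda>\<omega>. weighted_square (X n \<omega>)) \<le> 12 * ((real n + 1) * (real n + 2))"
proof -
  \<comment> \<open>The value is 6 + 2 * 5/2 = 11. The constant 12 of the statement is B + 2 K with
    B = 2 and K = 5.\<close>
  have "weighted_square {[]} \<le> 6 * 2"
    by (simp add: weighted_square_def node_sum_def leaf_weight_def external_nodes_root
        subtree_size_def power2_eq_square)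
  from drift_quadratic_growth[of weighted_square 5 2, OF _ this _ assms]
  show ?thesis by (simp add: weighted_square_drift)
qed

text \<open>The mean of the product obeys a homogeneous recursion and starts at 0, because one of
  two different nodes is not the root and hence lies outside the initial tree.\<close>

lemma excess_orthogonal:
  assumes "1 \<le> n" "length v = length w" "v \<noteq> w"
  shows "expectation (\<lambda>\<omega>. excess (X n \<omega>) v * excess (X n \<omega>) w) = 0"
  using assms(1)
proof (induction n rule: dec_induct)
  case base
  have "v \<noteq> [] \<or> w \<noteq> []" using assms(3) by blast
  then have "excess {[]} v = 0 \<or> excess {[]} w = 0"
    by (auto intro!: excess_outside simp: binary_tree_def)
  then show ?case using expectation_X1[of "\<lambda>x. excess x v * excess x w"] by auto
next
  case (step n)
  have np: "\<not> prefix v w" "\<not> prefix w v" using assms(2,3) by (auto simp: prefix_def)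
  let ?f = "\<lambda>x. excess x v * excess x w"
  have d: "(\<Sum>u\<in>external_nodes x. ?f (insert u x) - ?f x) = 2 * ?f x" if "grown n x" for x
    by (rule excess_prod_drift[OF that np])
  have up: "expectation (\<lambda>\<omega>. ?f (X (Suc n) \<omega>)) \<le> (1 + 2 / (real n + 1)) * expectation (\<lambda>\<omega>. ?f (X n \<omega>))
     + 0 / (real n + 1) * expectation (\<lambda>\<omega>. ?f (X n \<omega>))"
    by (rule expectation_drift_le[OF step.hyps(1)]) (simp add: d)
  \<comment> \<open>\<open>expectation_drift_le\<close> yields inequalities only, so it is also
    applied to the negated product.\<close>
  have "expectation (\<lambda>\<omega>. - ?f (X (Suc n) \<omega>)) \<le> (1 + 2 / (real n + 1)) * expectation (\<lambda>\<omega>. - ?f (X n \<omega>))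
     + 0 / (real n + 1) * expectation (\<lambda>\<omega>. ?f (X n \<omega>))"
  proof (rule expectation_drift_le[OF step.hyps(1)])
    fix x assume "grown n x"
    have "(\<Sum>u\<in>external_nodes x. - ?f (insert u x) - - ?f x) = - (\<Sum>u\<in>external_nodes x. ?f (insert u x) - ?f x)"
      by (simp add: sum_negf[symmetric])
    then show "(\<Sum>u\<in>external_nodes x. - ?f (insert u x) - - ?f x) \<le> 2 * - ?f x + 0 * ?f x"
      using d[OF \<open>grown n x\<close>] by simp
  qed
  then show ?case using up step.IH by simp
qed

text \<open>A level has 2^k nodes, and a triangle inequality over them would destroy the decay. By
  orthogonality the mean square of the sum is the sum of the mean squares, which
  \<open>expectation_level_square\<close> controls as a whole.\<close>

lemma expectation_excess_level:
  assumes "1 \<le> n"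
  shows "expectation (\<lambda>\<omega>. ((\<Sum>v | length v = k. excess (X n \<omega>) v) / (real n + 1))\<^sup>2) \<le> 256 * (4/5) ^ k"
proof -
  let ?L = "{v :: bool list. length v = k}"
  have int: "integrable M (\<lambda>\<omega>. excess (X n \<omega>) v * excess (X n \<omega>) w)"
    "integrable M (\<lambda>\<omega>. (excess (X n \<omega>) v)\<^sup>2)" "integrable M (\<lambda>\<omega>. scaled_square (X n \<omega>) v)" for v w
    by (rule integrable_fun1[OF assms])+
  have "expectation (\<lambda>\<omega>. (\<Sum>v\<in>?L. excess (X n \<omega>) v)\<^sup>2)
    = expectation (\<lambda>\<omega>. \<Sum>v\<in>?L. \<Sum>w\<in>?L. excess (X n \<omega>) v * excess (X n \<omega>) w)"
    by (simp add: power2_eq_square sum_product)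
  also have "\<dots> = (\<Sum>v\<in>?L. \<Sum>w\<in>?L. expectation (\<lambda>\<omega>. excess (X n \<omega>) v * excess (X n \<omega>) w))"
    by (simp add: int)
  also have "\<dots> = (\<Sum>v\<in>?L. \<Sum>w\<in>?L. if w = v then expectation (\<lambda>\<omega>. (excess (X n \<omega>) v)\<^sup>2) else 0)"
    using excess_orthogonal[OF assms] by (intro sum.cong refl) (auto simp: power2_eq_square)
  also have "\<dots> = expectation (\<lambda>\<omega>. \<Sum>v\<in>?L. (excess (X n \<omega>) v)\<^sup>2)"
    by (simp add: sum.delta int)
  also have "\<dots> \<le> expectation (\<lambda>\<omega>. level_square k (X n \<omega>))"
    unfolding level_square_def
    by (intro integral_mono sum_mono scaled_square_ge Bochner_Integration.integrable_sum int)
  also note expectation_level_square[OF assms]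
  finally have *: "expectation (\<lambda>\<omega>. (\<Sum>v\<in>?L. excess (X n \<omega>) v)\<^sup>2) \<le> 128 * (4/5) ^ k * ((real n + 1) * (real n + 2))" .
  have "expectation (\<lambda>\<omega>. ((\<Sum>v | length v = k. excess (X n \<omega>) v) / (real n + 1))\<^sup>2)
    = expectation (\<lambda>\<omega>. (\<Sum>v\<in>?L. excess (X n \<omega>) v)\<^sup>2) / (real n + 1)\<^sup>2"
    by (simp add: power_divide)
  also have "\<dots> \<le> 128 * (4/5) ^ k * ((real n + 1) * (real n + 2)) / (real n + 1)\<^sup>2"
    using * by (intro divide_right_mono) auto
  also have "\<dots> = 128 * (4/5) ^ k * (((real n + 1) * (real n + 2)) / (real n + 1)\<^sup>2)" by simp
  also have "\<dots> \<le> 128 * (4/5) ^ k * 2"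
  proof (intro mult_left_mono)
    have "(real n + 1) * (real n + 2) \<le> 2 * (real n + 1)\<^sup>2"
      by (simp add: power2_eq_square algebra_simps)
    then show "((real n + 1) * (real n + 2)) / (real n + 1)\<^sup>2 \<le> 2"
      by (subst pos_divide_le_eq) auto
  qed simp
  finally show ?thesis by simp
qed

lemma expectation_square_tail:
  assumes "1 \<le> n"
  shows "expectation (\<lambda>\<omega>. (square_tail k (X n \<omega>))\<^sup>2) \<le> 360 * (4/5) ^ k"
proof -
  have "expectation (\<lambda>\<omega>. (square_tail k (X n \<omega>))\<^sup>2)
    \<le> expectation (\<lambda>\<omega>. 5 * (4/5) ^ k / (real n)\<^sup>2 * weighted_square (X n \<omega>))"
    by (intro expectation_mono_grown assms square_tail_le)
  also have "\<dots> = 5 * (4/5) ^ k / (real n)\<^sup>2 * expectation (\<lambda>\<omega>. weighted_square (X n \<omega>))"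
    by (rule integral_mult_right_zero)
  also have "\<dots> \<le> 5 * (4/5) ^ k / (real n)\<^sup>2 * (12 * ((real n + 1) * (real n + 2)))"
    by (intro mult_left_mono expectation_weighted_square assms) simp
  also have "\<dots> = 60 * (4/5) ^ k * (((real n + 1) * (real n + 2)) / (real n)\<^sup>2)" by simp
  also have "\<dots> \<le> 60 * (4/5) ^ k * 6"
  proof (intro mult_left_mono)
    have n: "1 \<le> real n" using assms by simp
    then have "real n * 1 \<le> real n * real n" by (intro mult_left_mono) auto
    then have "2 + real n * 3 \<le> real n * (real n * 5)" using n by linarith
    then show "((real n + 1) * (real n + 2)) / (real n)\<^sup>2 \<le> 6"
      using n by (simp add: divide_le_eq power2_eq_square algebra_simps)
  qed simp
  finally show ?thesis by simp
qed

text \<open>Orthogonality of martingale increments: expanding around the conditional mean, the cross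
  term vanishes by \<open>compensated_step\<close>, so the variances of the single steps add up.
  Each is of order n^(-3/2) and the bounds telescope.\<close>

lemma compensated_diff:
  assumes "1 \<le> m" "m \<le> n"
  shows "expectation (\<lambda>\<omega>. (compensated n (X n \<omega>) - compensated m (X m \<omega>))\<^sup>2)
    \<le> 256 * (1 / sqrt (real m) - 1 / sqrt (real n))"
  using assms(2)
proof (induction n rule: dec_induct)
  case base
  show ?case by simp
next
  case (step n)
  have n: "1 \<le> n" using assms(1) step.hyps by simp
  define D where "D = expectation (\<lambda>\<omega>. (compensated n (X n \<omega>) - compensated m (X m \<omega>))\<^sup>2)"
  have "expectation (\<lambda>\<omega>. (compensated (Suc n) (X (Suc n) \<omega>) - compensated m (X m \<omega>))\<^sup>2)
    = expectation (\<lambda>\<omega>. (\<Sum>u\<in>external_nodes (X n \<omega>).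
        (compensated (Suc n) (insert u (X n \<omega>)) - compensated m (X m \<omega>))\<^sup>2) / (real n + 1))"
    by (rule expectation_step3[OF assms(1) step.hyps(1),
        where f = "\<lambda>a _ y. (compensated (Suc n) y - compensated m a)\<^sup>2"])
  also have "\<dots> \<le> expectation (\<lambda>\<omega>. (compensated n (X n \<omega>) - compensated m (X m \<omega>))\<^sup>2
      + 128 / ((real n + 1) * (real n + 2)\<^sup>2) * leaf_weight (X n \<omega>))"
  proof (rule integral_mono_AE)
    show "integrable M (\<lambda>\<omega>. (\<Sum>u\<in>external_nodes (X n \<omega>).
        (compensated (Suc n) (insert u (X n \<omega>)) - compensated m (X m \<omega>))\<^sup>2) / (real n + 1))"
      by (rule integrable_fun2[OF assms(1) n, where f = "\<lambda>a x. (\<Sum>u\<in>external_nodes x.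
        (compensated (Suc n) (insert u x) - compensated m a)\<^sup>2) / (real n + 1)"])
    show "integrable M (\<lambda>\<omega>. (compensated n (X n \<omega>) - compensated m (X m \<omega>))\<^sup>2
      + 128 / ((real n + 1) * (real n + 2)\<^sup>2) * leaf_weight (X n \<omega>))"
      by (rule integrable_fun2[OF assms(1) n, where f = "\<lambda>a x. (compensated n x - compensated m a)\<^sup>2
      + 128 / ((real n + 1) * (real n + 2)\<^sup>2) * leaf_weight x"])
    show "AE \<omega> in M. (\<Sum>u\<in>external_nodes (X n \<omega>).
        (compensated (Suc n) (insert u (X n \<omega>)) - compensated m (X m \<omega>))\<^sup>2) / (real n + 1)
      \<le> (compensated n (X n \<omega>) - compensated m (X m \<omega>))\<^sup>2
      + 128 / ((real n + 1) * (real n + 2)\<^sup>2) * leaf_weight (X n \<omega>)"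
      using AE_grown[OF n]
    proof eventually_elim
      case (elim \<omega>)
      define x where "x = X n \<omega>"
      define c where "c = compensated m (X m \<omega>)"
      have x: "grown n x" using elim by (simp add: x_def)
      let ?E = "external_nodes x" and ?f = "\<lambda>u. compensated (Suc n) (insert u x)"
      have "(\<Sum>u\<in>?E. (?f u - c)\<^sup>2)
        = (\<Sum>u\<in>?E. (?f u - compensated n x)\<^sup>2 + (2 * (compensated n x - c) * ?f u + (c\<^sup>2 - (compensated n x)\<^sup>2)))"
        by (intro sum.cong refl) (simp add: power2_eq_square algebra_simps)
      also have "\<dots> = (\<Sum>u\<in>?E. (?f u - compensated n x)\<^sup>2) + (real n + 1) * (compensated n x - c)\<^sup>2"
        using grown_external_card[OF x]
        by (simp add: sum.distrib sum_distrib_left[symmetric] compensated_step[OF x])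
          (simp add: power2_eq_square algebra_simps)
      also have "\<dots> \<le> 128 * leaf_weight x / (real n + 2)\<^sup>2 + (real n + 1) * (compensated n x - c)\<^sup>2"
        by (intro add_right_mono compensated_variance x)
      finally have "(\<Sum>u\<in>?E. (?f u - c)\<^sup>2) / (real n + 1)
        \<le> (128 * leaf_weight x / (real n + 2)\<^sup>2 + (real n + 1) * (compensated n x - c)\<^sup>2) / (real n + 1)"
        by (intro divide_right_mono) auto
      also have "\<dots> = (compensated n x - c)\<^sup>2 + 128 / ((real n + 1) * (real n + 2)\<^sup>2) * leaf_weight x"
        by (simp add: add_divide_distrib mult.commute)
      finally show ?case by (simp add: x_def c_def)
    qed
  qed
  also have "\<dots> = D + 128 / ((real n + 1) * (real n + 2)\<^sup>2) * expectation (\<lambda>\<omega>. leaf_weight (X n \<omega>))"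
    using integrable_fun2[OF assms(1) n, where f = "\<lambda>a x. (compensated n x - compensated m a)\<^sup>2"]
      integrable_fun1[OF n, of leaf_weight]
    by (simp add: D_def)
  also have "\<dots> \<le> D + 128 / ((real n + 1) * (real n + 2)\<^sup>2) * ((real n + 1) * sqrt (real n + 1))"
    by (intro add_left_mono mult_left_mono expectation_leaf_weight n) auto
  also have "\<dots> = D + 128 * (sqrt (real n + 1) / (real n + 2)\<^sup>2)"
    by (simp add: divide_simps)
  also have "\<dots> \<le> D + 128 * (sqrt (real n + 1) / (real n + 1)\<^sup>2)"
    by (intro add_left_mono mult_left_mono divide_left_mono power_mono) auto
  also have "\<dots> \<le> D + 128 * (2 * (1 / sqrt (real n) - 1 / sqrt (real n + 1)))"
    by (intro add_left_mono mult_left_mono inverse_sqrt_telescope n) auto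
  also have "\<dots> \<le> 256 * (1 / sqrt (real m) - 1 / sqrt (real (Suc n)))"
    using step.IH by (simp add: D_def add.commute)
  finally show ?case .
qed

end

section \<open>Convergence of truncations in quadratic mean\<close>

lemma harm_ln_bound:
  assumes "1 \<le> n"
  shows "\<bar>harm n - ln (real n) - euler_mascheroni\<bar> \<le> 1 / real n"
proof -
  have n: "0 < real n" using assms by simp
  have "euler_mascheroni \<in> {harm n - ln (real (Suc n)) + inverse (of_nat (2*(n+1)))
      .. harm n - ln (real (Suc n)) + inverse (of_nat (2*n))}"
    by (rule euler_mascheroni_bounds[OF assms])
  then have e: "harm n - ln (real (Suc n)) + inverse (of_nat (2*(n+1))) \<le> euler_mascheroni"
     "euler_mascheroni \<le> harm n - ln (real (Suc n)) + inverse (of_nat (2*n))" by simp_all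
  have i: "0 \<le> inverse (of_nat (2*(n+1)) :: real)" "inverse (of_nat (2*n) :: real) \<le> 1 / real n"
    using n by (simp_all add: field_simps)
  have l: "ln (real n) \<le> ln (real (Suc n))" using n by simp
  have "ln (real (Suc n)) - ln (real n) = ln (1 + 1 / real n)"
  proof -
    have "1 + 1 / real n = real (Suc n) / real n" using n by (simp add: field_simps)
    moreover have "ln (real (Suc n) / real n) = ln (real (Suc n)) - ln (real n)"
      using n by (simp add: ln_div)
    ultimately show ?thesis by (simp only:)
  qed
  also have "\<dots> \<le> 1 / real n" using n by (intro ln_add_one_self_le_self) simp
  finally have "ln (real (Suc n)) - ln (real n) \<le> 1 / real n" .
  then show ?thesis using e i l unfolding abs_le_iff by linarith
qed

text \<open>Far from the true logarithmic size, but it bounds the mean square of the path sum by a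
  multiple of n^3, and n^3 / n^4 is small enough for all error terms.\<close>

lemma harm_le_sqrt: "harm n \<le> 2 * sqrt (real n)"
proof (induction n)
  case (Suc n)
  define a b where "a = sqrt (real n)" and "b = sqrt (real (Suc n))"
  have ab: "0 \<le> a" "a \<le> b" "0 < b" "1 \<le> b" by (simp_all add: a_def b_def)
  have "b\<^sup>2 = a\<^sup>2 + 1" by (simp add: a_def b_def)
  then have "(b - a) * (b + a) = 1" by (simp add: power2_eq_square algebra_simps)
  moreover have "(b - a) * (b + a) \<le> (b - a) * (2 * b)" using ab by (intro mult_left_mono) auto
  ultimately have "1 \<le> 2 * (b - a) * b" by (simp add: algebra_simps)
  then have "1 / b \<le> 2 * (b - a)" using ab(3) by (simp only: pos_divide_le_eq)
  moreover have "inverse (real (Suc n)) \<le> 1 / b"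
  proof -
    have "b * 1 \<le> b * b" using ab by (intro mult_left_mono) auto
    then have "b \<le> real (Suc n)" by (simp add: b_def)
    then show ?thesis using ab by (simp add: field_simps)
  qed
  ultimately show ?case using Suc by (simp add: harm_Suc a_def b_def)
qed (simp add: harm_def)

lemma path_sum_nonneg: "0 \<le> path_sum x v"
  unfolding path_sum_def node_sum_def by (intro sum_nonneg) auto

lemma square_sum_le:
  assumes "grown n x"
  shows "square_sum x \<le> real n * path_sum x []"
  unfolding square_sum_def path_sum_def node_sum_def sum_distrib_left
  using subtree_size_le[OF assms] by (intro sum_mono) (simp add: power2_eq_square mult_right_mono)

lemma square_sum_nonneg: "0 \<le> square_sum x"
  unfolding square_sum_def node_sum_def by (intro sum_nonneg) auto

text \<open>The cost of passing between the denominators t^2 and (t + 1) (t + 2) and of dropping the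
  corrections in \<open>compensated\<close>. A relative error 1 / t of \<open>Q\<close> becomes an
  error in \<open>S\<close> through \<open>Q \<le> t * S\<close>.\<close>

lemma renormalization_bounds:
  fixes S Q t :: real
  assumes t: "1 \<le> t" and S: "0 \<le> S" and Q: "0 \<le> Q" "Q \<le> t * S"
  shows "0 \<le> Q / t\<^sup>2 - Q / ((t + 1) * (t + 2))"
    and "Q / t\<^sup>2 - Q / ((t + 1) * (t + 2)) \<le> 3 * (S / t\<^sup>2)"
    and "0 \<le> 3 * S / ((t + 1) * (t + 2))" and "3 * S / ((t + 1) * (t + 2)) \<le> 3 * (S / t\<^sup>2)"
    and "0 \<le> (4 * t + 2) / ((t + 1) * (t + 2))" and "(4 * t + 2) / ((t + 1) * (t + 2)) \<le> 4 * (1 / t)"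
    and "0 \<le> 4 / (t + 2)" and "4 / (t + 2) \<le> 4 * (1 / t)"
proof -
  show "0 \<le> Q / t\<^sup>2 - Q / ((t + 1) * (t + 2))"
    using Q t by (auto simp: power2_eq_square intro!: divide_left_mono mult_mono)
  have "Q / t\<^sup>2 - Q / ((t + 1) * (t + 2)) = Q * ((3 * t + 2) / ((t + 1) * (t + 2))) / t\<^sup>2"
    using t by (simp add: divide_simps power2_eq_square) (simp add: algebra_simps)
  also have "\<dots> \<le> (t * S) * (3 / t) / t\<^sup>2"
    using Q t S by (intro divide_right_mono mult_mono) (auto simp: divide_simps, simp add: algebra_simps)
  also have "\<dots> = 3 * (S / t\<^sup>2)" using t by simp
  finally show "Q / t\<^sup>2 - Q / ((t + 1) * (t + 2)) \<le> 3 * (S / t\<^sup>2)" .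
  have "3 * S / ((t + 1) * (t + 2)) \<le> 3 * S / t\<^sup>2"
    using S t by (auto simp: power2_eq_square intro!: divide_left_mono mult_mono)
  then show "3 * S / ((t + 1) * (t + 2)) \<le> 3 * (S / t\<^sup>2)" by simp
  show "(4 * t + 2) / ((t + 1) * (t + 2)) \<le> 4 * (1 / t)"
    using t by (auto simp: divide_simps) (simp add: algebra_simps)
qed (use S t in \<open>auto simp: field_simps\<close>)

text \<open>The constant in the limit stems from mean_path n / (n + 1) = 2 H_n - 3 + 3 / (n + 1)
  together with H_n = ln n + euler_mascheroni + O(1/n). The bounds add up to 7 = 1 + 3 + 3 and 13 =
  2 + 3 + 4 + 4.\<close>

lemma wiener_index_error:
  assumes "grown n x"
  shows "\<bar>wiener_index x / (real n)\<^sup>2 - 2 * ln (real n) - (compensated n x + 2 * euler_mascheroni - 3)\<bar>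
    \<le> 7 * path_sum x [] / (real n)\<^sup>2 + 13 / real n"
proof -
  define t S Q where "t = real n" and "S = path_sum x []" and "Q = square_sum x"
  have n: "1 \<le> n" using grown_pos[OF assms] by simp
  have t: "1 \<le> t" using n by (simp add: t_def)
  have S: "0 \<le> S" and Q: "0 \<le> Q" "Q \<le> t * S"
    using path_sum_nonneg square_sum_nonneg square_sum_le[OF assms] by (auto simp: S_def Q_def t_def)
  note bounds = renormalization_bounds[OF t S Q]
  define h where "h = harm n - ln t - euler_mascheroni"
  have h: "\<bar>h\<bar> \<le> 1 / t" using harm_ln_bound[OF n] by (simp add: h_def t_def)
  have m: "mean_path n / (t + 1) = 2 * harm n - 3 + 3 / (t + 1)"
    using t by (simp add: mean_path_def t_def field_simps)
  have "wiener_index x / t\<^sup>2 = S / t - Q / t\<^sup>2"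
    using t by (simp add: wiener_index_eq[OF assms] S_def Q_def t_def[symmetric] power2_eq_square field_simps)
  then have "wiener_index x / t\<^sup>2 - 2 * ln t - (compensated n x + 2 * euler_mascheroni - 3)
    = (S / t - S / (t + 1)) + 3 * S / ((t + 1) * (t + 2)) - (Q / t\<^sup>2 - Q / ((t + 1) * (t + 2)))
      + 2 * h + 3 / (t + 1) + (4 * t + 2) / ((t + 1) * (t + 2)) + 4 / (t + 2)"
    unfolding compensated_def S_def[symmetric] Q_def[symmetric] t_def[symmetric]
    using m by (simp add: h_def add_divide_distrib diff_divide_distrib)
  moreover have "0 \<le> S / t - S / (t + 1)" "S / t - S / (t + 1) \<le> S / t\<^sup>2"
  proof -
    have "S / t - S / (t + 1) = S / (t * (t + 1))" using t by (simp add: field_simps)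
    then show "0 \<le> S / t - S / (t + 1)" "S / t - S / (t + 1) \<le> S / t\<^sup>2"
      using S t by (auto simp: power2_eq_square intro!: divide_left_mono mult_left_mono)
  qed
  moreover have "0 \<le> 3 / (t + 1)" "3 / (t + 1) \<le> 3 * (1 / t)"
    using t by (auto simp: field_simps)
  ultimately have "\<bar>wiener_index x / t\<^sup>2 - 2 * ln t - (compensated n x + 2 * euler_mascheroni - 3)\<bar>
     \<le> 7 * (S / t\<^sup>2) + 13 * (1 / t)"
    using h bounds by (simp only: abs_le_iff times_divide_eq_right[symmetric]) linarith
  then show ?thesis by (simp add: t_def S_def)
qed

text \<open>The terms sum to 6 and 8; the constants 7 and 13 of \<open>wiener_index_error\<close>
  are kept so that \<open>expectation_error\<close> serves both.\<close>

lemma compensated_error: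
  assumes "grown n x"
  shows "\<bar>compensated n x - (excess x [] / (real n + 1) - square_tail 0 x)\<bar>
    \<le> 7 * path_sum x [] / (real n)\<^sup>2 + 13 / real n"
proof -
  define t S Q where "t = real n" and "S = path_sum x []" and "Q = square_sum x"
  have t: "1 \<le> t" using grown_pos[OF assms] by (simp add: t_def)
  have S: "0 \<le> S" and Q: "0 \<le> Q" "Q \<le> t * S"
    using path_sum_nonneg square_sum_nonneg square_sum_le[OF assms] by (auto simp: S_def Q_def t_def)
  have tail: "square_tail 0 x = Q / t\<^sup>2"
    by (simp add: square_tail_def grown_card[OF assms] Q_def t_def square_sum_def node_sum_def
        power_divide sum_divide_distrib)
  have e: "compensated n x - (excess x [] / (t + 1) - square_tail 0 x)
    = (Q / t\<^sup>2 - Q / ((t + 1) * (t + 2))) - 3 * S / ((t + 1) * (t + 2))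
      - (4 * t + 2) / ((t + 1) * (t + 2)) - 4 / (t + 2)"
    unfolding compensated_def tail excess_def subtree_size_Nil[OF assms] S_def[symmetric] Q_def[symmetric] t_def[symmetric]
    by (simp add: add_divide_distrib)
  have "0 \<le> S / t\<^sup>2" "0 \<le> 1 / t" using S t by auto
  then have "\<bar>compensated n x - (excess x [] / (t + 1) - square_tail 0 x)\<bar> \<le> 7 * (S / t\<^sup>2) + 13 * (1 / t)"
    unfolding e using renormalization_bounds[OF t S Q] by (intro abs_leI) linarith+
  then show ?thesis by (simp add: t_def S_def)
qed

lemma square_sum2_le: "(a + b)\<^sup>2 \<le> 2 * a\<^sup>2 + 2 * (b :: real)\<^sup>2"
proof -
  have "0 \<le> (a - b)\<^sup>2" by simp
  then show ?thesis by (simp add: power2_eq_square algebra_simps)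
qed

context bst
begin

lemma expectation_path_sum_square:
  assumes "1 \<le> n"
  shows "expectation (\<lambda>\<omega>. (path_sum (X n \<omega>) [])\<^sup>2) \<le> 1664 * real n ^ 3"
proof -
  define t where "t = real n"
  have t: "1 \<le> t" using assms by (simp add: t_def)
  have t2: "t \<le> t\<^sup>2" using t by (simp add: power2_eq_square)
  have t3: "t\<^sup>2 \<le> t ^ 3" using t by (intro power_increasing) auto
  have m: "(mean_path n)\<^sup>2 \<le> 64 * t ^ 3"
  proof -
    have "0 \<le> mean_path n"
    proof (cases n)
      case (Suc m)
      \<comment> \<open>Squaring the upper bound requires that the mean be nonnegative. One step
        adds 3 on the left and at least 2 + 2 on the right; the first 2 uses that the harmonic
        number is at least 1, hence the conjunction.\<close>
      have "1 \<le> (harm n :: real) \<and> 3 * real n \<le> 2 * (real n + 1) * harm n" if "1 \<le> n" for n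
        using that
      proof (induction n rule: dec_induct)
        case base
        then show ?case by (simp add: harm_def)
      next
        case (step n)
        have i: "1 \<le> (real n + 2) * inverse (real n + 1)" by (simp add: field_simps)
        have "3 * real (Suc n) \<le> 2 * (real n + 1) * harm n + 2 * harm n + 2 * ((real n + 2) * inverse (real n + 1))"
        proof -
          have "3 * real (Suc n) \<le> a + 2 * h + 2 * x" if "3 * real n \<le> a" "1 \<le> h" "1 \<le> x" for a h x
            using that by simp
          then show ?thesis using step.IH i by blast
        qed
        also have "\<dots> = 2 * (real (Suc n) + 1) * harm (Suc n)"
          by (simp add: harm_Suc algebra_simps)
        finally have "3 * real (Suc n) \<le> 2 * (real (Suc n) + 1) * harm (Suc n)" .
        moreover have "1 \<le> (harm (Suc n) :: real)" using step.IH by (simp add: harm_Suc add_increasing2)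
        ultimately show ?case by blast
      qed
      then show ?thesis using assms by (simp add: mean_path_def)
    qed (simp add: mean_path_0)
    moreover have "mean_path n \<le> 2 * (t + 1) * (2 * sqrt t)"
    proof -
      have "mean_path n \<le> 2 * (t + 1) * harm n" using t by (simp add: mean_path_def t_def)
      also have "\<dots> \<le> 2 * (t + 1) * (2 * sqrt t)"
        using t harm_le_sqrt[of n] by (intro mult_left_mono) (auto simp: t_def)
      finally show ?thesis .
    qed
    ultimately have "(mean_path n)\<^sup>2 \<le> (2 * (t + 1) * (2 * sqrt t))\<^sup>2" by (intro power_mono)
    also have "\<dots> = 16 * ((t + 1)\<^sup>2 * t)"
      using t real_sqrt_pow2[of t] by (simp only: power_mult_distrib) simp
    also have "\<dots> \<le> 16 * ((t + t)\<^sup>2 * t)" using t by (intro mult_left_mono mult_right_mono power_mono) auto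
    also have "\<dots> = 64 * t ^ 3" by (simp add: power2_eq_square power3_eq_cube)
    finally show ?thesis .
  qed
  have "expectation (\<lambda>\<omega>. (path_sum (X n \<omega>) [])\<^sup>2)
    \<le> expectation (\<lambda>\<omega>. 2 * level_square 0 (X n \<omega>) + 2 * (mean_path n)\<^sup>2)"
  proof (rule expectation_mono_grown[OF assms])
    fix x assume x: "grown n x"
    have "(path_sum x [])\<^sup>2 = (excess x [] + mean_path n)\<^sup>2"
      by (simp add: excess_def subtree_size_Nil[OF x])
    also have "\<dots> \<le> 2 * (excess x [])\<^sup>2 + 2 * (mean_path n)\<^sup>2" by (rule square_sum2_le)
    also have "\<dots> \<le> 2 * level_square 0 x + 2 * (mean_path n)\<^sup>2"
      using scaled_square_ge by (simp add: level_square_def)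
    finally show "(path_sum x [])\<^sup>2 \<le> 2 * level_square 0 x + 2 * (mean_path n)\<^sup>2" .
  qed
  also have "\<dots> = 2 * expectation (\<lambda>\<omega>. level_square 0 (X n \<omega>)) + 2 * (mean_path n)\<^sup>2"
    using integrable_fun1[OF assms, of "level_square 0"] by (simp add: prob_space)
  also have "\<dots> \<le> 2 * (128 * ((t + 1) * (t + 2))) + 2 * (64 * t ^ 3)"
    using m expectation_level_square[OF assms, of 0] by (simp add: t_def)
  also have "(t + 1) * (t + 2) \<le> 6 * t ^ 3"
  proof -
    have "(t + 1) * (t + 2) = t\<^sup>2 + 3 * t + 2" by (simp add: power2_eq_square algebra_simps)
    then show ?thesis using t t2 t3 by linarith
  qed
  finally show ?thesis by (simp add: t_def)
qed

lemma expectation_error: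
  assumes n1: "1 \<le> n"
    and f: "\<And>x. grown n x \<Longrightarrow> \<bar>f x\<bar> \<le> 7 * path_sum x [] / (real n)\<^sup>2 + 13 / real n"
  shows "expectation (\<lambda>\<omega>. (f (X n \<omega>))\<^sup>2) \<le> 163410 / real n"
proof -
  have n: "1 \<le> real n" using n1 by simp
  have "expectation (\<lambda>\<omega>. (f (X n \<omega>))\<^sup>2)
    \<le> expectation (\<lambda>\<omega>. 98 / (real n) ^ 4 * (path_sum (X n \<omega>) [])\<^sup>2 + 338 / (real n)\<^sup>2)"
  proof (rule expectation_mono_grown[OF n1])
    fix x assume x: "grown n x"
    have "(f x)\<^sup>2 \<le> (7 * path_sum x [] / (real n)\<^sup>2 + 13 / real n)\<^sup>2"
      using power_mono[OF f[OF x] abs_ge_zero, of 2] by simp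
    also have "\<dots> \<le> 2 * (7 * path_sum x [] / (real n)\<^sup>2)\<^sup>2 + 2 * (13 / real n)\<^sup>2"
      by (rule square_sum2_le)
    also have "\<dots> = 98 / (real n) ^ 4 * (path_sum x [])\<^sup>2 + 338 / (real n)\<^sup>2"
      by (simp add: power_divide power_mult_distrib power_mult[symmetric])
    finally show "(f x)\<^sup>2 \<le> 98 / (real n) ^ 4 * (path_sum x [])\<^sup>2 + 338 / (real n)\<^sup>2" .
  qed
  also have "\<dots> = 98 / (real n) ^ 4 * expectation (\<lambda>\<omega>. (path_sum (X n \<omega>) [])\<^sup>2) + 338 / (real n)\<^sup>2"
    using integrable_fun1[OF n1, of "\<lambda>x. (path_sum x [])\<^sup>2"] by (simp add: prob_space)
  also have "\<dots> \<le> 98 / (real n) ^ 4 * (1664 * real n ^ 3) + 338 / (real n)\<^sup>2"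
    by (intro add_right_mono mult_left_mono expectation_path_sum_square n1) simp
  also have "98 / (real n) ^ 4 * (1664 * real n ^ 3) = 163072 / real n"
    using n by (simp add: field_simps power4_eq_xxxx power3_eq_cube)
  also have "338 / (real n)\<^sup>2 \<le> 338 / real n"
    using n by (intro divide_left_mono) (auto simp: power2_eq_square)
  finally show ?thesis by simp
qed

end

section \<open>Square integrable functions and almost sure summability\<close>

lemma integrable_real_square_add:
  fixes f g :: "'b \<Rightarrow> real"
  assumes "f \<in> borel_measurable M" "g \<in> borel_measurable M"
    "integrable M (\<lambda>x. (f x)\<^sup>2)" "integrable M (\<lambda>x. (g x)\<^sup>2)"
  shows "integrable M (\<lambda>x. (f x + g x)\<^sup>2)"
    and "(\<integral>x. (f x + g x)\<^sup>2 \<partial>M) \<le> 2 * (\<integral>x. (f x)\<^sup>2 \<partial>M) + 2 * (\<integral>x. (g x)\<^sup>2 \<partial>M)"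
proof -
  have i: "integrable M (\<lambda>x. 2 * (f x)\<^sup>2 + 2 * (g x)\<^sup>2)" using assms by simp
  show j: "integrable M (\<lambda>x. (f x + g x)\<^sup>2)"
    using assms by (intro Bochner_Integration.integrable_bound[OF i]) (auto simp: square_sum2_le)
  have "(\<integral>x. (f x + g x)\<^sup>2 \<partial>M) \<le> (\<integral>x. 2 * (f x)\<^sup>2 + 2 * (g x)\<^sup>2 \<partial>M)"
    by (intro integral_mono i j square_sum2_le)
  also have "\<dots> = 2 * (\<integral>x. (f x)\<^sup>2 \<partial>M) + 2 * (\<integral>x. (g x)\<^sup>2 \<partial>M)" using assms by simp
  finally show "(\<integral>x. (f x + g x)\<^sup>2 \<partial>M) \<le> 2 * (\<integral>x. (f x)\<^sup>2 \<partial>M) + 2 * (\<integral>x. (g x)\<^sup>2 \<partial>M)" .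
qed

lemma integrable_real_square_diff:
  fixes f g :: "'b \<Rightarrow> real"
  assumes "f \<in> borel_measurable M" "g \<in> borel_measurable M"
    "integrable M (\<lambda>x. (f x)\<^sup>2)" "integrable M (\<lambda>x. (g x)\<^sup>2)"
  shows "integrable M (\<lambda>x. (f x - g x)\<^sup>2)"
    and "(\<integral>x. (f x - g x)\<^sup>2 \<partial>M) \<le> 2 * (\<integral>x. (f x)\<^sup>2 \<partial>M) + 2 * (\<integral>x. (g x)\<^sup>2 \<partial>M)"
  using integrable_real_square_add[of f M "\<lambda>x. - g x"] assms by auto

text \<open>For limits known only almost surely and without a dominating function: a uniform bound
  on the integrals is enough.\<close>

lemma integrable_Fatou:
  fixes f :: "nat \<Rightarrow> 'b \<Rightarrow> real" and g :: "'b \<Rightarrow> real"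
  assumes meas: "g \<in> borel_measurable M"
    and int: "\<And>j. integrable M (f j)" and nonneg: "\<And>j x. 0 \<le> f j x" and g: "\<And>x. 0 \<le> g x"
    and lim: "AE x in M. (\<lambda>j. f j x) \<longlonglongrightarrow> g x"
    and bound: "\<And>j. (\<integral>x. f j x \<partial>M) \<le> c"
  shows "integrable M g" and "(\<integral>x. g x \<partial>M) \<le> c"
proof -
  have c: "0 \<le> c" using order_trans[OF Bochner_Integration.integral_nonneg[where M = M and f = "f 0"] bound[of 0]] nonneg by simp
  have "(\<integral>\<^sup>+x. ennreal (g x) \<partial>M) = (\<integral>\<^sup>+x. liminf (\<lambda>j. ennreal (f j x)) \<partial>M)"
    using lim by (intro nn_integral_cong_AE)
      (auto elim!: eventually_mono intro!: lim_imp_Liminf[symmetric] tendsto_ennrealI)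
  also have "\<dots> \<le> liminf (\<lambda>j. \<integral>\<^sup>+x. ennreal (f j x) \<partial>M)"
    using int by (intro nn_integral_liminf) auto
  also have "\<dots> \<le> liminf (\<lambda>j. ennreal c)"
    using bound nonneg int by (intro Liminf_mono always_eventually allI)
      (simp add: nn_integral_eq_integral ennreal_leI)
  also have "\<dots> = ennreal c" by (simp add: Liminf_const)
  finally have le: "(\<integral>\<^sup>+x. ennreal (g x) \<partial>M) \<le> ennreal c" .
  show i: "integrable M g"
    by (rule integrableI_nonneg[OF meas]) (use g le in \<open>auto simp: le_less_trans\<close>)
  have "ennreal (\<integral>x. g x \<partial>M) \<le> ennreal c"
    using le i g by (simp add: nn_integral_eq_integral)
  then show "(\<integral>x. g x \<partial>M) \<le> c" using c by (simp add: ennreal_le_iff)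
qed

text \<open>With s = (10/9)^k and d the size of an increment, 2 d is at most s d^2 + 1 / s, so the
  increments are absolutely summable. Any base between 1 and 5/4 would fit the later decay
  (4/5)^k.\<close>

lemma square_summable_imp_convergent:
  fixes b :: "nat \<Rightarrow> real"
  assumes "summable (\<lambda>k. (10/9) ^ k * (b (Suc k) - b k)\<^sup>2)"
  shows "convergent b"
proof -
  have bound: "norm (b (Suc k) - b k) \<le> (10/9) ^ k * (b (Suc k) - b k)\<^sup>2 + (9/10) ^ k" for k
  proof -
    define d s r where "d = \<bar>b (Suc k) - b k\<bar>" and "s = (10/9 :: real) ^ k" and "r = (9/10 :: real) ^ k"
    have sr: "s * r = 1" "0 < s" "0 < r" by (simp_all add: s_def r_def power_mult_distrib[symmetric])
    have "0 \<le> s * (d - r)\<^sup>2" using sr by simp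
    also have "\<dots> = s * d\<^sup>2 - 2 * d * (s * r) + (s * r) * r" by (simp add: power2_eq_square algebra_simps)
    finally have "2 * d \<le> s * d\<^sup>2 + r" using sr by simp
    moreover have "0 \<le> d" by (simp add: d_def)
    ultimately have "d \<le> s * d\<^sup>2 + r" by linarith
    then show ?thesis by (simp add: d_def s_def r_def)
  qed
  have "summable (\<lambda>k. (10/9) ^ k * (b (Suc k) - b k)\<^sup>2 + (9/10) ^ k)"
    using assms by (intro summable_add summable_geometric) auto
  then have "summable (\<lambda>k. b (Suc k) - b k)"
    by (rule summable_comparison_test[rotated]) (use bound in auto)
  then have "(\<lambda>n. \<Sum>k<n. b (Suc k) - b k) \<longlonglongrightarrow> (\<Sum>k. b (Suc k) - b k)" by (rule summable_LIMSEQ)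
  then have "(\<lambda>n. b n - b 0) \<longlonglongrightarrow> (\<Sum>k. b (Suc k) - b k)" by (simp add: sum_lessThan_telescope)
  then have "(\<lambda>n. b n - b 0 + b 0) \<longlonglongrightarrow> (\<Sum>k. b (Suc k) - b k) + b 0" by (intro tendsto_add tendsto_const)
  then show ?thesis by (auto simp: convergent_def)
qed

lemma AE_summable:
  fixes f :: "nat \<Rightarrow> 'b \<Rightarrow> real"
  assumes int: "\<And>k. integrable M (f k)" and nonneg: "\<And>k x. 0 \<le> f k x"
    and bound: "\<And>k. (\<integral>x. f k x \<partial>M) \<le> c k" and sum: "summable c"
  shows "AE x in M. summable (\<lambda>k. f k x)"
proof -
  have c: "0 \<le> c k" for k
    using order_trans[OF Bochner_Integration.integral_nonneg[where M = M and f = "f k"] bound[of k]] nonneg by simp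
  have "(\<integral>\<^sup>+x. (\<Sum>k. ennreal (f k x)) \<partial>M) = (\<Sum>k. \<integral>\<^sup>+x. ennreal (f k x) \<partial>M)"
    using int by (intro nn_integral_suminf) auto
  also have "\<dots> = (\<Sum>k. ennreal (\<integral>x. f k x \<partial>M))"
    using int nonneg by (intro suminf_cong nn_integral_eq_integral) auto
  also have "\<dots> \<le> (\<Sum>k. ennreal (c k))"
    using bound by (intro suminf_le ennreal_leI summableI)
  also have "\<dots> = ennreal (\<Sum>k. c k)" using c sum by (intro suminf_ennreal2) auto
  also have "\<dots> < \<infinity>" by simp
  finally have "(\<integral>\<^sup>+x. (\<Sum>k. ennreal (f k x)) \<partial>M) \<noteq> \<infinity>" by simp
  then have "AE x in M. (\<Sum>k. ennreal (f k x)) \<noteq> \<infinity>"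
    using int by (intro nn_integral_PInf_AE) auto
  then show ?thesis
    by eventually_elim (use nonneg in \<open>auto intro: summable_suminf_not_top\<close>)
qed

text \<open>\<open>A n k\<close> is the part of \<open>D n\<close> that comes from the levels below \<open>k\<close>.\<close>

locale truncation = prob_space M for M :: "'a measure" +
  fixes A :: "nat \<Rightarrow> nat \<Rightarrow> 'a \<Rightarrow> real" and B :: "nat \<Rightarrow> 'a \<Rightarrow> real" and D :: "nat \<Rightarrow> 'a \<Rightarrow> real"
    and C :: real and K :: "nat \<Rightarrow> real"
  assumes A_meas [measurable]: "\<And>n k. A n k \<in> borel_measurable M"
    and B_meas [measurable]: "\<And>k. B k \<in> borel_measurable M"
    and D_meas [measurable]: "\<And>n. D n \<in> borel_measurable M"
    and A_bound: "\<And>n k. AE \<omega> in M. \<bar>A n k \<omega>\<bar> \<le> K k"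
    and A_lim: "\<And>k. AE \<omega> in M. (\<lambda>n. A n k \<omega>) \<longlonglongrightarrow> B k \<omega>"
    and D_int: "\<And>n k. integrable M (\<lambda>\<omega>. (D n \<omega> - A n k \<omega>)\<^sup>2)"
    and D_bound: "\<And>n k. expectation (\<lambda>\<omega>. (D n \<omega> - A n k \<omega>)\<^sup>2) \<le> C * (4/5) ^ k"
begin

lemma C_nonneg: "0 \<le> C"
  using order_trans[OF Bochner_Integration.integral_nonneg D_bound[of 0 0]] by simp

lemma B_bound: "AE \<omega> in M. \<bar>B k \<omega>\<bar> \<le> K k"
proof -
  have "AE \<omega> in M. \<forall>n. \<bar>A n k \<omega>\<bar> \<le> K k" using A_bound by (simp add: AE_all_countable)
  then show ?thesis using A_lim[of k]
    by eventually_elim (auto intro: LIMSEQ_le_const2[OF tendsto_rabs])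
qed

lemma diff_square_bound:
  fixes a b :: real
  shows "\<bar>a\<bar> \<le> c \<Longrightarrow> \<bar>b\<bar> \<le> d \<Longrightarrow> norm ((a - b)\<^sup>2) \<le> (c + d)\<^sup>2"
  using power_mono[of "\<bar>a - b\<bar>" "c + d" 2] by simp

text \<open>Two truncations of the same \<open>D n\<close> are close, uniformly in n. At fixed
  levels they are bounded, so dominated convergence carries the bound to their limits.\<close>

lemma B_diff:
  assumes "k \<le> j"
  shows "integrable M (\<lambda>\<omega>. (B j \<omega> - B k \<omega>)\<^sup>2)"
    and "expectation (\<lambda>\<omega>. (B j \<omega> - B k \<omega>)\<^sup>2) \<le> 4 * C * (4/5) ^ k"
proof -
  have lim: "AE \<omega> in M. (\<lambda>n. (A n j \<omega> - A n k \<omega>)\<^sup>2) \<longlonglongrightarrow> (B j \<omega> - B k \<omega>)\<^sup>2"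
    using A_lim[of j] A_lim[of k] by eventually_elim (intro tendsto_intros)
  have bd: "AE \<omega> in M. norm ((A n j \<omega> - A n k \<omega>)\<^sup>2) \<le> (K j + K k)\<^sup>2" for n
    using A_bound[of n j] A_bound[of n k] by eventually_elim (rule diff_square_bound)
  note dc = integral_dominated_convergence[where w = "\<lambda>_. (K j + K k)\<^sup>2", OF _ _ _ lim bd]
  show "integrable M (\<lambda>\<omega>. (B j \<omega> - B k \<omega>)\<^sup>2)"
    by (rule integrable_dominated_convergence[where w = "\<lambda>_. (K j + K k)\<^sup>2", OF _ _ _ lim bd]) auto
  have "(\<lambda>n. expectation (\<lambda>\<omega>. (A n j \<omega> - A n k \<omega>)\<^sup>2)) \<longlonglongrightarrow> expectation (\<lambda>\<omega>. (B j \<omega> - B k \<omega>)\<^sup>2)"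
    by (rule dc) auto
  moreover have "expectation (\<lambda>\<omega>. (A n j \<omega> - A n k \<omega>)\<^sup>2) \<le> 4 * C * (4/5) ^ k" for n
  proof -
    have "expectation (\<lambda>\<omega>. ((D n \<omega> - A n k \<omega>) - (D n \<omega> - A n j \<omega>))\<^sup>2)
      \<le> 2 * expectation (\<lambda>\<omega>. (D n \<omega> - A n k \<omega>)\<^sup>2) + 2 * expectation (\<lambda>\<omega>. (D n \<omega> - A n j \<omega>)\<^sup>2)"
      by (intro integrable_real_square_diff D_int) auto
    also have "\<dots> \<le> 2 * (C * (4/5) ^ k) + 2 * (C * (4/5) ^ j)"
      using D_bound[of n k] D_bound[of n j] by linarith
    also have "\<dots> \<le> 2 * (C * (4/5) ^ k) + 2 * (C * (4/5) ^ k)"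
      using assms C_nonneg by (intro add_left_mono mult_left_mono power_decreasing) auto
    finally show ?thesis by simp
  qed
  ultimately show "expectation (\<lambda>\<omega>. (B j \<omega> - B k \<omega>)\<^sup>2) \<le> 4 * C * (4/5) ^ k"
    using LIMSEQ_le_const2 by blast
qed

text \<open>The weight 10/9 still leaves the expected squared increments summable, as 10/9 * 4/5 =
  8/9 < 1.\<close>

lemma B_convergent: "AE \<omega> in M. convergent (\<lambda>k. B k \<omega>)"
proof -
  have "AE \<omega> in M. summable (\<lambda>k. (10/9) ^ k * (B (Suc k) \<omega> - B k \<omega>)\<^sup>2)"
  proof (rule AE_summable[where c = "\<lambda>k. 4 * C * (8/9) ^ k"])
    fix k
    show "integrable M (\<lambda>\<omega>. (10/9) ^ k * (B (Suc k) \<omega> - B k \<omega>)\<^sup>2)"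
      using B_diff(1)[of k "Suc k"] by simp
    have "expectation (\<lambda>\<omega>. (10/9) ^ k * (B (Suc k) \<omega> - B k \<omega>)\<^sup>2)
        = (10/9) ^ k * expectation (\<lambda>\<omega>. (B (Suc k) \<omega> - B k \<omega>)\<^sup>2)" by simp
    also have "\<dots> \<le> (10/9) ^ k * (4 * C * (4/5) ^ k)"
      by (intro mult_left_mono B_diff(2)) auto
    also have "\<dots> = 4 * C * (8/9) ^ k" by (simp add: power_mult_distrib[symmetric])
    finally show "expectation (\<lambda>\<omega>. (10/9) ^ k * (B (Suc k) \<omega> - B k \<omega>)\<^sup>2) \<le> 4 * C * (8/9) ^ k" .
  qed (auto intro!: summable_mult summable_geometric)
  then show ?thesis by eventually_elim (rule square_summable_imp_convergent)
qed

definition L :: "'a \<Rightarrow> real"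
  where "L \<omega> = lim (\<lambda>k. B k \<omega>)"

lemma L_meas [measurable]: "L \<in> borel_measurable M"
  unfolding L_def by measurable

lemma B_tendsto: "AE \<omega> in M. (\<lambda>k. B k \<omega>) \<longlonglongrightarrow> L \<omega>"
  using B_convergent by eventually_elim (simp add: L_def convergent_LIMSEQ_iff)

lemma L_diff:
  "integrable M (\<lambda>\<omega>. (L \<omega> - B k \<omega>)\<^sup>2)" "expectation (\<lambda>\<omega>. (L \<omega> - B k \<omega>)\<^sup>2) \<le> 4 * C * (4/5) ^ k"
proof -
  have lim: "AE \<omega> in M. (\<lambda>j. (B (j + k) \<omega> - B k \<omega>)\<^sup>2) \<longlonglongrightarrow> (L \<omega> - B k \<omega>)\<^sup>2"
    using B_tendsto by eventually_elim (intro tendsto_intros LIMSEQ_ignore_initial_segment)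
  show "integrable M (\<lambda>\<omega>. (L \<omega> - B k \<omega>)\<^sup>2)" "expectation (\<lambda>\<omega>. (L \<omega> - B k \<omega>)\<^sup>2) \<le> 4 * C * (4/5) ^ k"
    by (rule integrable_Fatou[OF _ _ _ _ lim]; (rule B_diff)?; simp)+
qed

lemma bounded_square_integrable:
  fixes f :: "'a \<Rightarrow> real"
  assumes "f \<in> borel_measurable M" "AE \<omega> in M. \<bar>f \<omega>\<bar> \<le> c"
  shows "integrable M (\<lambda>\<omega>. (f \<omega>)\<^sup>2)"
proof (rule integrable_const_bound)
  show "AE \<omega> in M. norm ((f \<omega>)\<^sup>2) \<le> c\<^sup>2"
    using assms(2) by eventually_elim (use power_mono[of "\<bar>f _\<bar>" c 2] in simp)
qed (use assms(1) in simp)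

lemmas A_square_integrable = bounded_square_integrable[OF A_meas A_bound]
lemmas B_square_integrable = bounded_square_integrable[OF B_meas B_bound]

lemma L_square_integrable: "integrable M (\<lambda>\<omega>. (L \<omega>)\<^sup>2)"
  using integrable_real_square_add(1)[OF _ _ L_diff(1)[of 0] B_square_integrable[of 0]] by simp

lemma D_square_integrable: "integrable M (\<lambda>\<omega>. (D n \<omega>)\<^sup>2)"
  using integrable_real_square_add(1)[OF _ _ D_int[of n 0] A_square_integrable[of n 0]] by simp

lemma D_L_integrable: "integrable M (\<lambda>\<omega>. (D n \<omega> - L \<omega>)\<^sup>2)"
  by (intro integrable_real_square_diff(1) D_square_integrable L_square_integrable) auto

lemma D_tendsto: "(\<lambda>n. expectation (\<lambda>\<omega>. (D n \<omega> - L \<omega>)\<^sup>2)) \<longlonglongrightarrow> 0"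
proof (rule LIMSEQ_I)
  fix e :: real assume e: "0 < e"
  \<comment> \<open>The final estimate collects 2 C (4/5)^k from \<open>D_bound\<close> and 16 C
    (4/5)^k from \<open>L_diff\<close>; 20 covers both.\<close>
  have "(\<lambda>k. 20 * C * (4/5) ^ k) \<longlonglongrightarrow> 20 * C * 0"
    by (intro tendsto_mult tendsto_const LIMSEQ_realpow_zero) auto
  from LIMSEQ_D[OF this, of "e / 2"] e obtain k where "\<bar>20 * C * (4/5) ^ k\<bar> < e / 2" by auto
  then have k: "20 * C * (4/5) ^ k < e / 2" by linarith
  have lim: "AE \<omega> in M. (\<lambda>n. (A n k \<omega> - B k \<omega>)\<^sup>2) \<longlonglongrightarrow> (B k \<omega> - B k \<omega>)\<^sup>2"
    using A_lim[of k] by eventually_elim (intro tendsto_intros)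
  have bd: "AE \<omega> in M. norm ((A n k \<omega> - B k \<omega>)\<^sup>2) \<le> (K k + K k)\<^sup>2" for n
    using A_bound[of n k] B_bound[of k] by eventually_elim (rule diff_square_bound)
  have "(\<lambda>n. expectation (\<lambda>\<omega>. (A n k \<omega> - B k \<omega>)\<^sup>2)) \<longlonglongrightarrow> expectation (\<lambda>\<omega>. (B k \<omega> - B k \<omega>)\<^sup>2)"
    by (rule integral_dominated_convergence[where w = "\<lambda>_. (K k + K k)\<^sup>2", OF _ _ _ lim bd]) auto
  then have "(\<lambda>n. expectation (\<lambda>\<omega>. (A n k \<omega> - B k \<omega>)\<^sup>2)) \<longlonglongrightarrow> 0" by simp
  from LIMSEQ_D[OF this, of "e / 8"] e
  obtain N where N: "\<And>n. N \<le> n \<Longrightarrow> \<bar>expectation (\<lambda>\<omega>. (A n k \<omega> - B k \<omega>)\<^sup>2)\<bar> < e / 8"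
    by auto
  have AB: "integrable M (\<lambda>\<omega>. (A n k \<omega> - B k \<omega>)\<^sup>2)" for n
    by (intro integrable_real_square_diff(1) A_square_integrable B_square_integrable) auto
  have "norm (expectation (\<lambda>\<omega>. (D n \<omega> - L \<omega>)\<^sup>2) - 0) < e" if n: "N \<le> n" for n
  proof -
    have i: "integrable M (\<lambda>\<omega>. ((A n k \<omega> - B k \<omega>) - (L \<omega> - B k \<omega>))\<^sup>2)"
      by (intro integrable_real_square_diff(1) AB L_diff) auto
    have "expectation (\<lambda>\<omega>. ((D n \<omega> - A n k \<omega>) + ((A n k \<omega> - B k \<omega>) - (L \<omega> - B k \<omega>)))\<^sup>2)
      \<le> 2 * expectation (\<lambda>\<omega>. (D n \<omega> - A n k \<omega>)\<^sup>2) + 2 * expectation (\<lambda>\<omega>. ((A n k \<omega> - B k \<omega>) - (L \<omega> - B k \<omega>))\<^sup>2)"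
      by (intro integrable_real_square_add(2) i D_int) auto
    also have "expectation (\<lambda>\<omega>. ((A n k \<omega> - B k \<omega>) - (L \<omega> - B k \<omega>))\<^sup>2)
      \<le> 2 * expectation (\<lambda>\<omega>. (A n k \<omega> - B k \<omega>)\<^sup>2) + 2 * expectation (\<lambda>\<omega>. (L \<omega> - B k \<omega>)\<^sup>2)"
      by (intro integrable_real_square_diff(2) AB L_diff) auto
    finally have "expectation (\<lambda>\<omega>. (D n \<omega> - L \<omega>)\<^sup>2)
      \<le> 2 * expectation (\<lambda>\<omega>. (D n \<omega> - A n k \<omega>)\<^sup>2) + 2 * (2 * expectation (\<lambda>\<omega>. (A n k \<omega> - B k \<omega>)\<^sup>2)
        + 2 * expectation (\<lambda>\<omega>. (L \<omega> - B k \<omega>)\<^sup>2))" by simp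
    moreover have x: "0 \<le> C * (4/5) ^ k" using C_nonneg by simp
    ultimately have "expectation (\<lambda>\<omega>. (D n \<omega> - L \<omega>)\<^sup>2) < e"
      using N[OF n] k D_bound[of n k] L_diff(2)[of k] x by (auto simp: abs_less_iff mult.assoc)
    then show ?thesis by simp
  qed
  then show "\<exists>N. \<forall>n\<ge>N. norm (expectation (\<lambda>\<omega>. (D n \<omega> - L \<omega>)\<^sup>2) - 0) < e" by blast
qed

end

section \<open>Limits along a single trajectory\<close>

definition xlnx :: "real \<Rightarrow> real"
  where "xlnx x = x * ln x"

lemma abs_xlnx_le:
  assumes "0 \<le> x" "x \<le> 1"
  shows "\<bar>xlnx x\<bar> \<le> 2 * sqrt x"
proof (cases "x = 0")
  case False
  define s where "s = sqrt x"
  have s: "0 < s" "s \<le> 1" "x = s * s" using assms False by (simp_all add: s_def)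
  have "- ln s = ln (1 / s)" using s by (simp add: ln_div)
  also have "\<dots> \<le> 1 / s" using s ln_le_minus_one[of "1 / s"] by simp
  finally have "x * (- (2 * ln s)) \<le> x * (2 * (1 / s))" using assms by (intro mult_left_mono) auto
  moreover have "ln x = 2 * ln s" using s by (simp add: ln_mult)
  moreover have "x * ln x \<le> 0" using assms by (intro mult_nonneg_nonpos) (auto simp: ln_le_zero_iff False order_less_le)
  ultimately show ?thesis using s by (simp add: xlnx_def s_def[symmetric])
qed (simp add: xlnx_def)

text \<open>The logarithm has no limit at 0, so there the product is controlled by the square
  root.\<close>

lemma tendsto_xlnx:
  assumes lim: "(f \<longlongrightarrow> l) F" and nonneg: "\<And>n. 0 \<le> f n" and l: "0 \<le> l"
  shows "((\<lambda>n. xlnx (f n)) \<longlongrightarrow> xlnx l) F"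
proof (cases "l = 0")
  case True
  have "((\<lambda>n. 2 * sqrt (f n)) \<longlongrightarrow> 2 * sqrt 0) F"
    using lim True by (intro tendsto_intros) auto
  then have sqrt: "((\<lambda>n. 2 * sqrt (f n)) \<longlongrightarrow> 0) F" by simp
  have "\<forall>\<^sub>F n in F. f n < 1" using lim True by (intro order_tendstoD) auto
  then have "\<forall>\<^sub>F n in F. norm (xlnx (f n)) \<le> 2 * sqrt (f n)"
  proof eventually_elim
    case (elim n)
    then show ?case using abs_xlnx_le[OF nonneg[of n]] by simp
  qed
  then have "((\<lambda>n. xlnx (f n)) \<longlongrightarrow> 0) F" by (rule Lim_null_comparison) (rule sqrt)
  then show ?thesis using True by (simp add: xlnx_def)
next
  case False
  then show ?thesis unfolding xlnx_def using lim l by (intro tendsto_intros) auto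
qed

text \<open>Clearing the quotient turns the entropy of a split into differences of x ln x. With 0 *
  ln 0 = 0 the right side is continuous also where a mass vanishes.\<close>

lemma mass_C_fun:
  assumes "0 \<le> a" "0 \<le> b"
  shows "(a + b) * C_fun (a / (a + b)) = a + b + 2 * (xlnx a + xlnx b - xlnx (a + b))"
proof (cases "a = 0 \<or> b = 0")
  case True
  then show ?thesis by (auto simp: C_fun_def xlnx_def)
next
  case False
  then have ab: "0 < a" "0 < b" using assms by auto
  have "1 - a / (a + b) = b / (a + b)" using ab by (simp add: field_simps)
  then have "(a + b) * C_fun (a / (a + b)) = a + b
      + 2 * ((a + b) * (a / (a + b)) * ln (a / (a + b)) + (a + b) * (b / (a + b)) * ln (b / (a + b)))"
    by (simp only: C_fun_def distrib_left mult_1_right mult.assoc mult.left_commute)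
  also have "\<dots> = a + b + 2 * (a * ln (a / (a + b)) + b * ln (b / (a + b)))"
    using ab by simp
  also have "\<dots> = a + b + 2 * (xlnx a + xlnx b - xlnx (a + b))"
    using ab by (simp add: ln_div xlnx_def algebra_simps)
  finally show ?thesis .
qed

text \<open>Apart from the entropy term the mean is linear in k, with a slope that depends on n
  only. Such a linear part nearly cancels when a subtree is split into its two halves.\<close>

lemma mean_path_asymp:
  assumes n: "1 \<le> n" and k: "k \<le> n"
  shows "\<bar>mean_path k - (2 * real n * xlnx (real k / real n)
     + (2 * ln (real n) + 2 * euler_mascheroni - 3) * real k)\<bar> \<le> 2 * ln (real n) + 6"
proof (cases "k = 0")
  case True
  then show ?thesis using n by (simp add: xlnx_def)
next
  case False
  then have k1: "1 \<le> k" by simp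
  define h where "h = harm k - ln (real k) - euler_mascheroni"
  have h: "\<bar>h\<bar> \<le> 1 / real k" unfolding h_def by (rule harm_ln_bound[OF k1])
  have "2 * real n * xlnx (real k / real n) = 2 * real k * (ln (real k) - ln (real n))"
    using k1 n by (simp add: xlnx_def ln_div)
  then have "mean_path k - (2 * real n * xlnx (real k / real n)
     + (2 * ln (real n) + 2 * euler_mascheroni - 3) * real k)
     = 2 * ln (real k) + 2 * euler_mascheroni + 2 * ((real k + 1) * h)"
    by (simp add: mean_path_def h_def algebra_simps)
  moreover have "\<bar>(real k + 1) * h\<bar> \<le> 2"
  proof -
    have "\<bar>(real k + 1) * h\<bar> = (real k + 1) * \<bar>h\<bar>" by (simp add: abs_mult)
    also have "\<dots> \<le> (real k + 1) * (1 / real k)" using h by (intro mult_left_mono) auto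
    also have "\<dots> \<le> 2" using k1 by (simp add: field_simps)
    finally show ?thesis .
  qed
  moreover have "0 \<le> ln (real k)" "ln (real k) \<le> ln (real n)" using k1 k by auto
  moreover have "0 < (euler_mascheroni :: real)" "(euler_mascheroni :: real) < 1"
    using euler_mascheroni_pos euler_mascheroni_less_13_over_22 by linarith+
  ultimately show ?thesis by linarith
qed

definition split_entropy :: "real \<Rightarrow> real \<Rightarrow> real \<Rightarrow> real"
  where "split_entropy m a b = m + 2 * (xlnx a + xlnx b - xlnx m)"

text \<open>Sizes are additive up to the node itself, so the linear parts leave at most one slope, 2
  ln n + 3. Added to three errors 2 ln n + 6 this is the stated bound.\<close>

lemma toll_asymp:
  assumes x: "grown n x"
  shows "\<bar>toll x v - real n * split_entropy (real (subtree_size x v) / real n)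
      (real (subtree_size x (v @ [False])) / real n) (real (subtree_size x (v @ [True])) / real n)\<bar>
    \<le> 8 * ln (real n) + 21"
proof -
  have n: "1 \<le> n" using grown_pos[OF x] by simp
  define m a b where "m = subtree_size x v" and "a = subtree_size x (v @ [False])"
    and "b = subtree_size x (v @ [True])"
  have le: "m \<le> n" "a \<le> n" "b \<le> n" using subtree_size_le[OF x] by (auto simp: m_def a_def b_def)
  have "m = (if v \<in> x then 1 else 0) + a + b"
    unfolding m_def a_def b_def by (rule subtree_size_rec[OF grown_finite[OF x]])
  then obtain d where d: "real m = d + real a + real b" "0 \<le> d" "d \<le> 1"
    by (cases "v \<in> x") auto
  define c where "c = 2 * ln (real n) + 2 * euler_mascheroni - 3"
  define e where "e k = mean_path k - (2 * real n * xlnx (real k / real n) + c * real k)" for k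
  have e: "\<bar>e k\<bar> \<le> 2 * ln (real n) + 6" if "k \<le> n" for k
    unfolding e_def c_def by (rule mean_path_asymp[OF n that])
  have "toll x v - real n * split_entropy (real m / real n) (real a / real n) (real b / real n)
     = (e a + e b - e m) + c * (real a + real b - real m)"
    using n unfolding toll_def split_entropy_def e_def m_def[symmetric] a_def[symmetric] b_def[symmetric]
    by (simp add: algebra_simps)
  moreover have "\<bar>c * (real a + real b - real m)\<bar> \<le> 2 * ln (real n) + 3"
  proof -
    have g: "0 < (euler_mascheroni :: real)" "(euler_mascheroni :: real) < 1"
      using euler_mascheroni_pos euler_mascheroni_less_13_over_22 by linarith+
    have l: "0 \<le> ln (real n)" using n by simp
    have "\<bar>c * (real a + real b - real m)\<bar> = \<bar>c\<bar> * d" using d by (simp add: abs_mult)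
    also have "\<dots> \<le> \<bar>c\<bar> * 1" using d by (intro mult_left_mono) auto
    also have "\<bar>c\<bar> \<le> 2 * ln (real n) + 3" using g l unfolding c_def by linarith
    finally show ?thesis by simp
  qed
  ultimately show ?thesis
    using e[OF le(1)] e[OF le(2)] e[OF le(3)]
    unfolding m_def[symmetric] a_def[symmetric] b_def[symmetric] by linarith
qed

text \<open>A bound independent of n for dominated convergence; 42 = 13 + 8 + 21, with 13 for the
  entropy term and ln n at most n.\<close>

lemma toll_bound:
  assumes x: "grown n x"
  shows "\<bar>toll x v\<bar> / (real n + 1) \<le> 42"
proof -
  have n: "0 < real n" "1 \<le> real n" using grown_pos[OF x] by simp_all
  let ?r = "\<lambda>v. real (subtree_size x v) / real n"
  have r: "0 \<le> ?r v" "?r v \<le> 1" for v using subtree_size_le[OF x, of v] n by (auto simp: divide_le_eq)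
  have f: "\<bar>xlnx (?r v)\<bar> \<le> 2" for v
    using abs_xlnx_le[OF r[of v]] real_sqrt_le_1_iff[of "?r v"] r[of v] by linarith
  let ?s = "split_entropy (?r v) (?r (v @ [False])) (?r (v @ [True]))"
  have "\<bar>m + 2 * (a + b - c)\<bar> \<le> 13"
    if "0 \<le> m" "m \<le> 1" "\<bar>a\<bar> \<le> 2" "\<bar>b\<bar> \<le> 2" "\<bar>c\<bar> \<le> 2" for a b c m :: real
    using that by (simp add: abs_le_iff)
  then have "\<bar>?s\<bar> \<le> 13" unfolding split_entropy_def using r f by blast
  then have "\<bar>real n * ?s\<bar> \<le> real n * 13" using n by (simp add: abs_mult)
  moreover have "ln (real n) \<le> real n" using n ln_le_minus_one[of "real n"] by simp
  ultimately have "\<bar>toll x v\<bar> \<le> 42 * real n"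
    using toll_asymp[OF x, of v] n by linarith
  then show ?thesis using n by (simp add: divide_le_eq)
qed

lemma toll_limit:
  fixes x :: "nat \<Rightarrow> bool list set"
  assumes x: "\<And>n. 1 \<le> n \<Longrightarrow> grown n (x n)"
    and lim: "\<And>u. (\<lambda>n. real (subtree_size (x n) u) / real n) \<longlonglongrightarrow> p u"
  shows "(\<lambda>n. toll (x n) v / (real n + 1)) \<longlonglongrightarrow> p v * C_fun (p (v @ [False]) / p v)"
proof -
  let ?r = "\<lambda>n v. real (subtree_size (x n) v) / real n"
  let ?s = "\<lambda>n. split_entropy (?r n v) (?r n (v @ [False])) (?r n (v @ [True]))"
  have p: "0 \<le> p u" for u by (rule LIMSEQ_le_const[OF lim]) auto
  \<comment> \<open>Additivity of \<open>p\<close> is inherited from the sizes, where the node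
    \<open>v\<close> itself accounts for at most 1 / n.\<close>
  have "(\<lambda>n. ?r n v - ?r n (v @ [False]) - ?r n (v @ [True])) \<longlonglongrightarrow> p v - p (v @ [False]) - p (v @ [True])"
    by (intro tendsto_diff lim)
  moreover have "(\<lambda>n. ?r n v - ?r n (v @ [False]) - ?r n (v @ [True])) \<longlonglongrightarrow> 0"
  proof (rule Lim_null_comparison)
    show "\<forall>\<^sub>F n in sequentially. norm (?r n v - ?r n (v @ [False]) - ?r n (v @ [True])) \<le> 1 / real n"
      using eventually_ge_at_top[of 1]
    proof eventually_elim
      case (elim n)
      have "?r n v - ?r n (v @ [False]) - ?r n (v @ [True]) = (if v \<in> x n then 1 else 0) / real n"
        by (simp add: subtree_size_rec[OF grown_finite[OF x[OF elim]], of v] add_divide_distrib)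
      then show ?case by simp
    qed
  qed (rule lim_1_over_n)
  ultimately have "p v - p (v @ [False]) - p (v @ [True]) = 0" by (rule LIMSEQ_unique)
  then have pv: "p v = p (v @ [False]) + p (v @ [True])" by simp
  have "?s \<longlonglongrightarrow> split_entropy (p v) (p (v @ [False])) (p (v @ [True]))"
    unfolding split_entropy_def by (intro tendsto_intros tendsto_xlnx lim p) auto
  moreover have "split_entropy (p v) (p (v @ [False])) (p (v @ [True])) = p v * C_fun (p (v @ [False]) / p v)"
    using mass_C_fun[OF p p, of "v @ [False]" "v @ [True]"] unfolding split_entropy_def pv by simp
  ultimately have main: "(\<lambda>n. real n / (real n + 1) * ?s n) \<longlonglongrightarrow> 1 * (p v * C_fun (p (v @ [False]) / p v))"
    by (intro tendsto_mult) (real_asymp, simp)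
  have "(\<lambda>n. toll (x n) v / (real n + 1) - real n / (real n + 1) * ?s n) \<longlonglongrightarrow> 0"
  proof (rule Lim_null_comparison)
    show "\<forall>\<^sub>F n in sequentially. norm (toll (x n) v / (real n + 1) - real n / (real n + 1) * ?s n)
        \<le> (8 * ln (real n) + 21) / (real n + 1)"
      using eventually_ge_at_top[of 1]
    proof eventually_elim
      case (elim n)
      have "norm (toll (x n) v / (real n + 1) - real n / (real n + 1) * ?s n)
         = \<bar>toll (x n) v - real n * ?s n\<bar> / (real n + 1)"
        by (simp add: diff_divide_distrib[symmetric])
      also have "\<dots> \<le> (8 * ln (real n) + 21) / (real n + 1)"
        by (intro divide_right_mono toll_asymp x elim) simp
      finally show ?case .
    qed
    show "(\<lambda>n. (8 * ln (real n) + 21) / (real n + 1)) \<longlonglongrightarrow> 0" by real_asymp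
  qed
  from tendsto_add[OF this main] show ?thesis by simp
qed

subsection \<open>Masses of cones\<close>

text \<open>Entering or leaving the region below \<open>u\<close> costs a fixed distance. That
  region is therefore open and closed, and its indicator is an admissible test function for weak
  convergence.\<close>

lemma dist_below:
  assumes "below u v" "\<not> below u w"
  shows "(1/2) ^ length u / 2 \<le> dist v w"
proof -
  have "u \<noteq> []" using assms by (cases w) auto
  have "\<not> enat (length u - 1) < meet_len v w"
  proof
    assume "enat (length u - 1) < meet_len v w"
    then obtain p where p: "below p v" "below p w" "length u - 1 < length p"
      by (auto simp: meet_len_iff)
    then have "prefix u p \<or> prefix p u" using below_total assms(1) by blast
    then have "prefix u p"
    proof
      assume "prefix p u"
      then obtain r where "u = p @ r" by (auto simp: prefix_def)
      then show ?thesis using p(3) by (cases r) auto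
    qed
    then show False using below_prefix p(2) assms(2) by blast
  qed
  then have "half_pow (enat (length u - 1)) \<le> half_pow (meet_len v w)"
    by (intro half_pow_antimono) simp
  moreover have "half_pow (enat (length u - 1)) = 2 * (1/2) ^ length u"
    using \<open>u \<noteq> []\<close> by (cases u) auto
  moreover have "half_pow (depth v) \<le> (1/2) ^ length u"
    using half_pow_antimono[OF below_len[OF assms(1)]] by simp
  moreover have "half_pow (depth w) \<le> half_pow (meet_len v w)"
    by (intro half_pow_antimono meet_len_le)
  moreover have "h / 2 \<le> m - (a + b) / 2" if "c \<le> m" "c = 2 * h" "a \<le> h" "b \<le> m" for h m a b c :: real
    using that by (simp add: field_simps)
  ultimately show ?thesis unfolding dist_seq01_def by blast
qed

lemma continuous_below: "continuous_on UNIV (indicator {v. below u v} :: seq01 \<Rightarrow> real)"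
  unfolding continuous_on_iff
proof (intro ballI allI impI)
  fix v :: seq01 and e :: real
  assume e: "0 < e"
  have "dist (indicator {v. below u v} w :: real) (indicator {v. below u v} v) < e"
    if "dist w v < (1/2) ^ length u / 2" for w
    using that e dist_below[of u v w] dist_below[of u w v]
    by (auto simp: indicator_def dist_commute not_less[symmetric])
  then show "\<exists>d>0. \<forall>w\<in>UNIV. dist w v < d \<longrightarrow>
      dist (indicator {v. below u v} w :: real) (indicator {v. below u v} v) < e"
    by (intro exI[of _ "(1/2) ^ length u / 2"]) auto
qed

lemma sets_below: "{v. below u v} \<in> sets borel"
proof -
  have "(indicator {v. below u v} :: seq01 \<Rightarrow> real) \<in> borel_measurable borel" (is "?f \<in> _")
    by (rule borel_measurable_continuous_onI[OF continuous_below])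
  then have "?f -` {1 :: real} \<inter> space borel \<in> sets borel" by (rule measurable_sets) simp
  moreover have "?f -` {1 :: real} \<inter> space borel = {v. below u v}" by (auto simp: indicator_def)
  ultimately show ?thesis by simp
qed

lemma cone_eq: "cone u = boundary \<inter> {v. below u v}"
  by (auto simp: cone_def)

lemma sets_cone: "cone u \<in> sets (restrict_space borel boundary)"
  unfolding cone_eq sets_restrict_space by (intro imageI sets_below)

lemma mass_limit:
  assumes conv: "weakly_converges (\<lambda>n. distr (measure_pmf (pmf_of_set (x n))) borel Node) (distr \<mu> borel (\<lambda>v. v))"
    and sets: "sets \<mu> = sets (restrict_space borel boundary)"
    and x: "\<And>n. 1 \<le> n \<Longrightarrow> grown n (x n)"
  shows "(\<lambda>n. real (subtree_size (x n) u) / real n) \<longlonglongrightarrow> mass \<mu> u"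
proof -
  \<comment> \<open>The region contains nodes as well as ends. Under the uniform distribution on the
    tree it counts the subtree at \<open>u\<close>; under the limit, which lives on the boundary, it
    measures the cone.\<close>
  let ?f = "indicator {v. below u v} :: seq01 \<Rightarrow> real"
  have f [measurable]: "?f \<in> borel_measurable borel"
    by (rule borel_measurable_continuous_onI[OF continuous_below])
  have "bounded (range ?f)" by (rule boundedI[of _ 1]) (auto simp: indicator_def)
  then have "(\<lambda>n. \<integral>v. ?f v \<partial>distr (measure_pmf (pmf_of_set (x n))) borel Node)
      \<longlonglongrightarrow> (\<integral>v. ?f v \<partial>distr \<mu> borel (\<lambda>v. v))"
    using conv continuous_below unfolding weakly_converges_def by blast
  moreover have "(\<integral>v. ?f v \<partial>distr \<mu> borel (\<lambda>v. v)) = mass \<mu> u"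
  proof -
    have "(\<lambda>v. v) \<in> \<mu> \<rightarrow>\<^sub>M borel"
      unfolding measurable_cong_sets[OF sets refl] by (rule measurable_restrict_space1) simp
    moreover have "space \<mu> = boundary" using sets_eq_imp_space_eq[OF sets] by (simp add: space_restrict_space)
    ultimately show ?thesis
      by (subst integral_distr) (auto simp: mass_def cone_eq Int_commute)
  qed
  moreover have "\<forall>\<^sub>F n in sequentially. (\<integral>v. ?f v \<partial>distr (measure_pmf (pmf_of_set (x n))) borel Node)
      = real (subtree_size (x n) u) / real n"
    using eventually_ge_at_top[of 1]
  proof eventually_elim
    case (elim n)
    note g = x[OF elim]
    have ne: "x n \<noteq> {}" "finite (x n)" using grown_Nil[OF g] grown_finite[OF g] by auto
    have "(\<integral>v. ?f v \<partial>distr (measure_pmf (pmf_of_set (x n))) borel Node)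
        = (\<integral>v. ?f (Node v) \<partial>measure_pmf (pmf_of_set (x n)))"
      by (rule integral_distr) auto
    also have "\<dots> = (\<Sum>v\<in>x n. ?f (Node v)) / card (x n)"
      by (rule integral_pmf_of_set[OF ne])
    also have "(\<Sum>v\<in>x n. ?f (Node v)) = real (subtree_size (x n) u)"
      using ne by (simp add: indicator_def sum.If_cases subtree_size_def Int_def)
    finally show ?case by (simp add: grown_card[OF g])
  qed
  ultimately show ?thesis by (simp add: tendsto_cong)
qed

lemma mass_nonneg: "0 \<le> mass \<mu> u"
  by (simp add: mass_def)

lemma measurable_mass:
  assumes "Xinf \<in> M \<rightarrow>\<^sub>M prob_algebra (restrict_space borel boundary)"
  shows "(\<lambda>\<omega>. mass (Xinf \<omega>) u) \<in> borel_measurable M"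
  unfolding mass_def
  by (rule measurable_compose[OF measurable_prob_algebraD[OF assms] measurable_measure_subprob_algebra[OF sets_cone]])

section \<open>Unordered sums over all nodes as limits along levels\<close>

lemma filterlim_below_level:
  "filterlim (\<lambda>k. {u :: bool list. length u < k}) (finite_subsets_at_top UNIV) sequentially"
  unfolding filterlim_finite_subsets_at_top
proof (intro allI impI)
  fix F :: "bool list set" assume F: "finite F \<and> F \<subseteq> UNIV"
  have "F \<subseteq> {u. length u < k}" if "Suc (Max (length ` F)) \<le> k" for k
  proof
    fix u assume "u \<in> F"
    then have "length u \<le> Max (length ` F)" using F by (intro Max_ge) auto
    then show "u \<in> {u. length u < k}" using that by simp
  qed
  then show "\<forall>\<^sub>F k in sequentially. finite {u :: bool list. length u < k} \<and> F \<subseteq> {u. length u < k}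
      \<and> {u :: bool list. length u < k} \<subseteq> UNIV"
    by (auto intro!: eventually_sequentiallyI)
qed

lemma summable_on_levels:
  fixes f :: "bool list \<Rightarrow> real"
  assumes nonneg: "\<And>u. 0 \<le> f u" and bound: "\<And>k. (\<Sum>u | length u < k. f u) \<le> c"
  shows "f summable_on UNIV"
proof (rule nonneg_bdd_above_summable_on)
  show "bdd_above (sum f ` {F. F \<subseteq> UNIV \<and> finite F})"
  proof (rule bdd_aboveI2)
    fix F :: "bool list set" assume F: "F \<in> {F. F \<subseteq> UNIV \<and> finite F}"
    have "\<forall>\<^sub>F k in sequentially. F \<subseteq> {u. length u < k}"
      using filterlim_below_level F unfolding filterlim_finite_subsets_at_top
      by (auto elim!: eventually_mono dest!: spec[of _ F])
    then obtain k where "F \<subseteq> {u. length u < k}" by (auto simp: eventually_sequentially)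
    then have "sum f F \<le> (\<Sum>u | length u < k. f u)" using nonneg by (intro sum_mono2) auto
    also note bound
    finally show "sum f F \<le> c" .
  qed
qed (rule nonneg)

lemma infsum_levels:
  fixes f :: "bool list \<Rightarrow> real"
  assumes "f summable_on UNIV"
  shows "(\<lambda>k. \<Sum>u | length u < k. f u) \<longlonglongrightarrow> infsum f UNIV"
  by (rule filterlim_compose[OF infsum_tendsto[OF assms] filterlim_below_level])

text \<open>With an extended real valued supremum the infinite sum is measurable also where it
  diverges, as both sides are then 0.\<close>

lemma infsum_eq_SUP:
  fixes f :: "bool list \<Rightarrow> real"
  assumes nonneg: "\<And>u. 0 \<le> f u"
  shows "infsum f UNIV = enn2real (SUP k. ennreal (\<Sum>u | length u < k. f u))"
proof -
  let ?b = "\<lambda>k. \<Sum>u | length u < k. f u"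
  have "incseq (\<lambda>k. ennreal (?b k))"
    using nonneg by (intro incseq_SucI ennreal_leI) (auto simp: below_Suc_sum sum_nonneg)
  then have lim: "(\<lambda>k. ennreal (?b k)) \<longlonglongrightarrow> (SUP k. ennreal (?b k))" by (rule LIMSEQ_SUP)
  show ?thesis
  proof (cases "f summable_on UNIV")
    case True
    have "(\<lambda>k. ennreal (?b k)) \<longlonglongrightarrow> ennreal (infsum f UNIV)"
      by (intro tendsto_ennrealI infsum_levels True)
    then have "(SUP k. ennreal (?b k)) = ennreal (infsum f UNIV)" using lim LIMSEQ_unique by blast
    then show ?thesis using nonneg by (simp add: infsum_nonneg)
  next
    case False
    have "(SUP k. ennreal (?b k)) = top"
    proof (rule ccontr)
      assume ne: "(SUP k. ennreal (?b k)) \<noteq> top"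
      then obtain c where c: "0 \<le> c" "(SUP k. ennreal (?b k)) = ennreal c"
        by (cases "SUP k. ennreal (?b k)" rule: ennreal_cases) auto
      have "ennreal (?b k) \<le> ennreal c" for k unfolding c(2)[symmetric] by (rule SUP_upper) simp
      then have "?b k \<le> c" for k using c(1) by (simp add: ennreal_le_iff)
      then have "f summable_on UNIV" by (rule summable_on_levels[OF nonneg])
      then show False using False by contradiction
    qed
    then show ?thesis by (simp only: infsum_not_exists[OF False] enn2real_top)
  qed
qed

subsection \<open>Almost sure convergence\<close>

text \<open>Between consecutive fourth powers a monotone sequence is squeezed, at the price of
  changing its normalisation. The subtracted logarithm diverges, so the ratio of the normalisations
  must tend to 1 faster than the logarithm grows: the error is of order ln k / k for a polynomial
  subsequence, whereas a geometric one would fail.\<close>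

lemma fourth_power_interpolation:
  fixes w :: "nat \<Rightarrow> real"
  assumes mono: "\<And>m n. 1 \<le> m \<Longrightarrow> m \<le> n \<Longrightarrow> w m \<le> w n" and nonneg: "\<And>n. 0 \<le> w n"
    and lim: "(\<lambda>k. w (Suc k ^ 4) / (real (Suc k ^ 4))\<^sup>2 - 2 * ln (real (Suc k ^ 4))) \<longlonglongrightarrow> l"
  shows "(\<lambda>n. w n / (real n)\<^sup>2 - 2 * ln (real n)) \<longlonglongrightarrow> l"
proof -
  define a where "a k = w (Suc k ^ 4) / (real (Suc k ^ 4))\<^sup>2 - 2 * ln (real (Suc k ^ 4))" for k
  define q where "q k = (real k + 1) ^ 4" for k :: nat
  have q: "real (Suc k ^ 4) = q k" for k by (simp add: q_def add.commute)
  have qpos: "0 < q k" for k by (simp add: q_def)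
  have w: "w (Suc k ^ 4) = (q k)\<^sup>2 * (a k + 2 * ln (q k))" for k
    using qpos[of k] unfolding a_def q by (simp add: field_simps)
  have a: "a \<longlonglongrightarrow> l" using lim by (simp add: a_def[abs_def])
  define up where "up k = w (Suc (Suc k) ^ 4) / (q k)\<^sup>2 - 2 * ln (q k)" for k
  define lo where "lo k = w (Suc k ^ 4) / (q (Suc k))\<^sup>2 - 2 * ln (q (Suc k))" for k
  have "(\<lambda>k. ((q (Suc k))\<^sup>2 / (q k)\<^sup>2) * a (Suc k)
      + ((q (Suc k))\<^sup>2 / (q k)\<^sup>2 * (2 * ln (q (Suc k))) - 2 * ln (q k))) \<longlonglongrightarrow> 1 * l + 0"
    unfolding q_def by (intro tendsto_intros LIMSEQ_Suc[OF a]; real_asymp)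
  then have up: "up \<longlonglongrightarrow> l" unfolding up_def w by (simp add: algebra_simps add_divide_distrib)
  have "(\<lambda>k. ((q k)\<^sup>2 / (q (Suc k))\<^sup>2) * a k
      + ((q k)\<^sup>2 / (q (Suc k))\<^sup>2 * (2 * ln (q k)) - 2 * ln (q (Suc k)))) \<longlonglongrightarrow> 1 * l + 0"
    unfolding q_def by (intro tendsto_intros a; real_asymp)
  then have lo: "lo \<longlonglongrightarrow> l" unfolding lo_def w by (simp add: algebra_simps add_divide_distrib)
  show ?thesis
  proof (rule LIMSEQ_I)
    fix e :: real assume e: "0 < e"
    obtain K1 where K1: "\<And>k. K1 \<le> k \<Longrightarrow> norm (up k - l) < e" using LIMSEQ_D[OF up e] by blast
    obtain K2 where K2: "\<And>k. K2 \<le> k \<Longrightarrow> norm (lo k - l) < e" using LIMSEQ_D[OF lo e] by blast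
    define K where "K = max K1 K2"
    have "norm (w n / (real n)\<^sup>2 - 2 * ln (real n) - l) < e" if n: "Suc K ^ 4 \<le> n" for n
    proof -
      define j where "j = (LEAST j. n < j ^ 4)"
      have ex: "n < Suc n ^ 4" using self_le_power[of "Suc n" 4] by simp
      have j: "n < j ^ 4" unfolding j_def by (rule LeastI, rule ex)
      have "Suc K < j"
      proof (rule ccontr)
        assume "\<not> Suc K < j"
        then have "j ^ 4 \<le> Suc K ^ 4" by (intro power_mono) auto
        then show False using j n by linarith
      qed
      then obtain k where k: "j = Suc (Suc k)" "K \<le> k" by (cases j; cases "j - 1") auto
      have "\<not> n < Suc k ^ 4" unfolding k using not_less_Least[of "Suc k" "\<lambda>j. n < j ^ 4"] k
        by (simp add: j_def[symmetric])
      then have kn: "Suc k ^ 4 \<le> n" "n \<le> Suc (Suc k) ^ 4" using j k by simp_all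
      have one: "1 \<le> Suc k ^ 4" by simp
      then have n1: "1 \<le> n" using kn by linarith
      have qn: "q k \<le> real n" "real n \<le> q (Suc k)" "0 < real n"
        using kn n1 unfolding q[symmetric] of_nat_le_iff by auto
      have "w n / (real n)\<^sup>2 \<le> w (Suc (Suc k) ^ 4) / (q k)\<^sup>2"
        using mono[OF n1 kn(2)] qn qpos[of k] nonneg by (intro frac_le power_mono) auto
      moreover have "ln (q k) \<le> ln (real n)" using qn qpos[of k] by simp
      moreover have "w (Suc k ^ 4) / (q (Suc k))\<^sup>2 \<le> w n / (real n)\<^sup>2"
        using mono[OF one kn(1)] qn nonneg by (intro frac_le power_mono) auto
      moreover have "ln (real n) \<le> ln (q (Suc k))" using qn qpos[of "Suc k"] by simp
      ultimately have "w n / (real n)\<^sup>2 - 2 * ln (real n) \<le> up k" "lo k \<le> w n / (real n)\<^sup>2 - 2 * ln (real n)"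
        unfolding up_def lo_def by linarith+
      moreover have "norm (up k - l) < e" "norm (lo k - l) < e" using K1 K2 k by (auto simp: K_def)
      ultimately show ?thesis unfolding real_norm_def abs_less_iff by linarith
    qed
    then show "\<exists>N. \<forall>n\<ge>N. norm (w n / (real n)\<^sup>2 - 2 * ln (real n) - l) < e" by blast
  qed
qed

section \<open>The limit theorem\<close>

definition toll_part :: "nat \<Rightarrow> nat \<Rightarrow> bool list set \<Rightarrow> real"
  where "toll_part n k x = (\<Sum>v | length v < k. toll x v) / (real n + 1)"

definition square_part :: "nat \<Rightarrow> nat \<Rightarrow> bool list set \<Rightarrow> real"
  where "square_part n k x = (\<Sum>u | length u < k. (real (subtree_size x u) / real n)\<^sup>2)"

lemma square_tail_split:
  assumes "grown n x"
  shows "square_tail 0 x = square_part n k x + square_tail k x"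
proof -
  note fin = grown_finite[OF assms]
  let ?f = "\<lambda>u. (real (subtree_size x u) / real n)\<^sup>2"
  have "(\<Sum>u | length u < k. ?f u) = (\<Sum>u\<in>{u \<in> x. length u < k}. ?f u)"
  proof (intro sum.mono_neutral_right ballI)
    fix u assume "u \<in> {u. length u < k} - {u \<in> x. length u < k}"
    then have "u \<notin> x" by blast
    then show "?f u = 0" by (simp add: subtree_size_0[OF grown_binary_tree[OF assms]])
  qed auto
  moreover have "(\<Sum>u\<in>x. ?f u) = (\<Sum>u\<in>{u \<in> x. length u < k} \<union> {u \<in> x. k \<le> length u}. ?f u)"
    by (intro sum.cong) auto
  moreover have "\<dots> = (\<Sum>u\<in>{u \<in> x. length u < k}. ?f u) + (\<Sum>u\<in>{u \<in> x. k \<le> length u}. ?f u)"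
    using fin by (intro sum.union_disjoint) auto
  ultimately show ?thesis by (simp add: square_part_def square_tail_def grown_card[OF assms])
qed

locale bst_with_limit = bst +
  fixes Xinf :: "'a \<Rightarrow> seq01 measure"
  assumes limit: "bst_limit M X Xinf"
begin

lemma measurable_Xinf: "Xinf \<in> M \<rightarrow>\<^sub>M prob_algebra (restrict_space borel boundary)"
  using limit by (simp add: bst_limit_def)

lemma AE_all_grown: "AE \<omega> in M. \<forall>n\<ge>1. grown n (X n \<omega>)"
proof -
  have "AE \<omega> in M. 1 \<le> n \<longrightarrow> grown n (X n \<omega>)" for n
    using AE_grown[of n] by (cases "1 \<le> n") auto
  then show ?thesis by (simp add: AE_all_countable)
qed

lemma AE_mass_limit:
  "AE \<omega> in M. \<forall>u. (\<lambda>n. real (subtree_size (X n \<omega>) u) / real n) \<longlonglongrightarrow> mass (Xinf \<omega>) u"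
proof -
  have "AE \<omega> in M. weakly_converges (\<lambda>n. distr (measure_pmf (pmf_of_set (X n \<omega>))) borel Node)
      (distr (Xinf \<omega>) borel (\<lambda>v. v))"
    using limit by (simp add: bst_limit_def)
  then show ?thesis
    using AE_all_grown AE_space
  proof eventually_elim
    case (elim \<omega>)
    have "sets (Xinf \<omega>) = sets (restrict_space borel boundary)"
      using measurable_space[OF measurable_prob_algebraD[OF measurable_Xinf] elim(3)]
      by (simp add: space_subprob_algebra)
    then show ?case using mass_limit[OF elim(1)] elim(2) by blast
  qed
qed

lemma AE_mass_le_1: "AE \<omega> in M. \<forall>u. mass (Xinf \<omega>) u \<le> 1"
  using AE_mass_limit AE_all_grown
proof eventually_elim
  case (elim \<omega>)
  show ?case
  proof
    fix u
    have "\<forall>n\<ge>1. real (subtree_size (X n \<omega>) u) / real n \<le> 1"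
      using elim(2) subtree_size_le by (auto simp: divide_le_eq)
    then show "mass (Xinf \<omega>) u \<le> 1" using LIMSEQ_le_const2[OF elim(1)[rule_format, of u]] by blast
  qed
qed

lemmas mass_measurable [measurable] = measurable_mass[OF measurable_Xinf]

text \<open>The index is shifted because nothing is assumed about \<open>X 0\<close>. The remainder
  after k levels is the scaled sum of the excesses on level k, by
  \<open>excess_eq_toll_sum\<close>.\<close>

sublocale Y: truncation M
  "\<lambda>n k \<omega>. toll_part (Suc n) k (X (Suc n) \<omega>)"
  "\<lambda>k \<omega>. \<Sum>v | length v < k. mass (Xinf \<omega>) v * C_fun (mass (Xinf \<omega>) (v @ [False]) / mass (Xinf \<omega>) v)"
  "\<lambda>n \<omega>. excess (X (Suc n) \<omega>) [] / (real (Suc n) + 1)"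
  256
  "\<lambda>k. real (card {v :: bool list. length v < k}) * 42"
proof unfold_locales
  fix n k
  show "(\<lambda>\<omega>. toll_part (Suc n) k (X (Suc n) \<omega>)) \<in> borel_measurable M"
    by (rule measurable_fun1[where f = "\<lambda>x. toll_part (Suc n) k x"]) simp
  show "(\<lambda>\<omega>. excess (X (Suc n) \<omega>) [] / (real (Suc n) + 1)) \<in> borel_measurable M"
    by (rule measurable_fun1[where f = "\<lambda>x. excess x [] / (real (Suc n) + 1)"]) simp
  show "AE \<omega> in M. \<bar>toll_part (Suc n) k (X (Suc n) \<omega>)\<bar>
      \<le> real (card {v :: bool list. length v < k}) * 42"
    using AE_all_grown
  proof eventually_elim
    case (elim \<omega>)
    have "\<bar>toll_part (Suc n) k (X (Suc n) \<omega>)\<bar>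
       = \<bar>\<Sum>v | length v < k. toll (X (Suc n) \<omega>) v\<bar> / (real (Suc n) + 1)"
      by (simp add: toll_part_def)
    also have "\<dots> \<le> (\<Sum>v | length v < k. \<bar>toll (X (Suc n) \<omega>) v\<bar>) / (real (Suc n) + 1)"
      by (intro divide_right_mono sum_abs) simp
    also have "\<dots> = (\<Sum>v | length v < k. \<bar>toll (X (Suc n) \<omega>) v\<bar> / (real (Suc n) + 1))"
      by (rule sum_divide_distrib)
    also have "\<dots> \<le> (\<Sum>v :: bool list | length v < k. 42)"
      by (intro sum_mono toll_bound) (use elim in simp)
    finally show ?case by simp
  qed
  show "integrable M (\<lambda>\<omega>. (excess (X (Suc n) \<omega>) [] / (real (Suc n) + 1)
      - toll_part (Suc n) k (X (Suc n) \<omega>))\<^sup>2)"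
    by (rule integrable_fun1[where f = "\<lambda>x. (excess x [] / (real (Suc n) + 1)
      - toll_part (Suc n) k x)\<^sup>2"]) simp
  have "expectation (\<lambda>\<omega>. (excess (X (Suc n) \<omega>) [] / (real (Suc n) + 1)
      - toll_part (Suc n) k (X (Suc n) \<omega>))\<^sup>2)
    \<le> expectation (\<lambda>\<omega>. ((\<Sum>v | length v = k. excess (X (Suc n) \<omega>) v) / (real (Suc n) + 1))\<^sup>2)"
  proof (rule expectation_mono_grown)
    fix x assume x: "grown (Suc n) x"
    have "excess x [] / (real (Suc n) + 1) - toll_part (Suc n) k x
      = (\<Sum>v | length v = k. excess x v) / (real (Suc n) + 1)"
      using excess_eq_toll_sum[OF grown_finite[OF x] grown_binary_tree[OF x], of k]
      by (simp add: toll_part_def diff_divide_distrib[symmetric])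
    then show "(excess x [] / (real (Suc n) + 1) - toll_part (Suc n) k x)\<^sup>2
      \<le> ((\<Sum>v | length v = k. excess x v) / (real (Suc n) + 1))\<^sup>2" by (simp only: order_refl)
  qed simp
  also have "\<dots> \<le> 256 * (4/5) ^ k" by (rule expectation_excess_level) simp
  finally show "expectation (\<lambda>\<omega>. (excess (X (Suc n) \<omega>) [] / (real (Suc n) + 1)
      - toll_part (Suc n) k (X (Suc n) \<omega>))\<^sup>2) \<le> 256 * (4/5) ^ k" .
next
  fix k
  show "(\<lambda>\<omega>. \<Sum>v | length v < k. mass (Xinf \<omega>) v * C_fun (mass (Xinf \<omega>) (v @ [False]) / mass (Xinf \<omega>) v))
      \<in> borel_measurable M"
    unfolding C_fun_def by measurable
  show "AE \<omega> in M. (\<lambda>n. toll_part (Suc n) k (X (Suc n) \<omega>))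
      \<longlonglongrightarrow> (\<Sum>v | length v < k. mass (Xinf \<omega>) v * C_fun (mass (Xinf \<omega>) (v @ [False]) / mass (Xinf \<omega>) v))"
    using AE_all_grown AE_mass_limit
  proof eventually_elim
    case (elim \<omega>)
    have "(\<lambda>n. toll (X (Suc n) \<omega>) v / (real (Suc n) + 1))
        \<longlonglongrightarrow> mass (Xinf \<omega>) v * C_fun (mass (Xinf \<omega>) (v @ [False]) / mass (Xinf \<omega>) v)" for v
      by (rule LIMSEQ_Suc[OF toll_limit]) (use elim in auto)
    then show ?case unfolding toll_part_def sum_divide_distrib by (intro tendsto_sum)
  qed
qed

sublocale Z: truncation M
  "\<lambda>n k \<omega>. square_part (Suc n) k (X (Suc n) \<omega>)"
  "\<lambda>k \<omega>. \<Sum>u | length u < k. (mass (Xinf \<omega>) u)\<^sup>2"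
  "\<lambda>n \<omega>. square_tail 0 (X (Suc n) \<omega>)"
  360
  "\<lambda>k. real (card {v :: bool list. length v < k})"
proof unfold_locales
  fix n k
  show "(\<lambda>\<omega>. square_part (Suc n) k (X (Suc n) \<omega>)) \<in> borel_measurable M"
    by (rule measurable_fun1[where f = "\<lambda>x. square_part (Suc n) k x"]) simp
  show "(\<lambda>\<omega>. square_tail 0 (X (Suc n) \<omega>)) \<in> borel_measurable M"
    by (rule measurable_fun1[where f = "square_tail 0"]) simp
  show "AE \<omega> in M. \<bar>square_part (Suc n) k (X (Suc n) \<omega>)\<bar>
      \<le> real (card {v :: bool list. length v < k})"
    using AE_all_grown
  proof eventually_elim
    case (elim \<omega>)
    then have "grown (Suc n) (X (Suc n) \<omega>)" by simp
    then have "real (subtree_size (X (Suc n) \<omega>) u) / real (Suc n) \<le> 1" for u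
      using subtree_size_le[of "Suc n" "X (Suc n) \<omega>" u] by (simp only: divide_le_eq) auto
    then have "square_part (Suc n) k (X (Suc n) \<omega>) \<le> (\<Sum>u :: bool list | length u < k. 1)"
      unfolding square_part_def by (intro sum_mono power_le_one) auto
    then show ?case by (simp add: square_part_def sum_nonneg)
  qed
  show "integrable M (\<lambda>\<omega>. (square_tail 0 (X (Suc n) \<omega>)
      - square_part (Suc n) k (X (Suc n) \<omega>))\<^sup>2)"
    by (rule integrable_fun1[where f = "\<lambda>x. (square_tail 0 x
      - square_part (Suc n) k x)\<^sup>2"]) simp
  have "expectation (\<lambda>\<omega>. (square_tail 0 (X (Suc n) \<omega>)
      - square_part (Suc n) k (X (Suc n) \<omega>))\<^sup>2)
    \<le> expectation (\<lambda>\<omega>. (square_tail k (X (Suc n) \<omega>))\<^sup>2)"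
  proof (rule expectation_mono_grown)
    fix x assume x: "grown (Suc n) x"
    show "(square_tail 0 x - square_part (Suc n) k x)\<^sup>2
      \<le> (square_tail k x)\<^sup>2"
      unfolding square_tail_split[OF x, of k] by simp
  qed simp
  also have "\<dots> \<le> 360 * (4/5) ^ k" by (rule expectation_square_tail) simp
  finally show "expectation (\<lambda>\<omega>. (square_tail 0 (X (Suc n) \<omega>)
      - square_part (Suc n) k (X (Suc n) \<omega>))\<^sup>2) \<le> 360 * (4/5) ^ k" .
next
  fix k
  show "(\<lambda>\<omega>. \<Sum>u | length u < k. (mass (Xinf \<omega>) u)\<^sup>2) \<in> borel_measurable M"
    by measurable
  show "AE \<omega> in M. (\<lambda>n. square_part (Suc n) k (X (Suc n) \<omega>))
      \<longlonglongrightarrow> (\<Sum>u | length u < k. (mass (Xinf \<omega>) u)\<^sup>2)"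
    using AE_mass_limit
  proof eventually_elim
    case (elim \<omega>)
    show ?case
      unfolding square_part_def by (intro tendsto_sum tendsto_power) (rule LIMSEQ_Suc[OF elim[rule_format]])
  qed
qed

section \<open>Identification of the limiting functionals Y and Z\<close>

lemma Y_partial_eq:
  "Y_partial (Xinf \<omega>) k = (\<Sum>v | length v < Suc k. mass (Xinf \<omega>) v
    * C_fun (mass (Xinf \<omega>) (v @ [False]) / mass (Xinf \<omega>) v))"
  by (simp add: Y_partial_def less_Suc_eq_le)

lemma AE_Y_lim: "AE \<omega> in M. Y_partial (Xinf \<omega>) \<longlonglongrightarrow> Y.L \<omega> \<and> Y_lim (Xinf \<omega>) = Y.L \<omega>"
  using Y.B_tendsto
proof eventually_elim
  case (elim \<omega>)
  \<comment> \<open>Levels up to and including k are those below \<open>Suc k\<close>, so this is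
    the truncated sequence shifted by one.\<close>
  have "Y_partial (Xinf \<omega>) \<longlonglongrightarrow> Y.L \<omega>" using LIMSEQ_Suc[OF elim] unfolding Y_partial_eq[symmetric] .
  then show ?case by (simp add: Y_lim_def limI)
qed

lemma AE_Z_lim:
  "AE \<omega> in M. (\<lambda>u. (mass (Xinf \<omega>) u)\<^sup>2) summable_on UNIV \<and> Z_lim (Xinf \<omega>) = Z.L \<omega>"
  using Z.B_tendsto
proof eventually_elim
  case (elim \<omega>)
  have "incseq (\<lambda>k. \<Sum>u | length u < k. (mass (Xinf \<omega>) u)\<^sup>2)"
    by (intro incseq_SucI) (simp add: below_Suc_sum sum_nonneg)
  then have "(\<Sum>u | length u < k. (mass (Xinf \<omega>) u)\<^sup>2) \<le> Z.L \<omega>" for k by (rule incseq_le[OF _ elim])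
  then have s: "(\<lambda>u. (mass (Xinf \<omega>) u)\<^sup>2) summable_on UNIV" by (intro summable_on_levels) auto
  then show ?case using LIMSEQ_unique[OF elim infsum_levels[OF s]] by (simp add: Z_lim_def)
qed

lemma measurable_Y_lim [measurable]: "(\<lambda>\<omega>. Y_lim (Xinf \<omega>)) \<in> borel_measurable M"
  unfolding Y_lim_def Y_partial_def C_fun_def by measurable

lemma measurable_Z_lim [measurable]: "(\<lambda>\<omega>. Z_lim (Xinf \<omega>)) \<in> borel_measurable M"
  unfolding Z_lim_def by (subst infsum_eq_SUP) simp_all

lemma measurable_W_lim [measurable]: "(\<lambda>\<omega>. W_lim (Xinf \<omega>)) \<in> borel_measurable M"
  unfolding W_lim_def by measurable

lemma AE_W_lim: "AE \<omega> in M. W_lim (Xinf \<omega>) = 2 * euler_mascheroni - 3 + (Y.L \<omega> - Z.L \<omega>)"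
  using AE_Y_lim AE_Z_lim by eventually_elim (simp add: W_lim_def)

lemma integrable_cong_AE_real:
  fixes f g :: "'a \<Rightarrow> real"
  assumes "f \<in> borel_measurable M" "g \<in> borel_measurable M" "AE x in M. f x = g x" "integrable M g"
  shows "integrable M f"
  using assms integrable_cong_AE[of f M g] by auto

lemma sq_integrable_Z_lim: "sq_integrable M (\<lambda>\<omega>. Z_lim (Xinf \<omega>))"
  unfolding sq_integrable_def
proof
  have "AE \<omega> in M. (Z_lim (Xinf \<omega>))\<^sup>2 = (Z.L \<omega>)\<^sup>2" using AE_Z_lim by eventually_elim simp
  then show "integrable M (\<lambda>\<omega>. (Z_lim (Xinf \<omega>))\<^sup>2)"
    by (intro integrable_cong_AE_real[OF _ _ _ Z.L_square_integrable]) auto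
qed measurable

lemma sq_integrable_finite_sum:
  assumes "finite F"
  shows "sq_integrable M (\<lambda>\<omega>. \<Sum>u\<in>F. (mass (Xinf \<omega>) u)\<^sup>2)"
  unfolding sq_integrable_def
proof
  show "integrable M (\<lambda>\<omega>. (\<Sum>u\<in>F. (mass (Xinf \<omega>) u)\<^sup>2)\<^sup>2)"
  proof (rule integrable_const_bound)
    show "AE \<omega> in M. norm ((\<Sum>u\<in>F. (mass (Xinf \<omega>) u)\<^sup>2)\<^sup>2) \<le> (real (card F))\<^sup>2"
      using AE_mass_le_1
    proof eventually_elim
      case (elim \<omega>)
      have "(\<Sum>u\<in>F. (mass (Xinf \<omega>) u)\<^sup>2) \<le> (\<Sum>u\<in>F. 1)"
        using elim mass_nonneg by (intro sum_mono power_le_one) auto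
      then show ?case by (simp add: power_mono sum_nonneg)
    qed
  qed measurable
qed measurable

text \<open>Convergence is along all finite sets of nodes. The terms are nonnegative, so once a set
  contains the levels below k, its remainder is at most that of the level truncation.\<close>

lemma tendsto_L2_Z:
  "tendsto_L2 M (\<lambda>F \<omega>. \<Sum>u\<in>F. (mass (Xinf \<omega>) u)\<^sup>2) (\<lambda>\<omega>. Z_lim (Xinf \<omega>)) (finite_subsets_at_top UNIV)"
  unfolding tendsto_L2_def
proof (intro conjI sq_integrable_Z_lim)
  show "\<forall>\<^sub>F F in finite_subsets_at_top UNIV. sq_integrable M (\<lambda>\<omega>. \<Sum>u\<in>F. (mass (Xinf \<omega>) u)\<^sup>2)"
    by (intro eventually_finite_subsets_at_top_weakI sq_integrable_finite_sum)
  show "((\<lambda>F. expectation (\<lambda>\<omega>. ((\<Sum>u\<in>F. (mass (Xinf \<omega>) u)\<^sup>2) - Z_lim (Xinf \<omega>))\<^sup>2)) \<longlongrightarrow> 0)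
      (finite_subsets_at_top UNIV)"
  proof (rule tendstoI)
    fix e :: real assume e: "0 < e"
    have "(\<lambda>k. 4 * 360 * (4/5) ^ k) \<longlonglongrightarrow> (4 * 360 * 0 :: real)"
      by (intro tendsto_mult tendsto_const LIMSEQ_realpow_zero) auto
    from LIMSEQ_D[OF this e] obtain k where k: "4 * 360 * (4/5 :: real) ^ k < e" by auto
    have "dist (expectation (\<lambda>\<omega>. ((\<Sum>u\<in>F. (mass (Xinf \<omega>) u)\<^sup>2) - Z_lim (Xinf \<omega>))\<^sup>2)) 0 < e"
      if F: "finite F" "{u. length u < k} \<subseteq> F" for F
    proof -
      have "AE \<omega> in M. ((\<Sum>u\<in>F. (mass (Xinf \<omega>) u)\<^sup>2) - Z_lim (Xinf \<omega>))\<^sup>2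
        \<le> (Z.L \<omega> - (\<Sum>u | length u < k. (mass (Xinf \<omega>) u)\<^sup>2))\<^sup>2"
        using AE_Z_lim
      proof eventually_elim
        case (elim \<omega>)
        let ?f = "\<lambda>u. (mass (Xinf \<omega>) u)\<^sup>2"
        have "(\<Sum>u | length u < k. ?f u) \<le> sum ?f F" using F by (intro sum_mono2) auto
        moreover have "sum ?f F \<le> infsum ?f UNIV"
          using elim F(1) by (intro finite_sum_le_infsum) auto
        ultimately have "\<bar>sum ?f F - Z.L \<omega>\<bar> \<le> Z.L \<omega> - (\<Sum>u | length u < k. ?f u)"
          using elim by (simp add: Z_lim_def)
        from power_mono[OF this abs_ge_zero, of 2] show ?case using elim by simp
      qed
      moreover have "integrable M (\<lambda>\<omega>. ((\<Sum>u\<in>F. (mass (Xinf \<omega>) u)\<^sup>2) - Z_lim (Xinf \<omega>))\<^sup>2)"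
        using sq_integrable_Z_lim sq_integrable_finite_sum[OF F(1)] unfolding sq_integrable_def
        by (intro integrable_real_square_diff(1)) auto
      ultimately have "expectation (\<lambda>\<omega>. ((\<Sum>u\<in>F. (mass (Xinf \<omega>) u)\<^sup>2) - Z_lim (Xinf \<omega>))\<^sup>2)
        \<le> expectation (\<lambda>\<omega>. (Z.L \<omega> - (\<Sum>u | length u < k. (mass (Xinf \<omega>) u)\<^sup>2))\<^sup>2)"
        using Z.L_diff(1) by (intro integral_mono_AE) auto
      also have "\<dots> \<le> 4 * 360 * (4/5) ^ k" by (rule Z.L_diff(2))
      also note k
      finally show ?thesis by (simp add: dist_real_def)
    qed
    then show "\<forall>\<^sub>F F in finite_subsets_at_top UNIV.
        dist (expectation (\<lambda>\<omega>. ((\<Sum>u\<in>F. (mass (Xinf \<omega>) u)\<^sup>2) - Z_lim (Xinf \<omega>))\<^sup>2)) 0 < e"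
      unfolding eventually_finite_subsets_at_top by (intro exI[of _ "{u. length u < k}"]) auto
  qed
qed

section \<open>Limit and rate of the martingale\<close>

abbreviation compensated_at :: "nat \<Rightarrow> 'a \<Rightarrow> real"
  where "compensated_at n \<omega> \<equiv> compensated (Suc n) (X (Suc n) \<omega>)"

lemma martingale_measurable [measurable]: "compensated_at n \<in> borel_measurable M"
  by (rule measurable_fun1) simp

lemma martingale_square_integrable: "integrable M (\<lambda>\<omega>. (compensated_at n \<omega>)\<^sup>2)"
  by (rule integrable_fun1[where f = "\<lambda>x. (compensated (Suc n) x)\<^sup>2"]) simp

lemma limit_square_integrable: "integrable M (\<lambda>\<omega>. (Y.L \<omega> - Z.L \<omega>)\<^sup>2)"
  by (intro integrable_real_square_diff(1) Y.L_square_integrable Z.L_square_integrable) auto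

text \<open>Up to an error with mean square O(1/n), the martingale is the scaled excess at the root
  minus the scaled square sum, whose limits the two truncations provide.\<close>

lemma martingale_tendsto: "(\<lambda>n. expectation (\<lambda>\<omega>. (compensated_at n \<omega> - (Y.L \<omega> - Z.L \<omega>))\<^sup>2)) \<longlonglongrightarrow> 0"
proof (rule tendsto_sandwich[where f = "\<lambda>_. 0"])
  let ?Y = "\<lambda>n \<omega>. excess (X (Suc n) \<omega>) [] / (real (Suc n) + 1)" and ?Z = "\<lambda>n \<omega>. square_tail 0 (X (Suc n) \<omega>)"
  let ?y = "\<lambda>n. expectation (\<lambda>\<omega>. (?Y n \<omega> - Y.L \<omega>)\<^sup>2)" and ?z = "\<lambda>n. expectation (\<lambda>\<omega>. (?Z n \<omega> - Z.L \<omega>)\<^sup>2)"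
  show "(\<lambda>n. 2 * (163410 / real (Suc n)) + 2 * (2 * ?y n + 2 * ?z n)) \<longlonglongrightarrow> 0"
  proof -
    have "(\<lambda>n. 163410 / real (Suc n)) \<longlonglongrightarrow> 0" by real_asymp
    then have "(\<lambda>n. 2 * (163410 / real (Suc n)) + 2 * (2 * ?y n + 2 * ?z n)) \<longlonglongrightarrow> 2 * 0 + 2 * (2 * 0 + 2 * 0)"
      using Y.D_tendsto Z.D_tendsto by (intro tendsto_intros)
    then show ?thesis by simp
  qed
  have "expectation (\<lambda>\<omega>. (compensated_at n \<omega> - (Y.L \<omega> - Z.L \<omega>))\<^sup>2) \<le> 2 * (163410 / real (Suc n)) + 2 * (2 * ?y n + 2 * ?z n)" for n
  proof -
    let ?e = "\<lambda>x. compensated (Suc n) x - (excess x [] / (real (Suc n) + 1) - square_tail 0 x)"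
    have int: "integrable M (\<lambda>\<omega>. (?e (X (Suc n) \<omega>))\<^sup>2)"
      by (rule integrable_fun1[where f = "\<lambda>x. (?e x)\<^sup>2"]) simp
    have meas: "(\<lambda>\<omega>. ?e (X (Suc n) \<omega>)) \<in> borel_measurable M" by (rule measurable_fun1[where f = ?e]) simp
    have int2: "integrable M (\<lambda>\<omega>. ((?Y n \<omega> - Y.L \<omega>) - (?Z n \<omega> - Z.L \<omega>))\<^sup>2)"
      by (intro integrable_real_square_diff(1) Y.D_L_integrable Z.D_L_integrable) measurable
    have eq: "compensated_at n \<omega> - (Y.L \<omega> - Z.L \<omega>) = ?e (X (Suc n) \<omega>) + ((?Y n \<omega> - Y.L \<omega>) - (?Z n \<omega> - Z.L \<omega>))" for \<omega>
      by argo
    have "expectation (\<lambda>\<omega>. (compensated_at n \<omega> - (Y.L \<omega> - Z.L \<omega>))\<^sup>2)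
      = expectation (\<lambda>\<omega>. (?e (X (Suc n) \<omega>) + ((?Y n \<omega> - Y.L \<omega>) - (?Z n \<omega> - Z.L \<omega>)))\<^sup>2)"
      unfolding eq ..
    also have "\<dots> \<le> 2 * expectation (\<lambda>\<omega>. (?e (X (Suc n) \<omega>))\<^sup>2)
        + 2 * expectation (\<lambda>\<omega>. ((?Y n \<omega> - Y.L \<omega>) - (?Z n \<omega> - Z.L \<omega>))\<^sup>2)"
      by (intro integrable_real_square_add(2) meas int int2) measurable
    also have "expectation (\<lambda>\<omega>. (?e (X (Suc n) \<omega>))\<^sup>2) \<le> 163410 / real (Suc n)"
      by (rule expectation_error[where f = ?e]) (simp, rule compensated_error)
    also have "expectation (\<lambda>\<omega>. ((?Y n \<omega> - Y.L \<omega>) - (?Z n \<omega> - Z.L \<omega>))\<^sup>2) \<le> 2 * ?y n + 2 * ?z n"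
      by (intro integrable_real_square_diff(2) Y.D_L_integrable Z.D_L_integrable) measurable
    finally show ?thesis by simp
  qed
  then show "\<forall>\<^sub>F n in sequentially. expectation (\<lambda>\<omega>. (compensated_at n \<omega> - (Y.L \<omega> - Z.L \<omega>))\<^sup>2)
      \<le> 2 * (163410 / real (Suc n)) + 2 * (2 * ?y n + 2 * ?z n)" by simp
qed auto

text \<open>Compare with a later time m and let m tend to infinity; 512 is twice the constant of
  \<open>compensated_diff\<close>. No rate is required of \<open>martingale_tendsto\<close>.\<close>

lemma martingale_rate: "expectation (\<lambda>\<omega>. (compensated_at n \<omega> - (Y.L \<omega> - Z.L \<omega>))\<^sup>2) \<le> 512 / sqrt (real (Suc n))"
proof -
  let ?d = "\<lambda>m. expectation (\<lambda>\<omega>. (compensated_at m \<omega> - (Y.L \<omega> - Z.L \<omega>))\<^sup>2)"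
  have "?d n \<le> 512 / sqrt (real (Suc n)) + 2 * ?d m" if "n \<le> m" for m
  proof -
    have int: "integrable M (\<lambda>\<omega>. (compensated_at m \<omega> - (Y.L \<omega> - Z.L \<omega>))\<^sup>2)" "integrable M (\<lambda>\<omega>. (compensated_at m \<omega> - compensated_at n \<omega>)\<^sup>2)"
      by (intro integrable_real_square_diff(1) martingale_square_integrable limit_square_integrable; measurable)+
    have eq: "compensated_at n \<omega> - (Y.L \<omega> - Z.L \<omega>) = (compensated_at m \<omega> - (Y.L \<omega> - Z.L \<omega>)) - (compensated_at m \<omega> - compensated_at n \<omega>)" for \<omega>
      by argo
    have "?d n = expectation (\<lambda>\<omega>. ((compensated_at m \<omega> - (Y.L \<omega> - Z.L \<omega>)) - (compensated_at m \<omega> - compensated_at n \<omega>))\<^sup>2)"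
      by (subst eq) (rule refl)
    also have "\<dots> \<le> 2 * ?d m + 2 * expectation (\<lambda>\<omega>. (compensated_at m \<omega> - compensated_at n \<omega>)\<^sup>2)"
      by (intro integrable_real_square_diff(2) int) measurable
    also have "expectation (\<lambda>\<omega>. (compensated_at m \<omega> - compensated_at n \<omega>)\<^sup>2) \<le> 256 * (1 / sqrt (real (Suc n)) - 1 / sqrt (real (Suc m)))"
      using that by (intro compensated_diff) auto
    also have "\<dots> \<le> 256 * (1 / sqrt (real (Suc n)))" by (intro mult_left_mono) auto
    finally show ?thesis by simp
  qed
  then have ev: "\<exists>K. \<forall>m\<ge>K. ?d n \<le> 512 / sqrt (real (Suc n)) + 2 * ?d m" by blast
  have "(\<lambda>m. 512 / sqrt (real (Suc n)) + 2 * ?d m) \<longlonglongrightarrow> 512 / sqrt (real (Suc n)) + 2 * 0"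
    by (intro tendsto_intros martingale_tendsto)
  from LIMSEQ_le_const[OF this ev] show ?thesis by simp
qed

section \<open>The normalised Wiener index\<close>

abbreviation normalized_wiener :: "nat \<Rightarrow> 'a \<Rightarrow> real"
  where "normalized_wiener n \<omega> \<equiv> wiener_index (X n \<omega>) / (real n)\<^sup>2 - 2 * ln (real n)"

lemma wiener_measurable: "1 \<le> n \<Longrightarrow> normalized_wiener n \<in> borel_measurable M"
  by (rule measurable_fun1[where f = "\<lambda>x. wiener_index x / (real n)\<^sup>2 - 2 * ln (real n)"])

lemma wiener_square_integrable: "1 \<le> n \<Longrightarrow> integrable M (\<lambda>\<omega>. (normalized_wiener n \<omega>)\<^sup>2)"
  by (rule integrable_fun1[where f = "\<lambda>x. (wiener_index x / (real n)\<^sup>2 - 2 * ln (real n))\<^sup>2"])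

lemma W_square_integrable: "integrable M (\<lambda>\<omega>. (W_lim (Xinf \<omega>))\<^sup>2)"
proof -
  have ae: "AE \<omega> in M. (W_lim (Xinf \<omega>))\<^sup>2 = ((2 * euler_mascheroni - 3) + (Y.L \<omega> - Z.L \<omega>))\<^sup>2"
    using AE_W_lim by eventually_elim simp
  have int: "integrable M (\<lambda>\<omega>. ((2 * euler_mascheroni - 3) + (Y.L \<omega> - Z.L \<omega>))\<^sup>2)"
    by (intro integrable_real_square_add(1) limit_square_integrable) auto
  show ?thesis by (rule integrable_cong_AE_real[OF _ _ ae int]) measurable
qed

text \<open>The martingale rate n^(-1/2) dominates the error of order 1/n; 327844 = 2 * 163410 + 2 *
  512.\<close>

lemma wiener_rate:
  assumes "1 \<le> n"
  shows "expectation (\<lambda>\<omega>. (normalized_wiener n \<omega> - W_lim (Xinf \<omega>))\<^sup>2) \<le> 327844 / sqrt (real n)"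
proof -
  obtain m where m: "n = Suc m" using assms by (cases n) auto
  let ?e = "\<lambda>x. wiener_index x / (real n)\<^sup>2 - 2 * ln (real n) - (compensated n x + 2 * euler_mascheroni - 3)"
  have int: "integrable M (\<lambda>\<omega>. (?e (X n \<omega>))\<^sup>2)"
    by (rule integrable_fun1[where f = "\<lambda>x. (?e x)\<^sup>2"]) fact
  have meas: "(\<lambda>\<omega>. ?e (X n \<omega>)) \<in> borel_measurable M" by (rule measurable_fun1[where f = ?e]) fact
  have int2: "integrable M (\<lambda>\<omega>. (compensated_at m \<omega> - (Y.L \<omega> - Z.L \<omega>))\<^sup>2)"
    by (intro integrable_real_square_diff(1) martingale_square_integrable limit_square_integrable) measurable
  have "AE \<omega> in M. (normalized_wiener n \<omega> - W_lim (Xinf \<omega>))\<^sup>2 = (?e (X n \<omega>) + (compensated_at m \<omega> - (Y.L \<omega> - Z.L \<omega>)))\<^sup>2"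
    using AE_W_lim
  proof eventually_elim
    case (elim \<omega>)
    then have "normalized_wiener n \<omega> - W_lim (Xinf \<omega>) = ?e (X n \<omega>) + (compensated_at m \<omega> - (Y.L \<omega> - Z.L \<omega>))" by (simp add: m)
    then show ?case by (simp only:)
  qed
  then have "expectation (\<lambda>\<omega>. (normalized_wiener n \<omega> - W_lim (Xinf \<omega>))\<^sup>2) = expectation (\<lambda>\<omega>. (?e (X n \<omega>) + (compensated_at m \<omega> - (Y.L \<omega> - Z.L \<omega>)))\<^sup>2)"
    using wiener_measurable[OF assms] meas by (intro integral_cong_AE) auto
  also have "\<dots> \<le> 2 * expectation (\<lambda>\<omega>. (?e (X n \<omega>))\<^sup>2) + 2 * expectation (\<lambda>\<omega>. (compensated_at m \<omega> - (Y.L \<omega> - Z.L \<omega>))\<^sup>2)"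
    by (intro integrable_real_square_add(2) meas int int2) measurable
  also have "expectation (\<lambda>\<omega>. (?e (X n \<omega>))\<^sup>2) \<le> 163410 / real n"
    by (rule expectation_error[where f = ?e]) (fact, rule wiener_index_error)
  also have "163410 / real n \<le> 163410 / sqrt (real n)"
    using assms by (intro divide_left_mono) (auto intro: real_le_lsqrt simp: power2_eq_square)
  also have "expectation (\<lambda>\<omega>. (compensated_at m \<omega> - (Y.L \<omega> - Z.L \<omega>))\<^sup>2) \<le> 512 / sqrt (real n)"
    using martingale_rate[of m] by (simp add: m)
  finally show ?thesis by simp
qed

lemma AE_tendsto_wiener: "AE \<omega> in M. (\<lambda>n. normalized_wiener n \<omega>) \<longlonglongrightarrow> W_lim (Xinf \<omega>)"
proof -
  \<comment> \<open>Along these times the mean square error is a multiple of 1 / (k + 1)^2, which is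
    summable. Any exponent above 2 would achieve this; 4 makes the root an exact square.\<close>
  let ?q = "\<lambda>k. Suc k ^ 4"
  have q: "1 \<le> ?q k" for k by simp
  have "AE \<omega> in M. summable (\<lambda>k. (normalized_wiener (?q k) \<omega> - W_lim (Xinf \<omega>))\<^sup>2)"
  proof (rule AE_summable[where c = "\<lambda>k. 327844 * inverse ((real (Suc k))\<^sup>2)"])
    fix k
    show "integrable M (\<lambda>\<omega>. (normalized_wiener (?q k) \<omega> - W_lim (Xinf \<omega>))\<^sup>2)"
      by (intro integrable_real_square_diff(1) wiener_measurable wiener_square_integrable W_square_integrable q) measurable
    have "sqrt (real (?q k)) = (real (Suc k))\<^sup>2"
      by (rule real_sqrt_unique) (simp_all add: power_mult[symmetric])
    then show "expectation (\<lambda>\<omega>. (normalized_wiener (?q k) \<omega> - W_lim (Xinf \<omega>))\<^sup>2) \<le> 327844 * inverse ((real (Suc k))\<^sup>2)"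
      using wiener_rate[OF q, of k] by (simp add: divide_inverse)
    show "summable (\<lambda>k. 327844 * inverse ((real (Suc k))\<^sup>2))"
      using inverse_squares_sums[THEN sums_summable] by (intro summable_mult) (simp add: inverse_eq_divide add.commute)
  qed auto
  moreover have "AE \<omega> in M. \<forall>n. 1 \<le> n \<longrightarrow> (\<exists>u\<in>external_nodes (X n \<omega>). X (Suc n) \<omega> = insert u (X n \<omega>))"
    unfolding AE_all_countable
  proof
    fix n
    show "AE \<omega> in M. 1 \<le> n \<longrightarrow> (\<exists>u\<in>external_nodes (X n \<omega>). X (Suc n) \<omega> = insert u (X n \<omega>))"
      using AE_step[of n] by (cases "1 \<le> n") auto
  qed
  ultimately show ?thesis
    using AE_all_grown
  proof eventually_elim
    case (elim \<omega>)
    let ?w = "\<lambda>n. wiener_index (X n \<omega>)"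
    have step: "?w n \<le> ?w (Suc n)" if "1 \<le> n" for n
      using elim(2,3) that wiener_index_mono[of n "X n \<omega>"] by metis
    have mono: "?w m \<le> ?w n" if "1 \<le> m" "m \<le> n" for m n
      using that(2)
    proof (induction n rule: dec_induct)
      case (step n)
      then show ?case using \<open>\<And>n. 1 \<le> n \<Longrightarrow> ?w n \<le> ?w (Suc n)\<close>[of n] that(1) by simp
    qed simp
    have nonneg: "0 \<le> ?w n" for n
      unfolding wiener_index_def by (auto intro!: sum_nonneg)
    have "(\<lambda>k. (normalized_wiener (?q k) \<omega> - W_lim (Xinf \<omega>))\<^sup>2) \<longlonglongrightarrow> 0"
      using elim(1) by (rule summable_LIMSEQ_zero)
    then have "(\<lambda>k. sqrt ((normalized_wiener (?q k) \<omega> - W_lim (Xinf \<omega>))\<^sup>2)) \<longlonglongrightarrow> sqrt 0" by (rule tendsto_real_sqrt)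
    then have "(\<lambda>k. normalized_wiener (?q k) \<omega> - W_lim (Xinf \<omega>)) \<longlonglongrightarrow> 0"
      by (simp only: real_sqrt_abs real_sqrt_zero tendsto_rabs_zero_iff)
    then have "(\<lambda>k. normalized_wiener (?q k) \<omega>) \<longlonglongrightarrow> W_lim (Xinf \<omega>)" by (rule LIM_zero_cancel)
    then have l: "(\<lambda>k. ?w (Suc k ^ 4) / (real (Suc k ^ 4))\<^sup>2 - 2 * ln (real (Suc k ^ 4))) \<longlonglongrightarrow> W_lim (Xinf \<omega>)" .
    show ?case using fourth_power_interpolation[where w = ?w, OF mono nonneg l] .
  qed
qed

lemma tendsto_L2_wiener: "tendsto_L2 M normalized_wiener (\<lambda>\<omega>. W_lim (Xinf \<omega>)) sequentially"
  unfolding tendsto_L2_def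
proof (intro conjI)
  show "\<forall>\<^sub>F n in sequentially. sq_integrable M (normalized_wiener n)"
    using eventually_ge_at_top[of 1]
    by eventually_elim (simp add: sq_integrable_def wiener_measurable wiener_square_integrable)
  show "sq_integrable M (\<lambda>\<omega>. W_lim (Xinf \<omega>))"
    by (simp add: sq_integrable_def W_square_integrable)
  show "(\<lambda>n. expectation (\<lambda>\<omega>. (normalized_wiener n \<omega> - W_lim (Xinf \<omega>))\<^sup>2)) \<longlonglongrightarrow> 0"
  proof (rule tendsto_sandwich[where f = "\<lambda>_. 0"])
    show "\<forall>\<^sub>F n in sequentially. expectation (\<lambda>\<omega>. (normalized_wiener n \<omega> - W_lim (Xinf \<omega>))\<^sup>2) \<le> 327844 / sqrt (real n)"
      using eventually_ge_at_top[of 1] by eventually_elim (rule wiener_rate)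
    show "(\<lambda>n. 327844 / sqrt (real n)) \<longlonglongrightarrow> 0" by real_asymp
  qed auto
qed

end

theorem theorem7:
  fixes M :: "'a measure"
    and X :: "nat \<Rightarrow> 'a \<Rightarrow> bool list set"
    and Xinf :: "'a \<Rightarrow> seq01 measure"
  assumes "prob_space M"
    and "bst_chain M X"
    and "bst_limit M X Xinf"
  shows "(AE \<omega> in M. (\<lambda>u. (mass (Xinf \<omega>) u)\<^sup>2) summable_on UNIV) \<and>
    tendsto_L2 M (\<lambda>F \<omega>. \<Sum>u\<in>F. (mass (Xinf \<omega>) u)\<^sup>2) (\<lambda>\<omega>. Z_lim (Xinf \<omega>))
      (finite_subsets_at_top UNIV) \<and>
    (AE \<omega> in M. convergent (Y_partial (Xinf \<omega>))) \<and>
    (AE \<omega> in M. (\<lambda>n. wiener_index (X n \<omega>) / (real n)\<^sup>2 - 2 * ln (real n))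
      \<longlonglongrightarrow> W_lim (Xinf \<omega>)) \<and>
    tendsto_L2 M (\<lambda>n \<omega>. wiener_index (X n \<omega>) / (real n)\<^sup>2 - 2 * ln (real n))
      (\<lambda>\<omega>. W_lim (Xinf \<omega>)) sequentially"
proof -
  interpret bst_with_limit M X Xinf
    using assms by (intro bst_with_limit.intro bst.intro bst_axioms.intro bst_with_limit_axioms.intro)
  have "AE \<omega> in M. convergent (Y_partial (Xinf \<omega>))"
    using AE_Y_lim by eventually_elim (auto simp: convergent_def)
  moreover have "AE \<omega> in M. (\<lambda>u. (mass (Xinf \<omega>) u)\<^sup>2) summable_on UNIV"
    using AE_Z_lim by eventually_elim simp
  ultimately show ?thesis
    using tendsto_L2_Z AE_tendsto_wiener tendsto_L2_wiener by blast
qed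

end
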